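(* Let $k\ge1$, let $P_1,\dots,P_n\in\mathbf{P}^2$ be general points, let $m_1,\dots,m_n\ge 0$ be integers and $Z=m_1P_1+\cdots+m_nP_n$. Assume $h^1(\mathcal{I}_Z(k))=0$ and moreover that there exists an integral curve $C\subset\mathbf{P}^2$ such that its strict transform $\tilde C=dL-\sum r_iE_i$ is smooth and rational in $X$, with $d\le k+2$, $r_i-1\le m_i$ for all $i$, and $$\delta_0(C,Z,k)>\text{exp-dim cok}\,\mu_k(Z).$$ Then $\mu_k(Z)$ is not of maximal rank (i.e. it is neither injective nor surjective).
   Context: $K$ is an algebraically closed field and $\mathbf{P}^2=\mathbf{P}^2_K$. $Z=m_1P_1+\cdots+m_nP_n$ is the fat point scheme with homogeneous ideal $\bigcap_iI(P_i)^{m_i}$ and ideal sheaf $\mathcal{I}_Z$. $\mu_k(Z):H^0(\mathcal{I}_Z(k))\otimes H^0(\mathcal{O}_{\mathbf{P}^2}(1))\to H^0(\mathcal{I}_Z(k+1))$ is multiplication, and $\text{exp-dim cok}\,\mu_k(Z)=\max(0,h^0(\mathcal{I}_Z(k+1))-3h^0(\mathcal{I}_Z(k)))$. $p:X\to\mathbf{P}^2$ is the blow-up at $P_1,\dots,P_n$, $E_i$ the exceptional curve over $P_i$, $L$ the pullback of a line; the strict transform of a curve $C$ of degree $d$ with multiplicity $r_i$ at $P_i$ is $\tilde C=dL-\sum r_iE_i$. $\Omega$ is the cotangent bundle of $\mathbf{P}^2$ and $\tilde Z=\sum m_iE_i\subset X$. For $\tilde C$ smooth rational, $\delta_0(C,Z,k)$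 is the dimension of the cokernel of the restriction map $$\theta_{C,Z,k}:H^0(p^*\Omega(k+1)|_{\tilde C})\to H^0(p^*\Omega(k+1)|_{\tilde C\cap\tilde Z}).$$ Writing $p^*\Omega(1)|_{\tilde C}\cong\mathcal{O}_{\tilde C}(-a)\oplus\mathcal{O}_{\tilde C}(-b)$ with $a\le b$ (so $a+b=d$; $\mathcal{O}_{\tilde C}(j)$ is the degree $j$ line bundle on $\tilde C\cong\mathbf{P}^1$), one has $\delta_0(C,Z,k)=\max(0,\sum r_im_i-dk+a-1)+\max(0,\sum r_im_i-dk+b-1)$. *)

theory Defs
  imports "HOL-Analysis.Analysis" "HOL-Library.Poly_Mapping"
    "HOL-Computational_Algebra.Polynomial"
begin

section \<open>Polynomials and Laurent polynomials in several variables\<close>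

text \<open>
  A monomial is a finitely supported exponent function and a polynomial is a finitely supported
  function on monomials. Exponents in \<^typ>\<open>nat\<close> give polynomials, exponents in \<^typ>\<open>int\<close> give
  Laurent polynomials; multiplication is the convolution product of \<^theory>\<open>HOL-Library.Poly_Mapping\<close>.
  The homogeneous coordinate rings of the projective plane and of the projective line are the
  polynomial rings with variables indexed by the types \<open>3\<close> and \<open>2\<close>.
\<close>

type_synonym ('v, 'a) mpoly = "('v \<Rightarrow>\<^sub>0 nat) \<Rightarrow>\<^sub>0 'a"
type_synonym ('v, 'a) lpoly = "('v \<Rightarrow>\<^sub>0 int) \<Rightarrow>\<^sub>0 'a"

definition Const :: "'a::zero \<Rightarrow> ('v \<Rightarrow>\<^sub>0 'e::zero) \<Rightarrow>\<^sub>0 'a" where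
  "Const c = Poly_Mapping.single 0 c"

definition Var :: "'v \<Rightarrow> ('v \<Rightarrow>\<^sub>0 'e::zero_neq_one) \<Rightarrow>\<^sub>0 'a::zero_neq_one" where
  "Var v = Poly_Mapping.single (Poly_Mapping.single v 1) 1"

definition homogeneous :: "'e::comm_monoid_add \<Rightarrow> (('v::finite \<Rightarrow>\<^sub>0 'e) \<Rightarrow>\<^sub>0 'a::zero) \<Rightarrow> bool" where
  "homogeneous d p \<longleftrightarrow>
    (\<forall>m\<in>Poly_Mapping.keys p. (\<Sum>v\<in>UNIV. Poly_Mapping.lookup m v) = d)"

definition mpoly_hom ::
    "('a::zero \<Rightarrow> 'b::comm_semiring_1) \<Rightarrow> ('v \<Rightarrow> 'b) \<Rightarrow> ('v, 'a) mpoly \<Rightarrow> 'b" where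
  "mpoly_hom h x p = (\<Sum>m\<in>Poly_Mapping.keys p.
     h (Poly_Mapping.lookup p m) * (\<Prod>v\<in>Poly_Mapping.keys m. x v ^ Poly_Mapping.lookup m v))"

definition eval :: "('v, 'a::comm_semiring_1) mpoly \<Rightarrow> ('v \<Rightarrow> 'a) \<Rightarrow> 'a" where
  "eval p x = mpoly_hom (\<lambda>c. c) x p"

definition subst ::
    "('v, 'a::comm_semiring_1) mpoly \<Rightarrow> ('v \<Rightarrow> ('w, 'a) mpoly) \<Rightarrow> ('w, 'a) mpoly" where
  "subst p x = mpoly_hom Const x p"

definition laurent :: "('v, 'a::comm_ring_1) mpoly \<Rightarrow> ('v, 'a) lpoly" where
  "laurent p = mpoly_hom Const Var p"

definition mpoly_deriv :: "'v \<Rightarrow> ('v, 'a::comm_semiring_1) mpoly \<Rightarrow> ('v, 'a) mpoly" where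
  "mpoly_deriv v p = (\<Sum>m\<in>Poly_Mapping.keys p.
     Poly_Mapping.single (m - Poly_Mapping.single v 1)
       (of_nat (Poly_Mapping.lookup m v) * Poly_Mapping.lookup p m))"

definition pm_scale :: "'a::field \<Rightarrow> ('b \<Rightarrow>\<^sub>0 'a) \<Rightarrow> 'b \<Rightarrow>\<^sub>0 'a" where
  "pm_scale c p = Poly_Mapping.map ((*) c) p"

lemma lookup_pm_scale: "Poly_Mapping.lookup (pm_scale c p) x = c * Poly_Mapping.lookup p x"
  by (auto simp: pm_scale_def Poly_Mapping.map.rep_eq when_def)

global_interpretation pm: vector_space "pm_scale :: 'a::field \<Rightarrow> ('b \<Rightarrow>\<^sub>0 'a) \<Rightarrow> 'b \<Rightarrow>\<^sub>0 'a"
  by unfold_locales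
    (auto intro!: poly_mapping_eqI simp: lookup_pm_scale lookup_add algebra_simps)

global_interpretation ideal: module "(*) :: 'b::comm_ring_1 \<Rightarrow> 'b \<Rightarrow> 'b"
  by unfold_locales (auto simp: algebra_simps)

global_interpretation free_module: module "(*s) :: 'b::comm_ring_1 \<Rightarrow> 'b^'n \<Rightarrow> 'b^'n"
  by unfold_locales (auto simp: vec_eq_iff algebra_simps)


section \<open>Points and fat points\<close>

text \<open>
  Points of the projective plane are given by homogeneous coordinates, that is, by nonzero vectors
  of type \<^typ>\<open>'a^3\<close>; every notion below is invariant under rescaling these vectors.
  Only the values \<open>P i\<close>, \<open>m i\<close>, \<open>r i\<close> with \<open>i < n\<close> matter.
\<close>

definition point_ideal :: "'a::field^3 \<Rightarrow> (3, 'a) mpoly set" where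
  "point_ideal p = ideal.span {f. (\<exists>d. homogeneous d f) \<and> eval f (($) p) = 0}"

definition ideal_power :: "'b::comm_ring_1 set \<Rightarrow> nat \<Rightarrow> 'b set" where
  "ideal_power I m = ideal.span {(\<Prod>j<m. f j) | f. \<forall>j<m. f j \<in> I}"

definition fat_ideal ::
    "nat \<Rightarrow> (nat \<Rightarrow> 'a::field^3) \<Rightarrow> (nat \<Rightarrow> nat) \<Rightarrow> (3, 'a) mpoly set" where
  "fat_ideal n P m = (\<Inter>i<n. ideal_power (point_ideal (P i)) (m i))"

text \<open>
  Closed subsets of the product of \<open>n\<close> projective planes are the zero loci of multihomogeneous
  polynomials; the variable \<open>(i, j)\<close> is the \<open>j\<close>-th coordinate of the \<open>i\<close>-th factor. The product is
  irreducible, so its nonempty open subsets are dense.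
\<close>

definition multihomogeneous :: "nat \<Rightarrow> (nat \<times> 3, 'a::zero) mpoly \<Rightarrow> bool" where
  "multihomogeneous n f \<longleftrightarrow>
    (\<forall>m\<in>Poly_Mapping.keys f. Poly_Mapping.keys m \<subseteq> {..<n} \<times> UNIV) \<and>
    (\<exists>e. \<forall>m\<in>Poly_Mapping.keys f. \<forall>i<n. (\<Sum>j\<in>UNIV. Poly_Mapping.lookup m (i, j)) = e i)"

definition zariski_open :: "nat \<Rightarrow> (nat \<Rightarrow> 'a::field^3) set \<Rightarrow> bool" where
  "zariski_open n U \<longleftrightarrow> (\<exists>S. (\<forall>f\<in>S. multihomogeneous n f) \<and>
     U = {P. (\<forall>i<n. P i \<noteq> 0) \<and> (\<exists>f\<in>S. eval f (\<lambda>(i, j). P i $ j) \<noteq> 0)})"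

definition for_general_points :: "nat \<Rightarrow> ((nat \<Rightarrow> 'a::field^3) \<Rightarrow> bool) \<Rightarrow> bool" where
  "for_general_points n Q \<longleftrightarrow> (\<exists>U. zariski_open n U \<and> U \<noteq> {} \<and> (\<forall>P\<in>U. Q P))"


section \<open>Cohomology of the ideal sheaf\<close>

text \<open>
  In this section \<open>I\<close> is the saturated homogeneous ideal of a closed subscheme, such as
  \<^const>\<open>fat_ideal\<close>; being saturated, its degree \<open>k\<close> part is the space of global sections of the
  \<open>k\<close>-th twist of the ideal sheaf.
\<close>

definition sections :: "('v::finite, 'a::field) mpoly set \<Rightarrow> nat \<Rightarrow> ('v, 'a) mpoly set" where
  "sections I k = {f \<in> I. homogeneous k f}"

definition h0 :: "('v::finite, 'a::field) mpoly set \<Rightarrow> nat \<Rightarrow> nat" where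
  "h0 I k = pm.dim (sections I k)"

text \<open>
  The localization of \<open>I\<close> at the product of the variables in \<open>V\<close>, inside the Laurent polynomial
  ring. Its degree \<open>k\<close> part is the space of sections of the \<open>k\<close>-th twist over the open set
  where no variable in \<open>V\<close> vanishes.
\<close>

definition localization :: "'v::finite set \<Rightarrow> ('v, 'a::field) mpoly set \<Rightarrow> ('v, 'a) lpoly set" where
  "localization V I = {u. \<exists>N. (\<Prod>v\<in>V. Var v) ^ N * u \<in> laurent ` I}"

text \<open>
  Vanishing of the first cohomology of the \<open>k\<close>-th twist, as Cech cohomology with respect to the
  standard affine cover: every 1-cocycle is a coboundary.
\<close>

definition h1_vanishes :: "('v::finite, 'a::field) mpoly set \<Rightarrow> nat \<Rightarrow> bool" where
  "h1_vanishes I k \<longleftrightarrow> (\<forall>c :: 'v \<Rightarrow> 'v \<Rightarrow> ('v, 'a) lpoly.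
     (\<forall>v w. c v w \<in> localization {v, w} I \<and> homogeneous (int k) (c v w)) \<and>
     (\<forall>v w z. c v w + c w z = c v z) \<longrightarrow>
     (\<exists>b. (\<forall>v. b v \<in> localization {v} I \<and> homogeneous (int k) (b v)) \<and>
          (\<forall>v w. c v w = b w - b v)))"


section \<open>The multiplication map\<close>

text \<open>
  The tensor product of two subspaces \<open>U\<close>, \<open>V\<close> of a polynomial ring is the free vector space
  \<open>free_on U V\<close> on \<open>U \<times> V\<close> modulo the bilinearity relations.
\<close>

definition free_on :: "'p set \<Rightarrow> 'q set \<Rightarrow> (('p \<times> 'q) \<Rightarrow>\<^sub>0 'a::zero) set" where
  "free_on U V = {t. Poly_Mapping.keys t \<subseteq> U \<times> V}"

definition tensor_relations ::
    "('b \<Rightarrow>\<^sub>0 'a::field) set \<Rightarrow> ('c \<Rightarrow>\<^sub>0 'a) set \<Rightarrow> ((('b \<Rightarrow>\<^sub>0 'a) \<times> ('c \<Rightarrow>\<^sub>0 'a)) \<Rightarrow>\<^sub>0 'a) set" where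
  "tensor_relations U V = pm.span
    ({Poly_Mapping.single (u + u', v) 1 - Poly_Mapping.single (u, v) 1 - Poly_Mapping.single (u', v) 1
        | u u' v. u \<in> U \<and> u' \<in> U \<and> v \<in> V} \<union>
     {Poly_Mapping.single (u, v + v') 1 - Poly_Mapping.single (u, v) 1 - Poly_Mapping.single (u, v') 1
        | u v v'. u \<in> U \<and> v \<in> V \<and> v' \<in> V} \<union>
     {Poly_Mapping.single (pm_scale c u, v) 1 - Poly_Mapping.single (u, v) c
        | c u v. u \<in> U \<and> v \<in> V} \<union>
     {Poly_Mapping.single (u, pm_scale c v) 1 - Poly_Mapping.single (u, v) c
        | c u v. u \<in> U \<and> v \<in> V})"

definition mult ::
    "((('v, 'a::field) mpoly \<times> ('v, 'a) mpoly) \<Rightarrow>\<^sub>0 'a) \<Rightarrow> ('v, 'a) mpoly" where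
  "mult t = (\<Sum>x\<in>Poly_Mapping.keys t. pm_scale (Poly_Mapping.lookup t x) (fst x * snd x))"

text \<open>
  In these two definitions \<^term>\<open>sections UNIV 1\<close> is the space of linear forms. Injectivity
  says that the kernel of \<^const>\<open>mult\<close> on the free space consists of bilinearity relations.
\<close>

definition mu_injective :: "(3, 'a::field) mpoly set \<Rightarrow> nat \<Rightarrow> bool" where
  "mu_injective I k \<longleftrightarrow> (\<forall>t \<in> free_on (sections I k) (sections UNIV 1).
     mult t = 0 \<longrightarrow> t \<in> tensor_relations (sections I k) (sections UNIV 1))"

definition mu_surjective :: "(3, 'a::field) mpoly set \<Rightarrow> nat \<Rightarrow> bool" where
  "mu_surjective I k \<longleftrightarrow>
     mult ` free_on (sections I k) (sections UNIV 1) = sections I (k + 1)"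

definition exp_dim_cok_mu :: "(3, 'a::field) mpoly set \<Rightarrow> nat \<Rightarrow> int" where
  "exp_dim_cok_mu I k = max 0 (int (h0 I (k + 1)) - 3 * int (h0 I k))"


section \<open>Curves and their strict transforms\<close>

definition integral_curve :: "nat \<Rightarrow> (3, 'a::field) mpoly \<Rightarrow> bool" where
  "integral_curve d F \<longleftrightarrow> homogeneous d F \<and> irreducible F"

definition multiplicity_at :: "(3, 'a::field) mpoly \<Rightarrow> 'a^3 \<Rightarrow> nat \<Rightarrow> bool" where
  "multiplicity_at F p r \<longleftrightarrow>
     F \<in> ideal_power (point_ideal p) r \<and> F \<notin> ideal_power (point_ideal p) (r + 1)"

definition same_point :: "'a::field^3 \<Rightarrow> 'a^3 \<Rightarrow> bool" where
  "same_point p q \<longleftrightarrow> (\<exists>c. c \<noteq> 0 \<and> q = c *s p)"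

text \<open>
  For a basis \<open>p, e, e'\<close> the point with homogeneous coordinates \<open>p + x *s e + y *s e'\<close> has affine
  coordinates \<open>(x, y)\<close> centred at \<open>p\<close>. The substitution \<open>x = u\<close>, \<open>y = u w\<close> describes a standard
  affine chart of the blow-up at \<open>p\<close>, with exceptional curve \<open>u = 0\<close>. The variables
  indexed by \<open>1\<close>, \<open>2\<close> are \<open>u\<close>, \<open>w\<close>. Exchanging \<open>e\<close> and \<open>e'\<close> gives the other chart.
\<close>

definition blowup_chart :: "'a::field^3 \<Rightarrow> 'a^3 \<Rightarrow> 'a^3 \<Rightarrow> 3 \<Rightarrow> (2, 'a) mpoly" where
  "blowup_chart p e e' j =
     Const (p $ j) + Const (e $ j) * Var 1 + Const (e' $ j) * (Var 1 * Var 2)"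

text \<open>
  Smoothness of the strict transform of the curve \<open>F = 0\<close>, which has multiplicity \<open>r i\<close> at \<open>P i\<close>, by
  the Jacobian criterion: first at its points away from the exceptional curves, then at its points
  on the exceptional curves, where \<open>g\<close> is its equation in a chart.
\<close>

definition smooth_strict_transform ::
    "nat \<Rightarrow> (nat \<Rightarrow> 'a::field^3) \<Rightarrow> (nat \<Rightarrow> nat) \<Rightarrow> (3, 'a) mpoly \<Rightarrow> bool" where
  "smooth_strict_transform n P r F \<longleftrightarrow>
     (\<forall>q. q \<noteq> 0 \<and> eval F (($) q) = 0 \<and> (\<forall>i<n. \<not> same_point (P i) q) \<longrightarrow>
        (\<exists>j. eval (mpoly_deriv j F) (($) q) \<noteq> 0)) \<and>
     (\<forall>i<n. \<forall>e e' g. det (vector [P i, e, e'] :: 'a^3^3) \<noteq> 0 \<and>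
        subst F (blowup_chart (P i) e e') = Var 1 ^ r i * g \<longrightarrow>
        (\<forall>q :: 'a^2. q $ 1 = 0 \<and> eval g (($) q) = 0 \<longrightarrow>
           (\<exists>j. eval (mpoly_deriv j g) (($) q) \<noteq> 0)))"

text \<open>
  \<open>\<phi>\<close> is a birational morphism from the projective line onto the curve \<open>F = 0\<close> of degree \<open>d\<close>, with
  inverse rational map \<open>\<psi>\<close>; the curve is rational iff there is such a \<open>\<phi>\<close>. The pullback of a line
  to the normalization of the curve has degree \<open>d\<close>, hence so have the forms defining \<open>\<phi>\<close>.
  If the strict transform is smooth, \<open>\<phi>\<close> lifts to an isomorphism onto the strict transform.
\<close>

definition rational_parametrization ::
    "nat \<Rightarrow> (3, 'a::field) mpoly \<Rightarrow> ((2, 'a) mpoly)^3 \<Rightarrow> bool" where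
  "rational_parametrization d F \<phi> \<longleftrightarrow>
     (\<forall>j. homogeneous d (\<phi> $ j)) \<and>
     (\<forall>q :: 'a^2. q \<noteq> 0 \<longrightarrow> (\<exists>j. eval (\<phi> $ j) (($) q) \<noteq> 0)) \<and>
     subst F (($) \<phi>) = 0 \<and>
     (\<exists>e (\<psi> :: ((3, 'a) mpoly)^2).
        (\<forall>i. homogeneous e (\<psi> $ i)) \<and>
        (\<exists>i. \<not> F dvd \<psi> $ i) \<and>
        (\<forall>i j. F dvd Var i * subst (\<phi> $ j) (($) \<psi>) - Var j * subst (\<phi> $ i) (($) \<psi>)) \<and>
        (\<exists>i. subst (\<psi> $ i) (($) \<phi>) \<noteq> 0) \<and>
        (\<forall>i j. Var i * subst (\<psi> $ j) (($) \<phi>) = Var j * subst (\<psi> $ i) (($) \<phi>)))"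


section \<open>The cotangent bundle restricted to a rational curve\<close>

text \<open>
  By the Euler sequence the first twist of the cotangent bundle of the plane is the kernel of
  the map from three copies of the structure sheaf to its first twist given by the coordinates. Its
  pullback along \<open>\<phi>\<close> is therefore the sheaf of the graded module of syzygies of \<open>\<phi>\<close>, and the
  \<open>(k+1)\<close>-st twist of the cotangent bundle pulls back to the twist of that sheaf by \<open>d * k\<close>.
\<close>

definition syzygies :: "((2, 'a::field) mpoly)^3 \<Rightarrow> ((2, 'a) mpoly^3) set" where
  "syzygies \<phi> = {g. (\<Sum>j\<in>UNIV. g $ j * \<phi> $ j) = 0}"

text \<open>
  The inverse image ideal of \<open>I\<close> along \<open>\<phi>\<close>. For the ideal of \<open>Z\<close> it cuts out, on the
  projective line, the intersection of the strict transform with the exceptional divisor given by \<open>Z\<close>.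
\<close>

definition pullback_ideal ::
    "((2, 'a::field) mpoly)^3 \<Rightarrow> (3, 'a) mpoly set \<Rightarrow> (2, 'a) mpoly set" where
  "pullback_ideal \<phi> I = ideal.span ((\<lambda>f. subst f (($) \<phi>)) ` I)"

definition ideal_times :: "'b::comm_ring_1 set \<Rightarrow> ('b^3) set \<Rightarrow> ('b^3) set" where
  "ideal_times J M = free_module.span {a *s g | a g. a \<in> J \<and> g \<in> M}"

definition laurent_vec :: "(('v, 'a::field) mpoly)^3 \<Rightarrow> (('v, 'a) lpoly)^3" where
  "laurent_vec g = (\<chi> j. laurent (g $ j))"

text \<open>The degree \<open>e\<close> part of the localization of a module.\<close>

definition localization_vec ::
    "'v::finite set \<Rightarrow> int \<Rightarrow> (('v, 'a::field) mpoly^3) set \<Rightarrow> (('v, 'a) lpoly^3) set" where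
  "localization_vec V e M = {u. (\<forall>j. homogeneous e (u $ j)) \<and>
     (\<exists>N. (\<Prod>v\<in>V. Var v) ^ N *s u \<in> laurent_vec ` M)}"

definition cochain_scale :: "'a::field \<Rightarrow> (('b \<Rightarrow>\<^sub>0 'a)^'m)^'n \<Rightarrow> (('b \<Rightarrow>\<^sub>0 'a)^'m)^'n" where
  "cochain_scale c u = (\<chi> v j. pm_scale c (u $ v $ j))"

global_interpretation cochain: vector_space
  "cochain_scale :: 'a::field \<Rightarrow> (('b \<Rightarrow>\<^sub>0 'a)^'m)^'n \<Rightarrow> (('b \<Rightarrow>\<^sub>0 'a)^'m)^'n"
  by unfold_locales
    (auto simp: cochain_scale_def vec_eq_iff
      intro!: poly_mapping_eqI simp: lookup_pm_scale lookup_add algebra_simps)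

text \<open>The dimension of the image of \<open>W\<close> modulo the span of \<open>W\<^sub>0\<close>, which is finite where this is used.\<close>

definition quotient_dim ::
    "((('b \<Rightarrow>\<^sub>0 'a::field)^'m)^'n) set \<Rightarrow> ((('b \<Rightarrow>\<^sub>0 'a)^'m)^'n) set \<Rightarrow> nat" where
  "quotient_dim W W\<^sub>0 = (LEAST c. \<exists>B. finite B \<and> card B = c \<and> B \<subseteq> W \<and> W \<subseteq> cochain.span (B \<union> W\<^sub>0))"

text \<open>
  The dimension of the cokernel of the restriction map from the sections of the sheaf of \<open>M\<close>,
  twisted by \<open>e\<close>, to those of its quotient by \<open>J\<close>, where \<open>M\<close> is the syzygy module of \<open>\<phi>\<close>,
  \<open>J\<close> is the inverse image ideal of \<open>I\<close> and \<open>e = d * k\<close>. Sections of the quotient sheaf are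
  represented by their lifts \<open>u $ v\<close> to \<open>M\<close> over the two standard affine open sets: \<open>W\<close> is the
  space of lifts whose classes agree on the overlap, and \<open>Z\<close> the space of lifts of the zero
  section. Hence the cokernel is the quotient of \<open>W\<close> by the span of \<open>Z\<close> and of the restrictions
  of global sections of the twisted sheaf of \<open>M\<close>, which form the degree \<open>e\<close> part of the
  syzygy module.
\<close>

definition delta0 ::
    "nat \<Rightarrow> ((2, 'a::field) mpoly)^3 \<Rightarrow> (3, 'a) mpoly set \<Rightarrow> nat \<Rightarrow> nat" where
  "delta0 d \<phi> I k =
    (let M = syzygies \<phi>; JM = ideal_times (pullback_ideal \<phi> I) M; e = int (d * k);
         W = {u :: ((2, 'a) lpoly)^3^2.
                (\<forall>v. u $ v \<in> localization_vec {v} e M) \<and>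
                (\<forall>v w. u $ v - u $ w \<in> localization_vec {v, w} e JM)};
         Z = {u :: ((2, 'a) lpoly)^3^2. \<forall>v. u $ v \<in> localization_vec {v} e JM};
         R = {(\<chi> v. laurent_vec g) | g. g \<in> M \<and> (\<forall>j. homogeneous (d * k) (g $ j))}
     in quotient_dim W (Z \<union> R))"

end

theory Submission
  imports Defs "HOL-Number_Theory.Cong"
begin

text \<open>
  The idea is to compare two cokernels: that of the multiplication map in degree \<open>k\<close>, and the one of
  dimension \<^const>\<open>delta0\<close> on the curve. Once the first is known to be at least as large as the
  second (\<open>delta0_le\<close>), the assumption \<open>\<delta>\<^sub>0 > max 0 (h0 I (k + 1) - 3 * h0 I k)\<close> finishes the proof:
  the cokernel is nonzero, so the multiplication map is not surjective, and it is larger than the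
  difference of the dimensions, so the map is not injective (\<open>dim_image_mu\<close>).

  For the comparison let \<open>I\<close> be the ideal of the fat points, \<open>J\<close> its inverse image on the projective line
  and \<open>\<phi>\<close> the parametrization of the curve, of degree \<open>d\<close>. Choose a linear form \<open>l\<close> that does not vanish at
  the points \<open>P i\<close> and avoids the finitely many points of the curve where the inverse of \<open>\<phi>\<close> is not available
  (\<open>general_line\<close>); put \<open>L = l \<circ> \<phi>\<close>. Two facts are combined. Since the first cohomology of the \<open>k\<close>-th twist
  of \<open>I\<close> vanishes, every form of degree \<open>j > k\<close> agrees on the line \<open>l = 0\<close> with an element of \<open>I\<close>
  (\<open>h1_vanishes_lift\<close>). And near the line \<open>\<phi>\<close> is an isomorphism onto the curve, so that forms of degree
  \<open>j \<ge> d - 1\<close> restrict onto all functions on the scheme \<open>L = 0\<close> of length \<open>d\<close> on the projective line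
  (\<open>line_section_surjective\<close>). As \<open>d \<le> k + 2\<close>, for every \<open>j > k\<close> the elements of \<open>I\<close> of degree \<open>j\<close>
  restrict onto the functions on \<open>L = 0\<close> (\<open>line_section_lift\<close>).

  This has two consequences. First, multiplication by \<open>L\<close> is injective on the first cohomology of \<open>J\<close> in
  degrees \<open>d * j\<close>, \<open>j \<ge> k\<close>. A large power of \<open>L\<close> kills every class, so the cohomology in degree \<open>d * k\<close>
  vanishes (\<open>splits_of_J\<close>). Secondly, let a class in the cokernel on the curve be given by local syzygies of
  \<open>\<phi>\<close> that agree modulo \<open>J\<close> on the overlap. By the vanishing they agree modulo \<open>J\<close> with a vector \<open>g\<close> of
  global forms of degree \<open>d * k\<close>, whose pairing with \<open>\<phi>\<close> is locally in \<open>J\<close>. By restriction to \<open>L = 0\<close> this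
  pairing is \<open>f \<circ> \<phi>\<close> up to a multiple of \<open>L\<close>, for a form \<open>f\<close> of degree \<open>k + 1\<close> in \<open>I\<close>, and the multiple of
  \<open>L\<close> can be removed by changing \<open>g\<close> (\<open>exists_connected_form\<close>). If \<open>f\<close> lies in the image of
  multiplication, the class is zero (\<open>connects_image_mu\<close>). Hence the dimension of the cokernel on the
  curve is at most that of the cokernel of multiplication.
\<close>

section \<open>Ring homomorphisms and evaluation\<close>

text \<open>
  For a ring viewed as a module over itself this rule is associativity read from right to left, so it
  undoes the normal form that the commutative rewrite rules aim at.
\<close>

declare ideal.scale_scale [simp del]

locale ring_map =
  fixes h :: "'a::comm_ring_1 \<Rightarrow> 'b::comm_ring_1"
  assumes one [simp]: "h 1 = 1"
    and add: "h (a + b) = h a + h b"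
    and mult: "h (a * b) = h a * h b"
begin

lemma zero [simp]: "h 0 = 0"
  using add[of 0 0] by simp

lemma minus: "h (- a) = - h a"
  using add[of a "- a"] by (simp add: eq_neg_iff_add_eq_0 add.commute)

lemma diff: "h (a - b) = h a - h b"
  using add[of a "- b"] by (simp add: minus)

lemma sum: "h (sum f A) = (\<Sum>i\<in>A. h (f i))"
  by (induction A rule: infinite_finite_induct) (auto simp: add)

lemma prod: "h (prod f A) = (\<Prod>i\<in>A. h (f i))"
  by (induction A rule: infinite_finite_induct) (auto simp: mult)

lemma power: "h (a ^ n) = h a ^ n"
  by (induction n) (auto simp: mult)

lemmas hom = add mult minus diff sum prod power

lemma dvd: "a dvd b \<Longrightarrow> h a dvd h b"
  by (auto simp: dvd_def mult)

end

lemma ring_map_id: "ring_map (\<lambda>c. c)"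
  by unfold_locales auto

lemma ring_map_const_poly: "ring_map (\<lambda>c. [:c:])"
  by unfold_locales (auto simp: one_pCons)

lemma ring_map_pcompose: "ring_map (\<lambda>p. pcompose p x)"
  by unfold_locales (auto simp: pcompose_add pcompose_mult pcompose_1)

lemma ring_map_poly: "ring_map (\<lambda>p. poly p x)"
  by unfold_locales auto

lemma ring_map_Const: "ring_map (Const :: 'a::comm_ring_1 \<Rightarrow> ('v \<Rightarrow>\<^sub>0 'e::comm_monoid_add) \<Rightarrow>\<^sub>0 'a)"
  by unfold_locales (auto simp: Const_def single_add mult_single)

lemmas Const_one [simp] = ring_map.one[OF ring_map_Const]
  and Const_zero [simp] = ring_map.zero[OF ring_map_Const]
  and Const_add = ring_map.add[OF ring_map_Const]
  and Const_mult = ring_map.mult[OF ring_map_Const]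

lemma pm_scale_eq_Const_mult: "pm_scale c p = Const c * p"
  unfolding pm_scale_def Const_def by (rule mult_map_scale_conv_mult)

lemma poly_mapping_sum_singles: "p = (\<Sum>m\<in>Poly_Mapping.keys p. Poly_Mapping.single m (Poly_Mapping.lookup p m))"
  by (rule poly_mapping_eqI)
    (auto simp: lookup_sum lookup_single when_def in_keys_iff)

text \<open>
  Evaluation of a monomial. Every evaluation, substitution and embedding used below is a sum of
  coefficients times such values, so multiplicativity needs to be proved only here.
\<close>

definition mon :: "('v \<Rightarrow> 'b::comm_semiring_1) \<Rightarrow> ('v \<Rightarrow>\<^sub>0 nat) \<Rightarrow> 'b" where
  "mon x m = (\<Prod>v\<in>Poly_Mapping.keys m. x v ^ Poly_Mapping.lookup m v)"

lemma mon_superset: "finite A \<Longrightarrow> Poly_Mapping.keys m \<subseteq> A \<Longrightarrow> mon x m = (\<Prod>v\<in>A. x v ^ Poly_Mapping.lookup m v)"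
  unfolding mon_def by (rule prod.mono_neutral_left) (auto simp: in_keys_iff)

lemma mon_zero [simp]: "mon x 0 = 1"
  by (simp add: mon_def)

lemma mon_single [simp]: "mon x (Poly_Mapping.single v n) = x v ^ n"
  by (subst mon_superset[of "{v}"]) auto

lemma mon_add: "mon x (m + m') = mon x m * mon x m'"
proof -
  let ?A = "Poly_Mapping.keys m \<union> Poly_Mapping.keys m'"
  have "mon x (m + m') = (\<Prod>v\<in>?A. x v ^ Poly_Mapping.lookup (m + m') v)"
    by (rule mon_superset) (use keys_add[of m m'] in auto)
  also have "\<dots> = mon x m * mon x m'"
    by (simp add: mon_superset[of ?A] lookup_add power_add prod.distrib)
  finally show ?thesis .
qed

lemma mpoly_hom_mon:
  "mpoly_hom h x p = (\<Sum>m\<in>Poly_Mapping.keys p. h (Poly_Mapping.lookup p m) * mon x m)"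
  by (simp add: mpoly_hom_def mon_def)

lemma (in ring_map) mpoly_hom_superset:
  "finite A \<Longrightarrow> Poly_Mapping.keys p \<subseteq> A \<Longrightarrow>
    mpoly_hom h x p = (\<Sum>m\<in>A. h (Poly_Mapping.lookup p m) * mon x m)"
  unfolding mpoly_hom_mon by (rule sum.mono_neutral_left) (auto simp: in_keys_iff)

lemma (in ring_map) mpoly_hom_single: "mpoly_hom h x (Poly_Mapping.single m c) = h c * mon x m"
  by (subst mpoly_hom_superset[of "{m}"]) auto

lemma (in ring_map) mpoly_hom_add: "mpoly_hom h x (p + q) = mpoly_hom h x p + mpoly_hom h x q"
proof -
  let ?A = "Poly_Mapping.keys p \<union> Poly_Mapping.keys q"
  have "mpoly_hom h x (p + q) = (\<Sum>m\<in>?A. h (Poly_Mapping.lookup (p + q) m) * mon x m)"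
    by (rule mpoly_hom_superset) (use keys_add[of p q] in auto)
  also have "\<dots> = mpoly_hom h x p + mpoly_hom h x q"
    by (simp add: mpoly_hom_superset[of ?A] lookup_add add distrib_right sum.distrib)
  finally show ?thesis .
qed

lemma (in ring_map) mpoly_hom_sum: "mpoly_hom h x (sum f A) = (\<Sum>i\<in>A. mpoly_hom h x (f i))"
  by (induction A rule: infinite_finite_induct) (auto simp: mpoly_hom_add, auto simp: mpoly_hom_def)

lemma (in ring_map) ring_map_mpoly_hom: "ring_map (mpoly_hom h x)"
proof
  show "mpoly_hom h x 1 = 1"
    by (metis mpoly_hom_single mon_zero mult_1_right one single_one)
  fix p q
  show "mpoly_hom h x (p + q) = mpoly_hom h x p + mpoly_hom h x q"
    by (rule mpoly_hom_add)
  have "p * q = (\<Sum>m\<in>Poly_Mapping.keys p. Poly_Mapping.single m (Poly_Mapping.lookup p m)) *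
       (\<Sum>m\<in>Poly_Mapping.keys q. Poly_Mapping.single m (Poly_Mapping.lookup q m))"
    by (simp only: poly_mapping_sum_singles[symmetric])
  also have "\<dots> = (\<Sum>m\<in>Poly_Mapping.keys p. \<Sum>m'\<in>Poly_Mapping.keys q.
      Poly_Mapping.single (m + m') (Poly_Mapping.lookup p m * Poly_Mapping.lookup q m'))"
    by (simp only: sum_product mult_single)
  also have "mpoly_hom h x \<dots> = (\<Sum>m\<in>Poly_Mapping.keys p. \<Sum>m'\<in>Poly_Mapping.keys q.
      (h (Poly_Mapping.lookup p m) * mon x m) * (h (Poly_Mapping.lookup q m') * mon x m'))"
    by (simp only: mpoly_hom_sum mpoly_hom_single mon_add mult ac_simps)
  also have "\<dots> = mpoly_hom h x p * mpoly_hom h x q"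
    by (simp only: mpoly_hom_mon sum_product)
  finally show "mpoly_hom h x (p * q) = mpoly_hom h x p * mpoly_hom h x q" .
qed

lemma (in ring_map) mpoly_hom_Const [simp]: "mpoly_hom h x (Const c) = h c"
  by (simp add: Const_def mpoly_hom_single)

lemma (in ring_map) mpoly_hom_Var [simp]: "mpoly_hom h x (Var v) = x v"
  by (simp add: Var_def mpoly_hom_single)

lemma (in ring_map) map_mpoly_hom: "h (mpoly_hom g x p) = mpoly_hom (\<lambda>c. h (g c)) (\<lambda>v. h (x v)) p"
  by (simp add: mpoly_hom_def hom)

lemma mon_Var: "mon Var m = (Poly_Mapping.single m 1 :: ('v, 'a::comm_ring_1) mpoly)"
proof -
  have pow: "(Var v :: ('v, 'a) mpoly) ^ n = Poly_Mapping.single (Poly_Mapping.single v n) 1" for v n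
    by (induction n) (auto simp: Var_def mult_single simp flip: single_add)
  have fin: "finite A \<Longrightarrow> (\<Prod>v\<in>A. (Var v :: ('v, 'a) mpoly) ^ Poly_Mapping.lookup m v) =
      Poly_Mapping.single (\<Sum>v\<in>A. Poly_Mapping.single v (Poly_Mapping.lookup m v)) 1" for A
    by (induction A rule: finite_induct) (auto simp: pow mult_single)
  show ?thesis
    unfolding mon_def by (simp add: fin flip: poly_mapping_sum_singles)
qed

text \<open>
  A polynomial is its own expansion in the variables. Whatever is a composition of evaluation
  homomorphisms can be recomputed from this.
\<close>

lemma mpoly_hom_Const_Var: "mpoly_hom Const Var p = (p :: ('v, 'a::comm_ring_1) mpoly)"
  by (subst (2) poly_mapping_sum_singles)
    (simp add: mpoly_hom_mon mon_Var Const_def mult_single)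

lemma ring_map_subst: "ring_map (\<lambda>p :: ('v, 'a::comm_ring_1) mpoly. subst p x)"
  unfolding subst_def by (rule ring_map.ring_map_mpoly_hom[OF ring_map_Const])

lemma subst_Var [simp]: "subst (Var v) x = (x v :: ('w, 'a::comm_ring_1) mpoly)"
  unfolding subst_def by (rule ring_map.mpoly_hom_Var[OF ring_map_Const])

lemma subst_Const [simp]: "subst (Const c) x = (Const c :: ('w, 'a::comm_ring_1) mpoly)"
  unfolding subst_def by (rule ring_map.mpoly_hom_Const[OF ring_map_Const])

lemma ring_map_eval: "ring_map (\<lambda>p :: ('v, 'a::comm_ring_1) mpoly. eval p x)"
  unfolding eval_def by (rule ring_map.ring_map_mpoly_hom[OF ring_map_id])

lemma eval_Var [simp]: "eval (Var v) x = (x v :: 'a::comm_ring_1)"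
  unfolding eval_def by (rule ring_map.mpoly_hom_Var[OF ring_map_id])

lemma eval_Const [simp]: "eval (Const c) x = (c :: 'a::comm_ring_1)"
  unfolding eval_def by (rule ring_map.mpoly_hom_Const[OF ring_map_id])

interpretation laurent: ring_map "laurent :: ('v, 'a::comm_ring_1) mpoly \<Rightarrow> ('v, 'a) lpoly"
  unfolding laurent_def by (rule ring_map.ring_map_mpoly_hom[OF ring_map_Const])

lemma laurent_Var [simp]: "laurent (Var v) = (Var v :: ('v, 'a::comm_ring_1) lpoly)"
  unfolding laurent_def by (rule ring_map.mpoly_hom_Var[OF ring_map_Const])

lemma laurent_Const [simp]: "laurent (Const c) = (Const c :: ('v, 'a::comm_ring_1) lpoly)"
  unfolding laurent_def by (rule ring_map.mpoly_hom_Const[OF ring_map_Const])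

section \<open>Homogeneous elements\<close>

lemma homogeneousD:
  "homogeneous d p \<Longrightarrow> Poly_Mapping.lookup p m \<noteq> 0 \<Longrightarrow> (\<Sum>v\<in>UNIV. Poly_Mapping.lookup m v) = d"
  by (auto simp: homogeneous_def in_keys_iff)

lemma homogeneous_0 [simp]: "homogeneous d 0"
  by (simp add: homogeneous_def)

lemma homogeneous_add: "homogeneous d p \<Longrightarrow> homogeneous d q \<Longrightarrow> homogeneous d (p + q)"
  unfolding homogeneous_def using keys_add[of p q] by blast

lemma homogeneous_uminus: "homogeneous d p \<Longrightarrow> homogeneous d (- p :: ('v::finite \<Rightarrow>\<^sub>0 'e::comm_monoid_add) \<Rightarrow>\<^sub>0 'a::ab_group_add)"
  unfolding homogeneous_def by (simp add: in_keys_iff)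

lemma homogeneous_diff:
  "homogeneous d p \<Longrightarrow> homogeneous d q \<Longrightarrow> homogeneous d (p - q :: ('v::finite \<Rightarrow>\<^sub>0 'e::comm_monoid_add) \<Rightarrow>\<^sub>0 'a::ab_group_add)"
  using homogeneous_add[of d p "- q"] homogeneous_uminus[of d q] by simp

lemma homogeneous_sum: "(\<And>i. i \<in> A \<Longrightarrow> homogeneous d (f i)) \<Longrightarrow> homogeneous d (sum f A)"
  by (induction A rule: infinite_finite_induct) (auto intro: homogeneous_add)

lemma homogeneous_mult:
  fixes p q :: "('v::finite \<Rightarrow>\<^sub>0 'e::comm_monoid_add) \<Rightarrow>\<^sub>0 'a::comm_ring_1"
  assumes "homogeneous d p" "homogeneous e q"
  shows "homogeneous (d + e) (p * q)"
  unfolding homogeneous_def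
proof
  fix m assume "m \<in> Poly_Mapping.keys (p * q)"
  then obtain a b where "m = a + b" "a \<in> Poly_Mapping.keys p" "b \<in> Poly_Mapping.keys q"
    using keys_mult[of p q] by blast
  then show "(\<Sum>v\<in>UNIV. Poly_Mapping.lookup m v) = d + e"
    using assms by (simp add: homogeneous_def lookup_add sum.distrib)
qed

lemma homogeneous_mult':
  fixes p q :: "('v::finite \<Rightarrow>\<^sub>0 'e::comm_monoid_add) \<Rightarrow>\<^sub>0 'a::comm_ring_1"
  shows "homogeneous d p \<Longrightarrow> homogeneous e q \<Longrightarrow> n = d + e \<Longrightarrow> homogeneous n (p * q)"
  using homogeneous_mult by blast

lemma homogeneous_Const: "homogeneous 0 (Const c)"
  by (auto simp: homogeneous_def Const_def)

lemma homogeneous_1: "homogeneous 0 (1 :: ('v::finite \<Rightarrow>\<^sub>0 'e::comm_monoid_add) \<Rightarrow>\<^sub>0 'a::comm_ring_1)"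
  by (subst Const_one[symmetric]) (rule homogeneous_Const)

lemma homogeneous_Const_mult:
  fixes p :: "('v::finite \<Rightarrow>\<^sub>0 'e::comm_monoid_add) \<Rightarrow>\<^sub>0 'a::comm_ring_1"
  shows "homogeneous d p \<Longrightarrow> homogeneous d (Const c * p)"
  using homogeneous_mult[OF homogeneous_Const] by fastforce

lemma homogeneous_Var: "homogeneous 1 (Var v :: ('v::finite \<Rightarrow>\<^sub>0 'e::comm_semiring_1) \<Rightarrow>\<^sub>0 'a::zero_neq_one)"
  by (auto simp: homogeneous_def Var_def lookup_single when_def)

lemma homogeneous_power:
  fixes p :: "('v::finite \<Rightarrow>\<^sub>0 'e::comm_semiring_1) \<Rightarrow>\<^sub>0 'a::comm_ring_1"
  shows "homogeneous d p \<Longrightarrow> homogeneous (of_nat n * d) (p ^ n)"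
proof (induction n)
  case (Suc n)
  then show ?case
    using homogeneous_mult[of d p "of_nat n * d" "p ^ n"] by (simp add: algebra_simps)
qed (simp add: homogeneous_1)

lemma homogeneous_Var_power:
  "homogeneous (of_nat n) (Var v ^ n :: ('v::finite \<Rightarrow>\<^sub>0 'e::comm_semiring_1) \<Rightarrow>\<^sub>0 'a::comm_ring_1)"
  using homogeneous_power[OF homogeneous_Var, of n] by simp

lemma homogeneous_prod:
  fixes f :: "'i \<Rightarrow> ('v::finite \<Rightarrow>\<^sub>0 'e::comm_monoid_add) \<Rightarrow>\<^sub>0 'a::comm_ring_1"
  shows "(\<And>i. i \<in> A \<Longrightarrow> homogeneous (g i) (f i)) \<Longrightarrow> homogeneous (sum g A) (prod f A)"
proof (induction A rule: infinite_finite_induct)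
  case (insert x A)
  then show ?case by (simp add: homogeneous_mult)
qed (simp_all add: homogeneous_1)

lemma homogeneous_subst:
  fixes p :: "('v::finite, 'a::comm_ring_1) mpoly" and x :: "'v \<Rightarrow> ('w::finite, 'a) mpoly"
  assumes p: "homogeneous n p" and x: "\<And>v. homogeneous d (x v)"
  shows "homogeneous (d * n) (subst p x)"
  unfolding subst_def mpoly_hom_mon
proof (intro homogeneous_sum homogeneous_Const_mult)
  fix m assume m: "m \<in> Poly_Mapping.keys p"
  have "homogeneous (\<Sum>v\<in>UNIV. Poly_Mapping.lookup m v * d) (\<Prod>v\<in>UNIV. x v ^ Poly_Mapping.lookup m v)"
    using homogeneous_power[OF x] by (intro homogeneous_prod) simp
  also have "(\<Sum>v\<in>UNIV. Poly_Mapping.lookup m v * d) = d * n"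
    using m p by (simp add: homogeneous_def flip: sum_distrib_right)
  finally show "homogeneous (d * n) (mon x m)"
    by (simp add: mon_superset[of UNIV])
qed

text \<open>
  Besides rescaling of coordinates of a point, this covers coordinates with a common factor in any ring.
\<close>

lemma eval_homogeneous_scale:
  fixes p :: "('v::finite, 'a::comm_ring_1) mpoly"
  assumes "homogeneous n p"
  shows "mpoly_hom h (\<lambda>v. c * x v) p = c ^ n * mpoly_hom h x p"
proof -
  have "mon (\<lambda>v. c * x v) m = c ^ n * mon x m" if "m \<in> Poly_Mapping.keys p" for m
    using that assms by (simp add: homogeneous_def mon_superset[of UNIV] power_mult_distrib prod.distrib flip: power_sum)
  then show ?thesis
    by (simp add: mpoly_hom_mon sum_distrib_left algebra_simps)
qed

section \<open>Laurent polynomials\<close>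

text \<open>
  Polynomials are the Laurent polynomials all of whose exponents are nonnegative. Through the
  embedding of exponents this gives injectivity of \<^const>\<open>laurent\<close>, its image, and invariance of degrees.
\<close>

definition int_exp :: "('v \<Rightarrow>\<^sub>0 nat) \<Rightarrow> ('v \<Rightarrow>\<^sub>0 int)" where
  "int_exp m = Poly_Mapping.map int m"

lemma lookup_int_exp: "Poly_Mapping.lookup (int_exp m) v = int (Poly_Mapping.lookup m v)"
  by (simp add: int_exp_def Poly_Mapping.map.rep_eq when_def)

lemma int_exp_eq_iff [simp]: "int_exp m = int_exp m' \<longleftrightarrow> m = m'"
  by (metis int_int_eq lookup_int_exp poly_mapping_eqI)

lemma range_int_exp: "m \<in> range int_exp \<longleftrightarrow> (\<forall>v. Poly_Mapping.lookup m v \<ge> 0)"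
proof
  assume "\<forall>v. Poly_Mapping.lookup m v \<ge> 0"
  then have "m = int_exp (Poly_Mapping.map nat m)"
    by (intro poly_mapping_eqI) (auto simp: lookup_int_exp Poly_Mapping.map.rep_eq when_def)
  then show "m \<in> range int_exp" by blast
qed (auto simp: lookup_int_exp)

lemma mon_Var_lpoly: "mon Var m = (Poly_Mapping.single (int_exp m) 1 :: ('v, 'a::comm_ring_1) lpoly)"
proof -
  have pow: "(Var v :: ('v, 'a) lpoly) ^ n = Poly_Mapping.single (Poly_Mapping.single v (int n)) 1" for v n
    by (induction n) (auto simp: Var_def mult_single simp flip: single_add)
  have fin: "finite A \<Longrightarrow> (\<Prod>v\<in>A. (Var v :: ('v, 'a) lpoly) ^ Poly_Mapping.lookup m v) =
      Poly_Mapping.single (\<Sum>v\<in>A. Poly_Mapping.single v (int (Poly_Mapping.lookup m v))) 1" for A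
    by (induction A rule: finite_induct) (auto simp: pow mult_single)
  have "Poly_Mapping.keys (int_exp m) = Poly_Mapping.keys m"
    by (auto simp: in_keys_iff lookup_int_exp)
  then have "(\<Sum>v\<in>Poly_Mapping.keys m. Poly_Mapping.single v (int (Poly_Mapping.lookup m v))) = int_exp m"
    by (subst (2) poly_mapping_sum_singles) (simp add: lookup_int_exp)
  then show ?thesis
    unfolding mon_def by (simp add: fin)
qed

lemma laurent_eq_sum:
  "laurent p = (\<Sum>m\<in>Poly_Mapping.keys p. Poly_Mapping.single (int_exp m) (Poly_Mapping.lookup p m :: 'a::comm_ring_1))"
  by (simp add: laurent_def mpoly_hom_mon mon_Var_lpoly Const_def mult_single)

lemma lookup_laurent:
  "Poly_Mapping.lookup (laurent p) (int_exp m) = (Poly_Mapping.lookup p m :: 'a::comm_ring_1)"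
  by (auto simp: laurent_eq_sum lookup_sum lookup_single when_def in_keys_iff)

lemma lookup_laurent_notin:
  "m \<notin> range int_exp \<Longrightarrow> Poly_Mapping.lookup (laurent p) m = (0 :: 'a::comm_ring_1)"
  by (auto simp: laurent_eq_sum lookup_sum lookup_single when_def intro!: sum.neutral)

lemma laurent_eq_iff [simp]: "laurent p = laurent q \<longleftrightarrow> p = (q :: ('v, 'a::comm_ring_1) mpoly)"
  by (metis lookup_laurent poly_mapping_eqI)

lemma range_laurent:
  "u \<in> range laurent \<longleftrightarrow> Poly_Mapping.keys u \<subseteq> range int_exp" for u :: "('v, 'a::comm_ring_1) lpoly"
proof
  assume sub: "Poly_Mapping.keys u \<subseteq> range int_exp"
  have "inj (int_exp :: ('v \<Rightarrow>\<^sub>0 nat) \<Rightarrow> _)" by (auto intro: injI)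
  have "finite (int_exp -` Poly_Mapping.keys u)"
    by (rule finite_vimageI) (auto intro: injI)
  then have "finite {m. Poly_Mapping.lookup u (int_exp m) \<noteq> 0}"
    by (rule rev_finite_subset) (auto simp: in_keys_iff)
  then have lk: "Poly_Mapping.lookup (Poly_Mapping.Abs_poly_mapping (\<lambda>m. Poly_Mapping.lookup u (int_exp m))) m =
      Poly_Mapping.lookup u (int_exp m)" for m
    by simp
  have "u = laurent (Poly_Mapping.Abs_poly_mapping (\<lambda>m. Poly_Mapping.lookup u (int_exp m)))"
  proof (rule poly_mapping_eqI)
    fix m
    show "Poly_Mapping.lookup u m =
      Poly_Mapping.lookup (laurent (Poly_Mapping.Abs_poly_mapping (\<lambda>m. Poly_Mapping.lookup u (int_exp m)))) m"
    proof (cases "m \<in> range int_exp")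
      case True
      then show ?thesis by (auto simp: lookup_laurent lk)
    next
      case False
      with sub have "Poly_Mapping.lookup u m = 0" by (auto simp: in_keys_iff)
      with False show ?thesis by (simp add: lookup_laurent_notin)
    qed
  qed
  then show "u \<in> range laurent" by blast
qed (use lookup_laurent_notin in \<open>auto simp: in_keys_iff\<close>)

lemma homogeneous_laurent_iff:
  fixes p :: "('v::finite, 'a::comm_ring_1) mpoly"
  shows "homogeneous (int d) (laurent p) \<longleftrightarrow> homogeneous d p"
proof -
  have "homogeneous (int d) (laurent p) \<longleftrightarrow>
      (\<forall>m. Poly_Mapping.lookup (laurent p) (int_exp m) \<noteq> 0 \<longrightarrow> (\<Sum>v\<in>UNIV. Poly_Mapping.lookup (int_exp m) v) = int d)"
  proof
    assume R: "\<forall>m. Poly_Mapping.lookup (laurent p) (int_exp m) \<noteq> 0 \<longrightarrow>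
      (\<Sum>v\<in>UNIV. Poly_Mapping.lookup (int_exp m) v) = int d"
    show "homogeneous (int d) (laurent p)"
      unfolding homogeneous_def
    proof
      fix m assume "m \<in> Poly_Mapping.keys (laurent p)"
      then have nz: "Poly_Mapping.lookup (laurent p) m \<noteq> 0" by (simp add: in_keys_iff)
      then obtain m' where "m = int_exp m'" using lookup_laurent_notin by blast
      with R nz show "(\<Sum>v\<in>UNIV. Poly_Mapping.lookup m v) = int d" by blast
    qed
  qed (auto simp: homogeneous_def in_keys_iff)
  also have "\<dots> \<longleftrightarrow> homogeneous d p"
    by (auto simp: homogeneous_def in_keys_iff lookup_laurent lookup_int_exp simp flip: of_nat_sum)
  finally show ?thesis .
qed

definition Varinv :: "'v \<Rightarrow> ('v, 'a::comm_ring_1) lpoly" where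
  "Varinv v = Poly_Mapping.single (Poly_Mapping.single v (-1)) 1"

lemma Var_Varinv [simp]: "Var v * Varinv v = (1 :: ('v, 'a::comm_ring_1) lpoly)"
  by (simp add: Var_def Varinv_def mult_single flip: single_add)

lemma Var_Varinv_power [simp]: "Var v ^ n * Varinv v ^ n = (1 :: ('v, 'a::comm_ring_1) lpoly)"
  by (simp flip: power_mult_distrib)

lemma Var_Varinv_power_mult [simp]: "Var v ^ n * (Varinv v ^ n * u) = (u :: ('v, 'a::comm_ring_1) lpoly)"
  "Varinv v ^ n * (Var v ^ n * u) = (u :: ('v, 'a::comm_ring_1) lpoly)"
  by (metis Var_Varinv_power mult.assoc mult.commute mult_1)+

lemma homogeneous_Varinv_power: "homogeneous (- int n) (Varinv v ^ n :: ('v::finite, 'a::comm_ring_1) lpoly)"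
proof -
  have "homogeneous (-1) (Varinv v :: ('v, 'a) lpoly)"
    by (auto simp: homogeneous_def Varinv_def lookup_single when_def)
  from homogeneous_power[OF this, of n] show ?thesis by simp
qed

lemma lookup_Var_power_mult:
  fixes u :: "('v, 'a::comm_ring_1) lpoly"
  shows "Poly_Mapping.lookup (Var v ^ n * u) m = Poly_Mapping.lookup u (m - Poly_Mapping.single v (int n))"
proof -
  have pow: "(Var v :: ('v, 'a) lpoly) ^ n = Poly_Mapping.single (Poly_Mapping.single v (int n)) 1" for v n
    by (induction n) (auto simp: Var_def mult_single simp flip: single_add)
  let ?a = "Poly_Mapping.single v (int n)"
  have "Poly_Mapping.single ?a 1 * u = Poly_Mapping.single ?a 1 *
      (\<Sum>m\<in>Poly_Mapping.keys u. Poly_Mapping.single m (Poly_Mapping.lookup u m))"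
    by (simp only: poly_mapping_sum_singles[symmetric])
  also have "\<dots> = (\<Sum>m\<in>Poly_Mapping.keys u. Poly_Mapping.single (?a + m) (Poly_Mapping.lookup u m))"
    by (simp only: sum_distrib_left mult_single mult_1)
  also have "Poly_Mapping.lookup \<dots> m = Poly_Mapping.lookup u (m - ?a)"
  proof -
    have "?a + m' = m \<longleftrightarrow> m' = m - ?a" for m' by (auto simp: algebra_simps)
    then show ?thesis by (auto simp: lookup_sum lookup_single when_def in_keys_iff)
  qed
  finally show ?thesis unfolding pow .
qed

text \<open>
  A power of \<open>Var v\<close> can only cancel negative exponents of \<open>v\<close>, so regularity on two
  different charts leaves no negative exponent: the only functions regular on both are polynomials.
\<close>

lemma range_laurentI:
  fixes u :: "('v, 'a::comm_ring_1) lpoly"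
  assumes "v \<noteq> w" "Var v ^ n * u \<in> range laurent" "Var w ^ n' * u \<in> range laurent"
  shows "u \<in> range laurent"
  unfolding range_laurent
proof
  fix m assume m: "m \<in> Poly_Mapping.keys u"
  have *: "Poly_Mapping.lookup m z \<ge> 0" if "Var x ^ k * u \<in> range laurent" "z \<noteq> x" for x k z
  proof -
    have "m + Poly_Mapping.single x (int k) \<in> Poly_Mapping.keys (Var x ^ k * u)"
      using m by (simp add: in_keys_iff lookup_Var_power_mult)
    then have "m + Poly_Mapping.single x (int k) \<in> range int_exp"
      using that unfolding range_laurent by blast
    then show ?thesis
      using that(2) unfolding range_int_exp by (auto simp: lookup_add lookup_single dest!: spec[of _ z])
  qed
  show "m \<in> range int_exp"
    unfolding range_int_exp using *[OF assms(2)] *[OF assms(3)] assms(1) by metis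
qed

section \<open>Forms of positive degree\<close>

lemma homogeneous_Suc_decompose:
  fixes g :: "('v::finite, 'a::comm_ring_1) mpoly"
  assumes "homogeneous (Suc n) g"
  obtains G where "\<And>j. homogeneous n (G j)" "g = (\<Sum>j\<in>UNIV. Var j * G j)"
proof -
  define Q where "Q g \<longleftrightarrow> (\<exists>G. (\<forall>j. homogeneous n (G j)) \<and> g = (\<Sum>j\<in>UNIV. Var j * G j))"
    for g :: "('v, 'a) mpoly"
  have Q0: "Q 0" unfolding Q_def by (intro exI[of _ "\<lambda>_. 0"]) simp
  have Qadd: "Q (g + g')" if "Q g" "Q g'" for g g'
  proof -
    from that[unfolded Q_def] obtain G G' where "\<forall>j. homogeneous n (G j)" "g = (\<Sum>j\<in>UNIV. Var j * G j)"
      "\<forall>j. homogeneous n (G' j)" "g' = (\<Sum>j\<in>UNIV. Var j * G' j)" by blast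
    then show ?thesis unfolding Q_def
      by (intro exI[of _ "\<lambda>j. G j + G' j"]) (auto simp: homogeneous_add algebra_simps sum.distrib)
  qed
  have Qsum: "(\<And>m. m \<in> A \<Longrightarrow> Q (f m)) \<Longrightarrow> Q (sum f A)" for f and A :: "('v \<Rightarrow>\<^sub>0 nat) set"
    by (induction A rule: infinite_finite_induct) (auto simp: Q0 Qadd)
  have "Q (Poly_Mapping.single m (Poly_Mapping.lookup g m))" if "m \<in> Poly_Mapping.keys g" for m
  proof -
    have deg: "(\<Sum>v\<in>UNIV. Poly_Mapping.lookup m v) = Suc n"
      using that assms by (simp add: homogeneous_def)
    then obtain w where w: "Poly_Mapping.lookup m w > 0"
      by (metis gr0I sum.neutral nat.distinct(1))
    define m' where "m' = m - Poly_Mapping.single w 1"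
    have m: "m = Poly_Mapping.single w 1 + m'"
      using w by (intro poly_mapping_eqI) (auto simp: m'_def lookup_add lookup_minus lookup_single when_def)
    have "(\<Sum>v\<in>UNIV. Poly_Mapping.lookup m' v) = n"
      using deg unfolding m by (simp add: lookup_add sum.distrib lookup_single when_def)
    then have hom: "homogeneous n (Poly_Mapping.single m' (Poly_Mapping.lookup g m))"
      by (auto simp: homogeneous_def)
    have eq: "Poly_Mapping.single m (Poly_Mapping.lookup g m) = Var w * Poly_Mapping.single m' (Poly_Mapping.lookup g m)"
      unfolding Var_def mult_single m[symmetric] by simp
    show ?thesis unfolding Q_def
      by (rule exI[of _ "\<lambda>j. if j = w then Poly_Mapping.single m' (Poly_Mapping.lookup g m) else 0"])
        (simp add: hom eq if_distrib[of "(*) _"] cong: if_cong)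
  qed
  then have "Q (\<Sum>m\<in>Poly_Mapping.keys g. Poly_Mapping.single m (Poly_Mapping.lookup g m))"
    by (rule Qsum)
  then have "Q g"
    by (simp only: poly_mapping_sum_singles[symmetric])
  then show ?thesis using that unfolding Q_def by blast
qed

lemma homogeneous_0_decompose:
  fixes g :: "('v::finite, 'a::comm_ring_1) mpoly"
  assumes "homogeneous 0 g"
  shows "g = Const (Poly_Mapping.lookup g 0)"
proof (rule poly_mapping_eqI)
  fix m
  show "Poly_Mapping.lookup g m = Poly_Mapping.lookup (Const (Poly_Mapping.lookup g 0)) m"
  proof (cases "m = 0")
    case False
    then obtain v where "Poly_Mapping.lookup m v \<noteq> 0"
      by (metis lookup_zero poly_mapping_eqI)
    then have "(\<Sum>v\<in>UNIV. Poly_Mapping.lookup m v) \<noteq> 0" by auto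
    with assms have "Poly_Mapping.lookup g m = 0" by (metis homogeneousD)
    with False show ?thesis by (simp add: Const_def lookup_single)
  qed (simp add: Const_def)
qed

lemma linear_form_decompose:
  fixes g :: "('v::finite, 'a::comm_ring_1) mpoly"
  assumes "homogeneous 1 g"
  obtains c where "g = (\<Sum>j\<in>UNIV. Const (c j) * Var j)"
proof -
  obtain G where G: "\<And>j. homogeneous 0 (G j)" "g = (\<Sum>j\<in>UNIV. Var j * G j)"
    using homogeneous_Suc_decompose[of 0 g] assms by auto
  have "g = (\<Sum>j\<in>UNIV. Const (Poly_Mapping.lookup (G j) 0) * Var j)"
    unfolding G(2) by (rule sum.cong[OF refl]) (metis G(1) homogeneous_0_decompose mult.commute)
  then show ?thesis by (rule that)
qed

section \<open>Powers of the ideal of a point\<close>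

lemma ideal_power_0 [simp]: "ideal_power I 0 = UNIV"
  unfolding ideal_power_def
  by (auto simp: module_iff_vector_space) (metis (no_types, lifting) ideal.span_base ideal.span_scale insertI1 mult.right_neutral)

lemma subspace_ideal_power: "ideal.subspace (ideal_power I m)"
  unfolding ideal_power_def by (rule ideal.subspace_span)

text \<open>
  It suffices to multiply generators, where two lists of factors are concatenated.
\<close>

lemma ideal_power_mult:
  assumes "a \<in> ideal_power I m" "b \<in> ideal_power I n"
  shows "a * b \<in> ideal_power I (m + n)"
proof -
  note sub = ideal.subspace_add[OF subspace_ideal_power] ideal.subspace_scale[OF subspace_ideal_power]
  have gen: "(\<Prod>j<m. f j) * (\<Prod>j<n. g j) \<in> ideal_power I (m + n)"
    if "\<forall>j<m. f j \<in> I" "\<forall>j<n. g j \<in> I" for f g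
  proof -
    define e where "e j = (if j < m then f j else g (j - m))" for j
    have "(\<Prod>j<m + n. e j) = (\<Prod>j<m. f j) * (\<Prod>j<n. g j)"
      by (simp add: prod.atLeastLessThan_concat[of 0 m "m + n", symmetric] lessThan_atLeast0 e_def
          prod.shift_bounds_nat_ivl[of _ 0 m n, simplified add_0 add.commute[of n]])
    moreover have "\<forall>j<m + n. e j \<in> I"
      using that by (auto simp: e_def)
    ultimately show ?thesis
      unfolding ideal_power_def by (intro ideal.span_base) (auto intro!: exI[of _ e])
  qed
  have 1: "(\<Prod>j<m. f j) * b \<in> ideal_power I (m + n)" if "\<forall>j<m. f j \<in> I" for f
    using assms(2) unfolding ideal_power_def[of I n]
  proof (induction rule: ideal.span_induct_alt)
    case base
    then show ?case by (simp add: ideal_power_def ideal.span_zero)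
  next
    case (step c x y)
    then obtain g where "x = (\<Prod>j<n. g j)" "\<forall>j<n. g j \<in> I" by blast
    then have "c * ((\<Prod>j<m. f j) * x) + (\<Prod>j<m. f j) * y \<in> ideal_power I (m + n)"
      using gen[OF that] step by (intro sub(1)[OF sub(2)]) auto
    then show ?case by (simp only: distrib_left mult.left_commute)
  qed
  show ?thesis
    using assms(1) unfolding ideal_power_def[of I m]
  proof (induction rule: ideal.span_induct_alt)
    case base
    then show ?case by (simp add: ideal_power_def ideal.span_zero)
  next
    case (step c x y)
    then obtain f where "x = (\<Prod>j<m. f j)" "\<forall>j<m. f j \<in> I" by blast
    then have "c * (x * b) + y * b \<in> ideal_power I (m + n)"
      using 1 step by (intro sub(1)[OF sub(2)]) auto
    then show ?case by (simp only: distrib_right mult.assoc)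
  qed
qed

lemma ideal_power_1I: "a \<in> I \<Longrightarrow> a \<in> ideal_power I 1"
  unfolding ideal_power_def by (intro ideal.span_base) (auto intro!: exI[of _ "\<lambda>_. a"])

lemma power_in_ideal_power: "a \<in> I \<Longrightarrow> a ^ m \<in> ideal_power I m"
  unfolding ideal_power_def by (intro ideal.span_base) (auto intro!: exI[of _ "\<lambda>_. a"])

lemma ideal_power_antimono:
  assumes "m \<le> n"
  shows "ideal_power I n \<subseteq> ideal_power I m"
proof -
  have "(\<Prod>j<n. f j) \<in> ideal_power I m" if "\<forall>j<n. f j \<in> I" for f
  proof -
    have "(\<Prod>j<n. f j) = (\<Prod>j\<in>{m..<n}. f j) * (\<Prod>j<m. f j)"
      using assms by (simp add: lessThan_atLeast0 prod.atLeastLessThan_concat mult.commute)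
    moreover have "(\<Prod>j<m. f j) \<in> ideal_power I m"
      unfolding ideal_power_def by (rule ideal.span_base) (use that assms in auto)
    ultimately show ?thesis
      by (simp add: ideal.subspace_scale[OF subspace_ideal_power])
  qed
  then show ?thesis
    unfolding ideal_power_def[of I n] by (intro ideal.span_minimal subspace_ideal_power) auto
qed

text \<open>
  The Rees algebra of \<open>I\<close>, as polynomials in one auxiliary variable. It is a subring of the
  polynomial ring, which turns membership in powers of \<open>I\<close> into a statement about coefficients.
\<close>

definition rees :: "'b::comm_ring_1 set \<Rightarrow> 'b poly set" where
  "rees I = {q. \<forall>i. coeff q i \<in> ideal_power I i}"

lemma rees_add: "p \<in> rees I \<Longrightarrow> q \<in> rees I \<Longrightarrow> p + q \<in> rees I"
  by (simp add: rees_def ideal.subspace_add[OF subspace_ideal_power])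

lemma rees_mult: "p \<in> rees I \<Longrightarrow> q \<in> rees I \<Longrightarrow> p * q \<in> rees I"
  unfolding rees_def mem_Collect_eq coeff_mult
proof (rule allI, rule ideal.subspace_sum[OF subspace_ideal_power])
  fix i j :: nat
  assume "\<forall>i. coeff p i \<in> ideal_power I i" "\<forall>i. coeff q i \<in> ideal_power I i" "j \<in> {..i}"
  then show "coeff p j * coeff q (i - j) \<in> ideal_power I i"
    using ideal_power_mult[of "coeff p j" I j "coeff q (i - j)" "i - j"] by auto
qed

lemma rees_const: "[:a:] \<in> rees I"
  unfolding rees_def
  by (auto simp: coeff_pCons ideal.subspace_0[OF subspace_ideal_power] split: nat.split)

lemma rees_linear: "b \<in> I \<Longrightarrow> [:a, b:] \<in> rees I"
  unfolding rees_def using ideal_power_1I[of b I]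
  by (auto simp: coeff_pCons ideal.subspace_0[OF subspace_ideal_power] split: nat.split)

lemma rees_sum: "(\<And>i. i \<in> A \<Longrightarrow> f i \<in> rees I) \<Longrightarrow> sum f A \<in> rees I"
  by (induction A rule: infinite_finite_induct) (use rees_const[of 0] in \<open>auto intro: rees_add\<close>)

lemma rees_power: "p \<in> rees I \<Longrightarrow> p ^ n \<in> rees I"
  by (induction n) (use rees_const[of 1] in \<open>auto intro: rees_mult simp: one_pCons\<close>)

lemma rees_prod: "(\<And>i. i \<in> A \<Longrightarrow> f i \<in> rees I) \<Longrightarrow> prod f A \<in> rees I"
  by (induction A rule: infinite_finite_induct) (use rees_const[of 1] in \<open>auto intro: rees_mult simp: one_pCons\<close>)

text \<open>
  The \<open>j\<close>-th coordinate of the projection onto the line spanned by \<open>p\<close> that keeps the coordinate \<open>v\<close>.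
  As a linear form it differs from \<^term>\<open>Var j\<close> by a linear form vanishing at \<open>p\<close>.
\<close>

definition retract :: "'a::field^3 \<Rightarrow> 3 \<Rightarrow> 3 \<Rightarrow> (3, 'a) mpoly" where
  "retract p v j = Const (p $ j / p $ v) * Var v"

text \<open>
  Taylor expansion at \<open>p\<close>: the coefficient of \<open>T ^ i\<close> in the value at \<open>\<rho> + T (x - \<rho>)\<close>, where \<open>\<rho>\<close> is the
  projection of \<open>x\<close> to the line of \<open>p\<close>, is the part of order \<open>i\<close> at \<open>p\<close>.
\<close>

definition taylor :: "'a::field^3 \<Rightarrow> 3 \<Rightarrow> (3, 'a) mpoly \<Rightarrow> (3, 'a) mpoly poly" where
  "taylor p v f = mpoly_hom (\<lambda>c. [:Const c:]) (\<lambda>j. [:retract p v j, Var j - retract p v j:]) f"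

lemma ring_map_Const_pCons: "ring_map (\<lambda>c. [:Const c:] :: ('v, 'a::comm_ring_1) mpoly poly)"
  by unfold_locales (auto simp: Const_add Const_mult one_pCons)

lemma ring_map_taylor: "ring_map (taylor p v)"
  unfolding taylor_def by (rule ring_map.ring_map_mpoly_hom[OF ring_map_Const_pCons])

lemma taylor_Var: "taylor p v (Var j) = [:retract p v j, Var j - retract p v j:]"
  unfolding taylor_def by (rule ring_map.mpoly_hom_Var[OF ring_map_Const_pCons])

lemma Var_minus_retract: "p $ v \<noteq> 0 \<Longrightarrow> Var j - retract p v j \<in> point_ideal p"
  unfolding point_ideal_def retract_def
  by (rule ideal.span_base)
    (auto simp: ring_map.hom[OF ring_map_eval] intro!: exI[of _ 1] homogeneous_diff homogeneous_Const_mult homogeneous_Var)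

lemma taylor_in_rees: "p $ v \<noteq> 0 \<Longrightarrow> taylor p v f \<in> rees (point_ideal p)"
  unfolding taylor_def mpoly_hom_mon mon_def
  by (intro rees_sum rees_mult rees_prod rees_power rees_const rees_linear Var_minus_retract)

lemma poly_taylor_1: "poly (taylor p v f) 1 = f"
  unfolding taylor_def ring_map.map_mpoly_hom[OF ring_map_poly]
  by (simp add: mpoly_hom_Const_Var)

lemma poly_taylor_0:
  assumes "homogeneous d f" "eval f (($) p) = 0" "p $ v \<noteq> 0"
  shows "poly (taylor p v f) 0 = 0"
proof -
  have "poly (taylor p v f) 0 = mpoly_hom Const (retract p v) f"
    unfolding taylor_def ring_map.map_mpoly_hom[OF ring_map_poly] by simp
  also have "retract p v = (\<lambda>j. Const (1 / p $ v) * Var v * Const (p $ j))"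
  proof
    fix j
    have "Const (p $ j / p $ v) = Const (1 / p $ v) * (Const (p $ j) :: (3, 'a) mpoly)"
      by (simp flip: Const_mult)
    then show "retract p v j = Const (1 / p $ v) * Var v * Const (p $ j)"
      by (simp only: retract_def ac_simps)
  qed
  also have "mpoly_hom Const \<dots> f = (Const (1 / p $ v) * Var v) ^ d * mpoly_hom Const (\<lambda>j. Const (p $ j)) f"
    by (rule eval_homogeneous_scale[OF assms(1)])
  also have "mpoly_hom Const (\<lambda>j. Const (p $ j)) f = Const (eval f (($) p))"
    unfolding eval_def by (rule ring_map.map_mpoly_hom[OF ring_map_Const, symmetric])
  finally show ?thesis using assms(2) by simp
qed

text \<open>
  The \<open>m\<close>-th power of the ideal of a point consists of the polynomials of order at least \<open>m\<close>. In one
  direction, the expansion of an element of the ideal is divisible by \<open>T\<close>. In the other, the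
  expansion lies in the Rees algebra, and its value at \<open>T = 1\<close> is the polynomial itself.
\<close>

lemma ideal_power_iff_taylor:
  assumes v: "p $ v \<noteq> 0"
  shows "f \<in> ideal_power (point_ideal p) m \<longleftrightarrow> (\<forall>i<m. coeff (taylor p v f) i = 0)"
proof
  have X: "monom 1 1 dvd taylor p v f" if "f \<in> point_ideal p" for f
    using that unfolding point_ideal_def
  proof (induction rule: ideal.span_induct_alt)
    case (step c x y)
    then have "poly (taylor p v x) 0 = 0" using poly_taylor_0[OF _ _ v] by blast
    then have "monom 1 1 dvd taylor p v x"
      by (simp add: monom_1_dvd_iff' poly_0_coeff_0)
    with step show ?case by (simp add: ring_map.hom[OF ring_map_taylor])
  qed (simp add: ring_map.zero[OF ring_map_taylor])
  have "monom 1 m dvd taylor p v f" if "f \<in> ideal_power (point_ideal p) m" for f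
    using that unfolding ideal_power_def
  proof (induction rule: ideal.span_induct_alt)
    case (step c x y)
    then obtain g where g: "x = (\<Prod>j<m. g j)" "\<forall>j<m. g j \<in> point_ideal p" by blast
    have "(\<Prod>j<m. monom 1 1) dvd (\<Prod>j<m. taylor p v (g j))"
      by (rule prod_dvd_prod) (use g X in auto)
    then have "monom 1 m dvd taylor p v x"
      by (simp add: g(1) ring_map.hom[OF ring_map_taylor] monom_power)
    with step show ?case by (simp add: ring_map.hom[OF ring_map_taylor])
  qed (simp add: ring_map.zero[OF ring_map_taylor])
  then show "f \<in> ideal_power (point_ideal p) m \<Longrightarrow> \<forall>i<m. coeff (taylor p v f) i = 0"
    by (simp add: monom_1_dvd_iff')
next
  assume 0: "\<forall>i<m. coeff (taylor p v f) i = 0"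
  have "coeff (taylor p v f) i \<in> ideal_power (point_ideal p) m" for i
  proof (cases "i < m")
    case True
    with 0 show ?thesis by (simp add: ideal.subspace_0[OF subspace_ideal_power])
  next
    case False
    then show ?thesis
      using taylor_in_rees[where p=p and v=v and f=f, OF v] ideal_power_antimono[of m i]
      unfolding rees_def by fastforce
  qed
  then have "poly (taylor p v f) 1 \<in> ideal_power (point_ideal p) m"
    by (auto simp: poly_altdef intro: ideal.subspace_sum[OF subspace_ideal_power])
  then show "f \<in> ideal_power (point_ideal p) m"
    by (simp add: poly_taylor_1)
qed

lemma Var_neq_0 [simp]: "(Var v :: ('v, 'a::comm_ring_1) mpoly) \<noteq> 0"
  by (metis Var_def lookup_single_eq lookup_zero zero_neq_one)

text \<open>
  The coordinate \<open>v\<close> does not vanish at \<open>p\<close>, hence its Taylor expansion is the constant \<^term>\<open>Var v\<close>, and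
  multiplication by it does not change the order.
\<close>

lemma ideal_power_point_saturated:
  fixes p :: "'a::field^3"
  assumes v: "p $ v \<noteq> 0" and "Var v ^ N * f \<in> ideal_power (point_ideal p) m"
  shows "f \<in> ideal_power (point_ideal p) m"
proof -
  have "taylor p v (Var v ^ N * f) = [:Var v ^ N:] * taylor p v f"
    using v by (simp add: ring_map.hom[OF ring_map_taylor] taylor_Var retract_def poly_const_pow)
  then show ?thesis
    using assms by (simp add: ideal_power_iff_taylor[OF v])
qed

lemma subspace_fat_ideal: "ideal.subspace (fat_ideal n P m)"
  unfolding fat_ideal_def by (intro ideal.subspace_Inter) (auto simp: subspace_ideal_power)

lemma fat_ideal_saturated:
  fixes P :: "nat \<Rightarrow> 'a::field^3"
  assumes P: "\<And>i. i < n \<Longrightarrow> P i \<noteq> 0" and f: "\<And>v. \<exists>N. Var v ^ N * f \<in> fat_ideal n P m"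
  shows "f \<in> fat_ideal n P m"
  unfolding fat_ideal_def
proof (rule InterI, clarsimp)
  fix i assume i: "i < n"
  then obtain v where v: "P i $ v \<noteq> 0" using P by (auto simp: vec_eq_iff)
  obtain N where "Var v ^ N * f \<in> fat_ideal n P m" using f by blast
  then have "Var v ^ N * f \<in> ideal_power (point_ideal (P i)) (m i)"
    using i by (auto simp: fat_ideal_def)
  then show "f \<in> ideal_power (point_ideal (P i)) (m i)"
    using ideal_power_point_saturated[OF v] by blast
qed

section \<open>Lifting forms from a line\<close>

text \<open>
  \<open>E\<close> agrees with \<open>Var v ^ N\<close> on the line \<open>l = 0\<close>. With \<open>E\<close> in an ideal this says that on the chart of \<open>v\<close>
  the zero locus of the ideal does not meet the line. The cofactor has degree \<open>N - 1\<close>; this degree is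
  taken in the Laurent ring because for \<open>N = 0\<close> it has to force the cofactor to be \<open>0\<close>.
\<close>

definition coprime_witness :: "('v::finite, 'a::comm_ring_1) mpoly \<Rightarrow> 'v \<Rightarrow> nat \<Rightarrow> ('v, 'a) mpoly \<Rightarrow> bool" where
  "coprime_witness l v N E \<longleftrightarrow> (\<exists>A. homogeneous (int N - 1) (laurent A) \<and> Var v ^ N = E + l * A)"

lemma coprime_witness_1: "coprime_witness l v 0 1"
  unfolding coprime_witness_def by (intro exI[of _ 0]) simp

lemma coprime_witness_mult:
  fixes E :: "('v::finite, 'a::comm_ring_1) mpoly"
  assumes l: "homogeneous 1 l" and "coprime_witness l v N E" "coprime_witness l v N' E'"
  shows "coprime_witness l v (N + N') (E * E')"
proof -
  obtain A A' where A: "homogeneous (int N - 1) (laurent A)" "Var v ^ N = E + l * A"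
    and A': "homogeneous (int N' - 1) (laurent A')" "Var v ^ N' = E' + l * A'"
    using assms by (auto simp: coprime_witness_def)
  have l': "homogeneous (int 1) (laurent l)" using l homogeneous_laurent_iff by blast
  have "E = Var v ^ N - l * A" "E' = Var v ^ N' - l * A'" using A(2) A'(2) by auto
  have "laurent (l * A') = laurent l * laurent A'" by (rule laurent.mult)
  moreover have "homogeneous (int N') (laurent l * laurent A')"
    by (rule homogeneous_mult'[OF l' A'(1)]) simp
  ultimately have "homogeneous (int N') (laurent E')"
    unfolding \<open>E' = _\<close> laurent.diff laurent.power laurent_Var
    by (intro homogeneous_diff homogeneous_Var_power) simp
  then have "homogeneous (int (N + N') - 1) (laurent A * laurent E')"
    by (rule homogeneous_mult'[OF A(1)]) simp
  moreover have "homogeneous (int (N + N') - 1) (Var v ^ N * laurent A')"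
    by (rule homogeneous_mult'[OF homogeneous_Var_power A'(1)]) simp
  ultimately have "homogeneous (int (N + N') - 1) (laurent (A * E' + Var v ^ N * A'))"
    unfolding laurent.add laurent.mult laurent.power laurent_Var by (rule homogeneous_add)
  moreover have "Var v ^ (N + N') = E * E' + l * (A * E' + Var v ^ N * A')"
    unfolding power_add A(2) A'(2) by (simp add: algebra_simps)
  ultimately show ?thesis unfolding coprime_witness_def by blast
qed

lemma coprime_witness_linear:
  "coprime_witness l v 1 (Var v - Const c * l)"
  unfolding coprime_witness_def
  by (rule exI[of _ "Const c"]) (simp add: homogeneous_Const)

lemma coprime_witness_power:
  assumes "homogeneous 1 l" "coprime_witness l v N E"
  shows "coprime_witness l v (m * N) (E ^ m)"
proof (induction m)
  case (Suc m)
  then show ?case using coprime_witness_mult[OF assms(1) Suc assms(2)] by (simp add: ac_simps)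
qed (simp add: coprime_witness_1)

lemma coprime_witness_prod:
  fixes n :: nat
  assumes l: "homogeneous 1 l" and "\<And>i. i < n \<Longrightarrow> coprime_witness l v (N i) (E i)"
  shows "coprime_witness l v (\<Sum>i<n. N i) (\<Prod>i<n. E i)"
  using assms(2)
proof (induction n)
  case (Suc n)
  then show ?case using coprime_witness_mult[OF l Suc.IH Suc.prems, of n] by simp
qed (simp add: coprime_witness_1)

text \<open>
  A linear form \<open>Var v - c * l\<close> vanishes at \<open>P i\<close> for a suitable constant \<open>c\<close> and agrees with \<open>Var v\<close> on the
  line; take the product of the \<open>m i\<close>-th powers.
\<close>

lemma fat_ideal_coprime:
  fixes P :: "nat \<Rightarrow> 'a::field^3"
  assumes l: "homogeneous 1 l" and lP: "\<And>i. i < n \<Longrightarrow> eval l (($) (P i)) \<noteq> 0"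
  obtains E where "E \<in> fat_ideal n P m" "coprime_witness l v (\<Sum>i<n. m i) E"
proof
  define e where "e i = Var v - Const (P i $ v / eval l (($) (P i))) * l" for i
  have e: "e i \<in> point_ideal (P i)" if "i < n" for i
    unfolding point_ideal_def e_def using lP[OF that]
    by (intro ideal.span_base)
      (auto simp: ring_map.hom[OF ring_map_eval] intro!: exI[of _ 1] homogeneous_diff homogeneous_Const_mult homogeneous_Var l)
  show "coprime_witness l v (\<Sum>i<n. m i) (\<Prod>i<n. e i ^ m i)"
    using coprime_witness_power[OF l coprime_witness_linear, of v] 
    by (intro coprime_witness_prod l) (auto simp: e_def)
  show "(\<Prod>i<n. e i ^ m i) \<in> fat_ideal n P m"
    unfolding fat_ideal_def
  proof (rule InterI, clarsimp)
    fix i assume i: "i < n"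
    then have "(\<Prod>i<n. e i ^ m i) = (\<Prod>j\<in>{..<n} - {i}. e j ^ m j) * e i ^ m i"
      by (subst prod.remove[of _ i]) (auto simp: mult.commute)
    then show "(\<Prod>i<n. e i ^ m i) \<in> ideal_power (point_ideal (P i)) (m i)"
      by (simp add: ideal.subspace_scale[OF subspace_ideal_power] power_in_ideal_power[OF e[OF i]])
  qed
qed

text \<open>
  The exact sequence \<open>0 \<rightarrow> I(k) \<rightarrow> I(k+1) \<rightarrow> O(k+1) \<rightarrow> 0\<close>, where the last term is on the line \<open>l = 0\<close>: it is
  exact because the line avoids the zero locus of \<open>I\<close>. On the chart of \<open>v\<close> a lift of \<open>g\<close> to \<open>I\<close> is
  \<open>g * E v / Var v ^ N = g - l * g * a v\<close>, with \<open>a v\<close> as in the proof. The differences of the lifts,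
  divided by \<open>l\<close>, form a cocycle with values in \<open>I\<close>. A coboundary expression of it corrects the local
  lifts to a common global one.
\<close>

lemma h1_vanishes_lift:
  fixes I :: "(3, 'a::field) mpoly set"
  assumes I: "ideal.subspace I" and sat: "\<And>f. (\<And>v. \<exists>N. Var v ^ N * f \<in> I) \<Longrightarrow> f \<in> I"
    and E: "\<And>v. E v \<in> I" and cw: "\<And>v. coprime_witness l v N (E v)"
    and h1: "h1_vanishes I k" and l: "homogeneous 1 l" and g: "homogeneous (k + 1) g"
  obtains f where "f \<in> sections I (k + 1)" "l dvd g - f"
proof -
  obtain A where A: "\<And>v. homogeneous (int N - 1) (laurent (A v))" "\<And>v. Var v ^ N = E v + l * A v"
    using cw unfolding coprime_witness_def by metis
  have E_eq: "E v = Var v ^ N - l * A v" for v using A(2)[of v] by simp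
  have expand: "g * (y * a - x * b) = g * a * (y - l * b) - g * b * (x - l * a)"
    for g l a b x y :: "(3, 'a) mpoly"
    by (simp add: algebra_simps)
  define a where "a v = Varinv v ^ N * laurent (A v)" for v
  define c where "c v w = laurent g * (a v - a w)" for v w
  have homA: "homogeneous (-1) (a v)" for v
    unfolding a_def by (rule homogeneous_mult'[OF homogeneous_Varinv_power A(1)]) simp
  have homg: "homogeneous (int k + 1) (laurent g)"
    using g homogeneous_laurent_iff[of "k + 1" g] by (simp add: add.commute)
  have homga: "homogeneous (int k) (laurent g * a v)" for v
    by (rule homogeneous_mult'[OF homg homA]) simp
  have xa: "Var v ^ N * a v = laurent (A v)" for v by (simp add: a_def)
  have "c v w \<in> localization {v, w} I" for v w
  proof (cases "v = w")
    case True
    then have "(\<Prod>v\<in>{v, w}. Var v) ^ 0 * c v w = laurent 0" by (simp add: c_def)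
    then show ?thesis unfolding localization_def using ideal.subspace_0[OF I] by blast
  next
    case False
    then have "(\<Prod>v\<in>{v, w}. Var v) ^ N * c v w = (Var v * Var w) ^ N * c v w" by simp
    also have "\<dots> = laurent g * (Var w ^ N * (Var v ^ N * a v) - Var v ^ N * (Var w ^ N * a w))"
      by (simp only: c_def power_mult_distrib right_diff_distrib ac_simps)
    also have "\<dots> = laurent (g * (Var w ^ N * A v - Var v ^ N * A w))"
      by (simp only: xa laurent.mult laurent.diff laurent.power laurent_Var)
    also have "g * (Var w ^ N * A v - Var v ^ N * A w) = g * A v * E w - g * A w * E v"
      unfolding E_eq by (rule expand)
    finally have "(\<Prod>v\<in>{v, w}. Var v) ^ N * c v w = laurent (g * A v * E w - g * A w * E v)" .
    moreover have "g * A v * E w - g * A w * E v \<in> I"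
      using E ideal.subspace_scale[OF I] ideal.subspace_diff[OF I] by blast
    ultimately show ?thesis unfolding localization_def by blast
  qed
  moreover have "homogeneous (int k) (c v w)" for v w
    unfolding c_def right_diff_distrib by (intro homogeneous_diff homga)
  moreover have "c v w + c w z = c v z" for v w z
    by (simp add: c_def algebra_simps)
  ultimately obtain b where b: "\<And>v. b v \<in> localization {v} I" "\<And>v. homogeneous (int k) (b v)"
    "\<And>v w. c v w = b w - b v"
    using h1 unfolding h1_vanishes_def by metis
  have "\<exists>M B. B \<in> I \<and> Var v ^ M * b v = laurent B" for v
    using b(1)[of v] by (auto simp: localization_def)
  then obtain M B where B: "\<And>v. B v \<in> I" "\<And>v. Var v ^ M v * b v = laurent (B v)" by metis
  \<comment> \<open>The corrected cofactor of \<open>l\<close>: it does not depend on the chart, so it is a polynomial.\<close>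
  define q where "q = laurent g * a 1 + b 1"
  have q: "q = laurent g * a v + b v" for v
    using b(3)[of 1 v] by (simp add: q_def c_def algebra_simps)
  have xq: "Var v ^ (N + M v) * q = laurent (Var v ^ M v * g * A v + Var v ^ N * B v)" for v
  proof -
    have "Var v ^ (N + M v) * q = Var v ^ M v * laurent g * (Var v ^ N * a v) + Var v ^ N * (Var v ^ M v * b v)"
      by (simp add: q[of v] power_add algebra_simps)
    then show ?thesis by (simp add: xa B laurent.hom)
  qed
  have "q \<in> range laurent"
    using xq by (intro range_laurentI[of 1 2 "N + M 1" q "N + M 2"]) auto
  then obtain Q where Q: "q = laurent Q" by blast
  have "homogeneous (int k) (laurent Q)"
    unfolding Q[symmetric] q_def by (intro homogeneous_add homga b)
  then have homQ: "homogeneous k Q" by (simp add: homogeneous_laurent_iff)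
  show ?thesis
  proof
    show "l dvd g - (g - l * Q)" by simp
    have "homogeneous (k + 1) (l * Q)" by (rule homogeneous_mult'[OF l homQ]) simp
    then have "homogeneous (k + 1) (g - l * Q)" by (rule homogeneous_diff[OF g])
    moreover have "g - l * Q \<in> I"
    proof (rule sat)
      fix v
      have "Var v ^ (N + M v) * Q = Var v ^ M v * g * A v + Var v ^ N * B v"
        using xq[of v] unfolding Q laurent_Var[symmetric] laurent.power[symmetric] laurent.mult[symmetric]
        by simp
      moreover have "Var v ^ (N + M v) * (g - l * Q) = Var v ^ (N + M v) * g - l * (Var v ^ (N + M v) * Q)"
        by (simp add: algebra_simps)
      ultimately have "Var v ^ (N + M v) * (g - l * Q) = (Var v ^ M v * g) * (Var v ^ N - l * A v) - (l * Var v ^ N) * B v"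
        by (simp add: algebra_simps power_add)
      also have "\<dots> \<in> I"
        unfolding E_eq[symmetric] using E B ideal.subspace_scale[OF I] ideal.subspace_diff[OF I] by blast
      finally show "\<exists>N. Var v ^ N * (g - l * Q) \<in> I" by blast
    qed
    ultimately show "g - l * Q \<in> sections I (k + 1)" by (simp add: sections_def)
  qed
qed

text \<open>
  A form of higher degree is a combination of the variables with forms of one degree less, and \<open>I\<close> is
  an ideal.
\<close>

lemma lift_higher_degree:
  fixes I :: "('v::finite, 'a::field) mpoly set"
  assumes I: "ideal.subspace I"
    and base: "\<And>g. homogeneous k g \<Longrightarrow> \<exists>f\<in>sections I k. l dvd g - f"
    and "k \<le> n" "homogeneous n g"
  shows "\<exists>f\<in>sections I n. l dvd g - f"
  using \<open>k \<le> n\<close> \<open>homogeneous n g\<close>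
proof (induction n arbitrary: g rule: dec_induct)
  case (step n)
  obtain G where G: "\<And>j. homogeneous n (G j)" "g = (\<Sum>j\<in>UNIV. Var j * G j)"
    using homogeneous_Suc_decompose[OF step.prems] by blast
  obtain F where F: "\<And>j. F j \<in> sections I n" "\<And>j. l dvd G j - F j"
    using step.IH[OF G(1)] by metis
  show ?case
  proof
    have "l dvd (\<Sum>j\<in>UNIV. Var j * (G j - F j))" using F(2) by (intro dvd_sum dvd_mult)
    then show "l dvd g - (\<Sum>j\<in>UNIV. Var j * F j)"
      by (simp add: G(2) right_diff_distrib sum_subtractf)
    have "homogeneous (Suc n) (Var j * F j)" for j
      by (rule homogeneous_mult'[OF homogeneous_Var]) (use F(1)[of j] in \<open>auto simp: sections_def\<close>)
    moreover have "Var j * F j \<in> I" for j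
      using F(1)[of j] ideal.subspace_scale[OF I] by (simp add: sections_def)
    ultimately show "(\<Sum>j\<in>UNIV. Var j * F j) \<in> sections I (Suc n)"
      by (auto simp: sections_def intro: homogeneous_sum ideal.subspace_sum[OF I])
  qed
qed (use base in blast)

section \<open>Bezout identities over an algebraically closed field\<close>

lemma infinite_alg_closed: "infinite (UNIV :: 'a::alg_closed_field set)"
proof
  assume fin: "finite (UNIV :: 'a set)"
  define p where "p = (\<Prod>a\<in>(UNIV :: 'a set). [:-a, 1:])"
  have deg: "degree p = card (UNIV :: 'a set)"
    unfolding p_def by (subst degree_prod_eq_sum_degree) (auto simp: fin)
  then have "degree p > 0" using fin by (simp add: card_gt_0_iff)
  then have "degree (p + 1) > 0" by (subst degree_add_eq_left) auto
  then obtain x where "poly (p + 1) x = 0" using alg_closed_imp_poly_has_root by blast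
  moreover have "poly p x = 0"
    unfolding p_def poly_prod by (rule prod_zero) (auto simp: fin)
  ultimately show False by simp
qed

text \<open>
  A nonzero element of least degree of the ideal generated by the \<open>f j\<close> divides all of them, so it has no
  root and is a constant.
\<close>

lemma common_root_free_bezout:
  fixes f :: "'i::finite \<Rightarrow> 'a::alg_closed_field poly"
  assumes "\<And>x. \<exists>j. poly (f j) x \<noteq> 0"
  obtains a where "(\<Sum>j\<in>UNIV. a j * f j) = 1"
proof -
  define A where "A = range (\<lambda>a. \<Sum>j\<in>UNIV. a j * f j)"
  have fA: "f j \<in> A" for j
    unfolding A_def by (rule range_eqI[of _ _ "\<lambda>i. if i = j then 1 else 0"]) (simp add: if_distrib[of "\<lambda>x. x * _"] cong: if_cong)
  have scale: "c * u \<in> A" if "u \<in> A" for c u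
  proof -
    from that obtain a where "u = (\<Sum>j\<in>UNIV. a j * f j)" by (auto simp: A_def)
    then show ?thesis unfolding A_def
      by (intro range_eqI[of _ _ "\<lambda>j. c * a j"]) (simp add: sum_distrib_left mult.assoc)
  qed
  have diff: "u - w \<in> A" if "u \<in> A" "w \<in> A" for u w
  proof -
    from that obtain a b where "u = (\<Sum>j\<in>UNIV. a j * f j)" "w = (\<Sum>j\<in>UNIV. b j * f j)" by (auto simp: A_def)
    then show ?thesis unfolding A_def
      by (intro range_eqI[of _ _ "\<lambda>j. a j - b j"]) (simp add: left_diff_distrib sum_subtractf)
  qed
  obtain j0 where "f j0 \<noteq> 0" using assms[of 0] by force
  then have ex: "\<exists>n u. u \<in> A \<and> u \<noteq> 0 \<and> degree u = n" using fA by blast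
  then obtain h where h: "h \<in> A" "h \<noteq> 0" and min: "\<And>u. u \<in> A \<Longrightarrow> u \<noteq> 0 \<Longrightarrow> degree h \<le> degree u"
    using exists_least_iff[of "\<lambda>n. \<exists>u. u \<in> A \<and> u \<noteq> 0 \<and> degree u = n"] by (metis not_le)
  have "h dvd f j" for j
  proof (rule ccontr)
    assume "\<not> h dvd f j"
    then have "f j mod h \<noteq> 0" by (simp add: dvd_eq_mod_eq_0)
    moreover have "f j mod h \<in> A"
      using diff[OF fA[of j] scale[OF h(1), of "f j div h"]] by (simp add: minus_div_mult_eq_mod)
    ultimately show False
      using min[of "f j mod h"] degree_mod_less[OF h(2), of "f j"] by auto
  qed
  then have "poly h x \<noteq> 0" for x
    using assms[of x] by (metis dvd_def mult_zero_left poly_mult)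
  then have "degree h = 0" using alg_closed_imp_poly_has_root by blast
  then obtain c where c: "h = [:c:]" by (rule degree_eq_zeroE)
  then have "[:inverse c:] * h = 1" using h(2) by (simp add: one_pCons)
  then have "1 \<in> A" using scale[OF h(1)] by metis
  then show ?thesis using that by (auto simp: A_def)
qed

lemma common_root_free_bezout_2:
  fixes f g :: "'a::alg_closed_field poly"
  assumes "\<And>x. poly f x = 0 \<Longrightarrow> poly g x \<noteq> 0"
  obtains a b where "a * f + b * g = 1"
proof -
  obtain c where "(\<Sum>j\<in>UNIV. c j * (if j then f else g)) = 1"
    using common_root_free_bezout[of "\<lambda>j. if j then f else g"] assms by (metis (full_types))
  then show ?thesis using that[of "c True" "c False"] by (simp add: UNIV_bool add.commute)
qed

section \<open>Binary forms\<close>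

lemma UNIV_2_eq: "(UNIV :: 2 set) = {v, v + 1}" and plus_1_neq_2 [simp]: "v + 1 \<noteq> (v :: 2)" "v \<noteq> v + 1"
proof -
  have two: "(2 :: 2) = 0" using exhaust_2[of 0] by auto
  have "v = 1 \<and> v + 1 = 2 \<or> v = 2 \<and> v + 1 = 1"
  proof (cases "v = 1")
    case False
    then have "v = 2" using exhaust_2[of v] by simp
    moreover from this have "v + 1 = 1" by (simp only: two add_0)
    ultimately show ?thesis by blast
  qed simp
  moreover have "(1 :: 2) \<noteq> 2" by (simp only: two one_neq_zero not_False_eq_True)
  ultimately show "(UNIV :: 2 set) = {v, v + 1}" "v + 1 \<noteq> v" "v \<noteq> v + 1"
    by (metis UNIV_2 insert_commute)+
qed

lemma neq_iff_plus_1: "u \<noteq> v \<longleftrightarrow> u = v + (1 :: 2)"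
  using UNIV_2_eq[of v] plus_1_neq_2[of v] by (metis UNIV_I insert_iff singletonD)

text \<open>
  Restriction of binary forms to the chart \<open>v = 1\<close>, and the inverse operation on forms of a fixed degree.
  The other variable is \<open>v + 1\<close>, addition being modulo 2 in the index type.
\<close>

definition dehom :: "2 \<Rightarrow> (2, 'a::field) mpoly \<Rightarrow> 'a poly" where
  "dehom v = mpoly_hom (\<lambda>c. [:c:]) (\<lambda>u. if u = v then 1 else [:0, 1:])"

definition rehom :: "2 \<Rightarrow> nat \<Rightarrow> 'a::field poly \<Rightarrow> (2, 'a) mpoly" where
  "rehom v n p = (\<Sum>i\<le>n. Const (coeff p i) * (Var v ^ (n - i) * Var (v + 1) ^ i))"

interpretation dehom: ring_map "dehom v" for v
  unfolding dehom_def by (rule ring_map.ring_map_mpoly_hom[OF ring_map_const_poly])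

lemma dehom_Var: "dehom v (Var u) = (if u = v then 1 else [:0, 1:])"
  unfolding dehom_def by (rule ring_map.mpoly_hom_Var[OF ring_map_const_poly])

lemma dehom_Const: "dehom v (Const c) = [:c:]"
  unfolding dehom_def by (rule ring_map.mpoly_hom_Const[OF ring_map_const_poly])

lemma poly_dehom: "poly (dehom v f) x = eval f (\<lambda>u. if u = v then 1 else x)"
  unfolding dehom_def eval_def ring_map.map_mpoly_hom[OF ring_map_poly]
  by (simp add: if_distrib[of "\<lambda>p. poly p x"] cong: if_cong)

lemma dehom_subst:
  "dehom v (subst f x) = mpoly_hom (\<lambda>c. [:c:]) (\<lambda>j. dehom v (x j)) f"
  unfolding subst_def by (simp add: dehom.map_mpoly_hom dehom_Const)

lemma homogeneous_rehom: "homogeneous n (rehom v n p)"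
  unfolding rehom_def
proof (intro homogeneous_sum homogeneous_Const_mult)
  fix i assume "i \<in> {..n}"
  then show "homogeneous n (Var v ^ (n - i) * Var (v + 1) ^ i :: (2, 'a) mpoly)"
    using homogeneous_Var_power[where ?'e = nat]
    by (intro homogeneous_mult'[where d = "n - i" and e = i]) auto
qed

lemma dehom_rehom:
  assumes "degree p \<le> n"
  shows "dehom v (rehom v n p) = p"
proof -
  have "dehom v (rehom v n p) = (\<Sum>i\<le>n. monom (coeff p i) i)"
    by (simp add: rehom_def dehom.hom dehom_Var dehom_Const monom_altdef)
  also have "\<dots> = p" by (rule poly_as_sum_of_monoms'[OF assms])
  finally show ?thesis .
qed

lemma dehom_eq_sum:
  "dehom v f = (\<Sum>m\<in>Poly_Mapping.keys f. monom (Poly_Mapping.lookup f m) (Poly_Mapping.lookup m (v + 1)))"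
  unfolding dehom_def mpoly_hom_mon
  by (intro sum.cong refl)
    (simp add: mon_superset[OF finite subset_UNIV], simp add: UNIV_2_eq[of v] monom_altdef)

lemma degree_dehom_le:
  assumes "homogeneous n f"
  shows "degree (dehom v f) \<le> n"
  unfolding dehom_eq_sum
proof (rule degree_sum_le)
  fix m assume "m \<in> Poly_Mapping.keys f"
  then have "Poly_Mapping.lookup m v + Poly_Mapping.lookup m (v + 1) = n"
    using assms by (simp add: homogeneous_def UNIV_2_eq[of v])
  then show "degree (monom (Poly_Mapping.lookup f m) (Poly_Mapping.lookup m (v + 1))) \<le> n"
    by (intro order.trans[OF degree_monom_le]) linarith
qed simp

lemma dehom_eq_0:
  assumes f: "homogeneous n f" and 0: "dehom v f = 0"
  shows "f = 0"
proof (rule ccontr)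
  assume "f \<noteq> 0"
  then obtain m where m: "m \<in> Poly_Mapping.keys f" by (metis keys_eq_empty ex_in_conv)
  have uniq: "m' = m" if "m' \<in> Poly_Mapping.keys f" "Poly_Mapping.lookup m' (v + 1) = Poly_Mapping.lookup m (v + 1)" for m'
  proof (rule poly_mapping_eqI)
    fix u
    have "Poly_Mapping.lookup m v + Poly_Mapping.lookup m (v + 1) = n"
      "Poly_Mapping.lookup m' v + Poly_Mapping.lookup m' (v + 1) = n"
      using f m that(1) by (simp_all add: homogeneous_def UNIV_2_eq[of v])
    then show "Poly_Mapping.lookup m' u = Poly_Mapping.lookup m u"
      using that(2) neq_iff_plus_1[of u v] by (cases "u = v") auto
  qed
  have "coeff (dehom v f) (Poly_Mapping.lookup m (v + 1)) =
      (\<Sum>m'\<in>Poly_Mapping.keys f. if m' = m then Poly_Mapping.lookup f m else 0)"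
    unfolding dehom_eq_sum coeff_sum by (intro sum.cong refl) (use uniq in auto)
  then show False using m 0 by (simp add: in_keys_iff)
qed

lemma dehom_inject:
  "homogeneous n f \<Longrightarrow> homogeneous n g \<Longrightarrow> dehom v f = dehom v g \<Longrightarrow> f = g"
  using dehom_eq_0[of n "f - g" v] by (simp add: homogeneous_diff dehom.diff)

lemma rehom_dehom: "homogeneous n f \<Longrightarrow> rehom v n (dehom v f) = f"
  by (rule dehom_inject[of n _ _ v]) (simp_all add: homogeneous_rehom dehom_rehom degree_dehom_le)

text \<open>
  The leading coefficient measures the value at the one point outside the chart.
\<close>

lemma eval_rehom: "eval (rehom v n p) (\<lambda>u. if u = v then 0 else 1) = coeff p n"
proof -
  have "eval (rehom v n p) (\<lambda>u. if u = v then 0 else 1) = (\<Sum>i\<le>n. if i = n then coeff p n else 0)"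
    unfolding rehom_def ring_map.hom[OF ring_map_eval]
    by (intro sum.cong refl) (simp add: zero_power)
  then show ?thesis by simp
qed

text \<open>
  The degree assumption on \<open>L\<close> means that \<open>L\<close> has no zero at the point at infinity, so that divisibility can
  be tested on the chart.
\<close>

lemma form_dvd_of_dehom_dvd:
  assumes L: "homogeneous d L" "L \<noteq> 0" "degree (dehom v L) = d"
    and g: "homogeneous n g" and dvd: "dehom v L dvd dehom v g"
  obtains q where "homogeneous (n - d) q" "g = L * q"
proof -
  obtain q0 where q0: "dehom v g = dehom v L * q0" using dvd by (auto simp: dvd_def)
  show ?thesis
  proof (cases "q0 = 0")
    case True
    then have "g = 0" using dehom_eq_0[OF g, of v] q0 by simp
    then show ?thesis using that[of 0] by simp
  next
    case False
    have L0: "dehom v L \<noteq> 0" using dehom_eq_0[OF L(1), of v] L(2) by blast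
    have deg: "d + degree q0 \<le> n"
      using degree_dehom_le[OF g, of v] unfolding q0 by (simp add: degree_mult_eq[OF L0 False] L(3))
    have "homogeneous n (L * rehom v (n - d) q0)"
      by (rule homogeneous_mult'[OF L(1) homogeneous_rehom]) (use deg in simp)
    moreover have "dehom v (L * rehom v (n - d) q0) = dehom v g"
      using deg by (simp add: dehom.mult dehom_rehom q0)
    ultimately have "g = L * rehom v (n - d) q0"
      using dehom_inject[OF g] by metis
    then show ?thesis using that homogeneous_rehom by blast
  qed
qed

text \<open>
  The Nullstellensatz for binary forms: a Bezout identity on the chart \<open>v = 1\<close>, made homogeneous.
\<close>

lemma forms_without_common_zero:
  fixes f :: "'i::finite \<Rightarrow> (2, 'a::alg_closed_field) mpoly"
  assumes f: "\<And>j. homogeneous d (f j)"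
    and nz: "\<And>q :: 'a^2. q \<noteq> 0 \<Longrightarrow> \<exists>j. eval (f j) (($) q) \<noteq> 0"
  shows "\<exists>M a. Var v ^ M = (\<Sum>j\<in>UNIV. a j * f j)"
proof -
  have "\<exists>j. poly (dehom v (f j)) x \<noteq> 0" for x
  proof -
    let ?q = "(\<chi> u. if u = v then 1 else x) :: 'a^2"
    have "?q \<noteq> 0" by (auto simp: vec_eq_iff intro!: exI[of _ v])
    moreover have "($) ?q = (\<lambda>u. if u = v then 1 else x)" by auto
    ultimately show ?thesis using nz[of ?q] by (simp add: poly_dehom)
  qed
  then obtain a where a: "(\<Sum>j\<in>UNIV. a j * dehom v (f j)) = 1"
    by (rule common_root_free_bezout[of "\<lambda>j. dehom v (f j)"])
  define D where "D = (\<Sum>j\<in>UNIV. degree (a j))"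
  have deg: "degree (a j) \<le> D" for j
    unfolding D_def by (rule member_le_sum) auto
  have "homogeneous (D + d) (Var v ^ (D + d) :: (2, 'a) mpoly)"
    using homogeneous_Var_power[where ?'e = nat, of "D + d"] by simp
  moreover have "homogeneous (D + d) (\<Sum>j\<in>UNIV. rehom v D (a j) * f j)"
    by (intro homogeneous_sum homogeneous_mult homogeneous_rehom f)
  moreover have "dehom v (Var v ^ (D + d)) = dehom v (\<Sum>j\<in>UNIV. rehom v D (a j) * f j)"
    by (simp add: dehom.hom dehom_Var dehom_rehom deg a)
  ultimately have "Var v ^ (D + d) = (\<Sum>j\<in>UNIV. rehom v D (a j) * f j)"
    by (rule dehom_inject)
  then show ?thesis by (intro exI)
qed

section \<open>Line sections of a rational curve\<close>

lemma cong_mpoly_hom: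
  fixes L :: "'a::field poly"
  assumes "\<And>j. [f j = g j] (mod L)"
  shows "[mpoly_hom h f p = mpoly_hom h g p] (mod L)"
  unfolding mpoly_hom_def by (intro cong_sum cong_mult cong_prod cong_pow cong_refl assms)

lemma cong_pcompose:
  fixes L :: "'a::field poly"
  assumes "[u = w] (mod L)"
  shows "[pcompose p u = pcompose p w] (mod L)"
  by (induction p) (auto simp: pcompose_pCons intro!: cong_add cong_mult cong_refl assms)

lemma pcompose_as_sum:
  fixes p q :: "'a::field poly"
  assumes "degree p \<le> n"
  shows "pcompose p q = (\<Sum>i\<le>n. [:coeff p i:] * q ^ i)"
proof -
  have "pcompose p q = pcompose (\<Sum>i\<le>n. monom (coeff p i) i) q"
    by (simp add: poly_as_sum_of_monoms'[OF assms])
  also have "\<dots> = (\<Sum>i\<le>n. [:coeff p i:] * q ^ i)"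
    by (simp add: ring_map.hom[OF ring_map_pcompose] monom_altdef pcompose_smult pcompose_pCons)
  finally show ?thesis .
qed

text \<open>
  Here \<open>f\<close> is the parametrization on an affine chart, \<open>L\<close> the equation of a line restricted to it, and
  \<open>\<psi>1\<close>, \<open>\<psi>2\<close> describe an inverse rational map, defined at all points of the line section \<open>L = 0\<close>. The claim
  is that forms of degree \<open>n\<close> cut out all functions on the line section as soon as
  \<open>degree L \<le> n + 1\<close>.

  Let \<open>b\<close> be a linear form without zero on the section, and let \<open>x\<close> be an affine coordinate on the line, the
  quotient of another linear form by \<open>b\<close>. Modulo \<open>L\<close>, a form of degree \<open>i\<close> is \<open>b ^ i\<close> times a polynomial in \<open>x\<close>.
  The inverse map expresses the parameter \<open>t\<close> as a quotient of polynomials in \<open>x\<close>, and the denominator is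
  invertible as a polynomial in \<open>x\<close>. So every function is a polynomial in \<open>x\<close>. As \<open>x\<close> satisfies an
  equation \<open>D(x) = 0\<close> of degree \<open>degree L\<close>, namely the product of \<open>x - x(a)\<close> over the roots \<open>a\<close> of \<open>L\<close>,
  degrees at most \<open>n\<close> suffice, and multiplication by \<open>b ^ n\<close> makes the polynomial homogeneous.
\<close>

lemma line_section_surjective:
  fixes L :: "'a::alg_closed_field poly" and f :: "3 \<Rightarrow> 'a poly"
  assumes L0: "L \<noteq> 0" and deg: "degree L \<le> n + 1"
    and line: "L dvd f 1 + [:l2:] * f 2 + [:l3:] * f 3"
    and nz: "\<And>x. poly L x = 0 \<Longrightarrow> \<exists>j. poly (f j) x \<noteq> 0"
    and \<psi>: "homogeneous e \<psi>1" "homogeneous e \<psi>2"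
    and inv: "mpoly_hom (\<lambda>c. [:c:]) f \<psi>2 = [:0, 1:] * mpoly_hom (\<lambda>c. [:c:]) f \<psi>1"
    and nz\<psi>: "\<And>x. poly L x = 0 \<Longrightarrow> poly (mpoly_hom (\<lambda>c. [:c:]) f \<psi>1) x \<noteq> 0"
  shows "\<exists>g. homogeneous n g \<and> L dvd y - mpoly_hom (\<lambda>c. [:c:]) f g"
proof -
  let ?ev = "mpoly_hom (\<lambda>c :: 'a. [:c:])"
  interpret ev: ring_map "?ev z" for z :: "3 \<Rightarrow> 'a poly"
    by (rule ring_map.ring_map_mpoly_hom[OF ring_map_const_poly])
  have fin: "finite {x. poly L x = 0}" by (rule poly_roots_finite[OF L0])
  have line0: "poly (f 1) x + l2 * poly (f 2) x + l3 * poly (f 3) x = 0" if "poly L x = 0" for x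
    using line that by (auto simp: dvd_def dest!: arg_cong[of _ _ "\<lambda>p. poly p x"])
  have f23: "poly (f 2) x \<noteq> 0 \<or> poly (f 3) x \<noteq> 0" if root: "poly L x = 0" for x
  proof -
    obtain j where "poly (f j) x \<noteq> 0" using nz[OF root] by blast
    then show ?thesis using line0[OF root] exhaust_3[of j] by auto
  qed
  have "finite ((\<lambda>x. - poly (f 2) x / poly (f 3) x) ` {x. poly L x = 0})" using fin by simp
  then obtain c where c: "c \<notin> (\<lambda>x. - poly (f 2) x / poly (f 3) x) ` {x. poly L x = 0}"
    using infinite_alg_closed ex_new_if_finite by blast
  define b where "b = f 2 + [:c:] * f 3"
  have bnz: "poly b x \<noteq> 0" if "poly L x = 0" for x
  proof
    assume "poly b x = 0"
    then have eq: "poly (f 2) x + c * poly (f 3) x = 0" by (simp add: b_def)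
    then have "poly (f 3) x \<noteq> 0" using f23[OF that] by auto
    moreover from this eq have "c = - poly (f 2) x / poly (f 3) x"
      by (simp add: field_simps eq_neg_iff_add_eq_0)
    ultimately show False using c that by blast
  qed
  then obtain w b' where "w * L + b' * b = 1"
    using common_root_free_bezout_2[of L b] by blast
  then have "b * b' - 1 = L * (- w)" by (simp add: algebra_simps eq_diff_eq)
  then have bb': "[b * b' = 1] (mod L)" by (simp add: cong_iff_dvd_diff)
  have cancel_b: "[u = z] (mod L)" if "[b ^ i * u = b ^ i * z] (mod L)" for i u z
  proof -
    have "[b' ^ i * (b ^ i * u) = b' ^ i * (b ^ i * z)] (mod L)"
      by (rule cong_mult[OF cong_refl that])
    moreover have "[b' ^ i * (b ^ i * t) = t] (mod L)" for t
      using cong_mult[OF cong_pow[OF bb', of i] cong_refl[of t]] by (simp add: power_mult_distrib ac_simps)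
    ultimately show ?thesis by (meson cong_sym cong_trans)
  qed
  define x where "x = f 3 * b'"
  have f3: "[f 3 = b * x] (mod L)"
    using cong_mult[OF cong_refl[of "f 3"] cong_sym[OF bb']] by (simp add: x_def ac_simps)
  \<comment> \<open>The homogeneous coordinates on the line, divided by \<open>b\<close>, as polynomials in \<open>x\<close>; the first one is
    determined by the equation of the line.\<close>
  define p where "p j = (if j = 1 then [:-l2, l2 * c - l3:] else if j = 2 then [:1, -c:] else [:0, 1:])" for j :: 3
  have fp: "[f j = b * pcompose (p j) x] (mod L)" for j
  proof -
    have 3: "pcompose (p 3) x = x" by (simp add: p_def pcompose_pCons)
    have 2: "pcompose (p 2) x = 1 - [:c:] * x" by (simp add: p_def pcompose_pCons one_pCons)
    have 1: "pcompose (p 1) x = - ([:l2:] * (1 - [:c:] * x) + [:l3:] * x)"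
      by (simp add: p_def pcompose_pCons algebra_simps one_pCons smult_diff_left smult_diff_right)
    have c2: "[f 2 = b * (1 - [:c:] * x)] (mod L)"
    proof -
      have "[b - [:c:] * f 3 = b - [:c:] * (b * x)] (mod L)"
        by (intro cong_diff cong_mult cong_refl f3)
      moreover have "b - [:c:] * f 3 = f 2" by (simp add: b_def)
      moreover have "b - [:c:] * (b * x) = b * (1 - [:c:] * x)"
        by (simp only: right_diff_distrib mult_1_right mult.left_commute)
      ultimately show ?thesis by (simp only:)
    qed
    have "[f 1 = - ([:l2:] * f 2 + [:l3:] * f 3)] (mod L)"
      using line by (simp add: cong_iff_dvd_diff algebra_simps)
    also have "[- ([:l2:] * f 2 + [:l3:] * f 3) = - ([:l2:] * (b * (1 - [:c:] * x)) + [:l3:] * (b * x))] (mod L)"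
      using cong_diff[OF cong_refl[of 0] cong_add[OF cong_mult[OF cong_refl[of "[:l2:]"] c2] cong_mult[OF cong_refl[of "[:l3:]"] f3]]]
      by simp
    also have "- ([:l2:] * (b * (1 - [:c:] * x)) + [:l3:] * (b * x)) = b * pcompose (p 1) x"
      by (simp only: 1 mult_minus_right distrib_left mult.left_commute)
    finally have c1: "[f 1 = b * pcompose (p 1) x] (mod L)" .
    have "j = 1 \<or> j = 2 \<or> j = 3" by (rule exhaust_3)
    then show ?thesis using c1 c2 f3 2 3 by auto
  qed
  have ev_form: "[?ev f h = b ^ i * pcompose (?ev p h) x] (mod L)" if "homogeneous i h" for h i
  proof -
    have "[?ev f h = ?ev (\<lambda>j. b * pcompose (p j) x) h] (mod L)"
      by (rule cong_mpoly_hom[OF fp])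
    also have "?ev (\<lambda>j. b * pcompose (p j) x) h = b ^ i * ?ev (\<lambda>j. pcompose (p j) x) h"
      by (rule eval_homogeneous_scale[OF that])
    also have "?ev (\<lambda>j. pcompose (p j) x) h = pcompose (?ev p h) x"
      by (simp add: ring_map.map_mpoly_hom[OF ring_map_pcompose])
    finally show ?thesis .
  qed
  define \<Psi>1 \<Psi>2 where "\<Psi>1 = ?ev p \<psi>1" and "\<Psi>2 = ?ev p \<psi>2"
  note ev1 = ev_form[OF \<psi>(1), folded \<Psi>1_def] and ev2 = ev_form[OF \<psi>(2), folded \<Psi>2_def]
  have \<Psi>: "[pcompose \<Psi>2 x = [:0, 1:] * pcompose \<Psi>1 x] (mod L)"
  proof (rule cancel_b)
    have "[b ^ e * pcompose \<Psi>2 x = ?ev f \<psi>2] (mod L)" by (rule cong_sym[OF ev2])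
    also have "[?ev f \<psi>2 = [:0, 1:] * (b ^ e * pcompose \<Psi>1 x)] (mod L)"
      unfolding inv by (rule cong_mult[OF cong_refl ev1])
    finally show "[b ^ e * pcompose \<Psi>2 x = b ^ e * ([:0, 1:] * pcompose \<Psi>1 x)] (mod L)"
      by (simp only: ac_simps)
  qed
  obtain A where A: "size A = degree L" "L = smult (lead_coeff L) (\<Prod>a\<in>#A. [:-a, 1:])"
    using alg_closed_imp_factorization[OF L0] by blast
  have rootA: "poly L a = 0" if "a \<in># A" for a
  proof -
    have "[:-a, 1:] dvd (\<Prod>a\<in>#A. [:-a, 1:])" using that by (intro dvd_prod_mset) auto
    then show ?thesis by (subst A(2)) (auto simp: dvd_def)
  qed
  define D where "D = (\<Prod>a\<in>#A. [:- poly x a, 1:])"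
  have D0: "D \<noteq> 0" by (auto simp: D_def prod_mset_zero_iff)
  have degD: "degree D = degree L"
  proof -
    have "degree (\<Prod>a\<in>#B. [:- poly x a, 1:]) = size B" for B
    proof (induction B)
      case (add a B)
      have "degree ([:- poly x a, 1:] * (\<Prod>a\<in>#B. [:- poly x a, 1:])) =
          degree [:- poly x a, 1:] + degree (\<Prod>a\<in>#B. [:- poly x a, 1:])"
        by (rule degree_mult_eq) (auto simp: prod_mset_zero_iff)
      then show ?case by (simp only: image_mset_add_mset prod_mset.add_mset add.IH size_add_mset) simp
    qed simp
    then show ?thesis by (simp add: D_def A(1))
  qed
  have LD: "L dvd pcompose D x"
  proof -
    have "(\<Prod>a\<in>#B. [:-a, 1:]) dvd pcompose (\<Prod>a\<in>#B. [:- poly x a, 1:]) x" for B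
    proof (induction B)
      case (add a B)
      have "[:-a, 1:] dvd x - [:poly x a:]" by (simp flip: poly_eq_0_iff_dvd)
      also have "x - [:poly x a:] = pcompose [:- poly x a, 1:] x" by (simp add: pcompose_pCons)
      finally have "[:-a, 1:] dvd pcompose [:- poly x a, 1:] x" .
      from mult_dvd_mono[OF this add.IH] show ?case
        by (simp only: image_mset_add_mset prod_mset.add_mset pcompose_mult)
    qed (simp add: pcompose_1)
    then show ?thesis unfolding D_def by (subst A(2)) (simp add: smult_dvd L0)
  qed
  have "poly \<Psi>1 z \<noteq> 0" if "poly D z = 0" for z
  proof -
    have "\<exists>a. a \<in># A \<and> z = poly x a"
      using that by (auto simp: D_def poly_prod_mset prod_mset_zero_iff)
    then obtain a where a: "a \<in># A" "z = poly x a" by blast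
    have "L dvd ?ev f \<psi>1 - b ^ e * pcompose \<Psi>1 x" using ev1 by (simp add: cong_iff_dvd_diff)
    then obtain k where k: "?ev f \<psi>1 - b ^ e * pcompose \<Psi>1 x = L * k" by (auto simp: dvd_def)
    have "poly (?ev f \<psi>1 - b ^ e * pcompose \<Psi>1 x) a = 0"
      unfolding k using rootA[OF a(1)] by simp
    then show ?thesis using nz\<psi>[OF rootA[OF a(1)]] by (auto simp: poly_pcompose a(2))
  qed
  then obtain V U where "V * D + U * \<Psi>1 = 1"
    using common_root_free_bezout_2[of D \<Psi>1] by blast
  then have "pcompose (V * D + U * \<Psi>1) x = 1" by (simp add: pcompose_1)
  then have "pcompose U x * pcompose \<Psi>1 x - 1 = pcompose D x * (- pcompose V x)"
    by (simp add: pcompose_add pcompose_mult algebra_simps eq_diff_eq)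
  then have U1: "[pcompose U x * pcompose \<Psi>1 x = 1] (mod L)"
    using LD by (simp add: cong_iff_dvd_diff)
  \<comment> \<open>The parameter of the curve as a polynomial in \<open>x\<close>.\<close>
  define \<theta> where "\<theta> = U * \<Psi>2"
  have t: "[[:0, 1:] = pcompose \<theta> x] (mod L)"
  proof -
    have "[pcompose U x * pcompose \<Psi>2 x = pcompose U x * ([:0, 1:] * pcompose \<Psi>1 x)] (mod L)"
      by (rule cong_mult[OF cong_refl \<Psi>])
    also have "pcompose U x * ([:0, 1:] * pcompose \<Psi>1 x) = [:0, 1:] * (pcompose U x * pcompose \<Psi>1 x)"
      by (simp only: ac_simps)
    also have "[\<dots> = [:0, 1:] * 1] (mod L)" by (rule cong_mult[OF cong_refl U1])
    finally show ?thesis unfolding \<theta>_def pcompose_mult by (simp add: cong_sym)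
  qed
  have reduce: "\<exists>r. degree r \<le> n \<and> [z = pcompose r x] (mod L)" for z
  proof (intro exI conjI)
    define r where "r = pcompose z \<theta> mod D"
    show "degree r \<le> n"
      using degree_mod_less[OF D0, of "pcompose z \<theta>"] deg degD by (auto simp: r_def)
    have "z = pcompose z [:0, 1:]" by simp
    also have "[pcompose z [:0, 1:] = pcompose z (pcompose \<theta> x)] (mod L)" by (rule cong_pcompose[OF t])
    also have "pcompose z (pcompose \<theta> x) = pcompose (pcompose z \<theta>) x" by (rule pcompose_assoc)
    also have "[pcompose (pcompose z \<theta>) x = pcompose r x] (mod L)"
    proof -
      have "pcompose z \<theta> = r + D * (pcompose z \<theta> div D)" by (simp add: r_def)
      then have "pcompose (pcompose z \<theta>) x - pcompose r x = pcompose D x * pcompose (pcompose z \<theta> div D) x"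
        by (metis add_diff_cancel_left' pcompose_add pcompose_mult)
      then show ?thesis using LD by (simp add: cong_iff_dvd_diff)
    qed
    finally show "[z = pcompose r x] (mod L)" .
  qed
  obtain r where r: "degree r \<le> n" "[y * b' ^ n = pcompose r x] (mod L)"
    using reduce by blast
  define g :: "(3, 'a) mpoly" where
    "g = (\<Sum>i\<le>n. Const (coeff r i) * (Var 3 ^ i * (Var 2 + Const c * Var 3) ^ (n - i)))"
  have "homogeneous n g"
    unfolding g_def
  proof (intro homogeneous_sum homogeneous_Const_mult)
    fix i assume "i \<in> {..n}"
    moreover have "homogeneous 1 (Var 2 + Const c * Var 3 :: (3, 'a) mpoly)"
      by (intro homogeneous_add homogeneous_Const_mult homogeneous_Var)
    ultimately show "homogeneous n (Var 3 ^ i * (Var 2 + Const c * Var 3) ^ (n - i) :: (3, 'a) mpoly)"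
      using homogeneous_Var_power[where ?'e = nat, of i] homogeneous_power[where ?'e = nat, of 1 _ "n - i"]
      by (intro homogeneous_mult'[where d = i and e = "n - i"]) auto
  qed
  moreover have "[y = ?ev f g] (mod L)"
  proof -
    have "[y * 1 = y * (b * b') ^ n] (mod L)"
      using cong_pow[OF bb', of n] by (intro cong_mult cong_refl) (simp add: cong_sym)
    also have "y * (b * b') ^ n = b ^ n * (y * b' ^ n)" by (simp add: power_mult_distrib)
    also have "[\<dots> = b ^ n * pcompose r x] (mod L)" by (rule cong_mult[OF cong_refl r(2)])
    also have "b ^ n * pcompose r x = (\<Sum>i\<le>n. [:coeff r i:] * ((b * x) ^ i * b ^ (n - i)))"
      unfolding pcompose_as_sum[OF r(1)] sum_distrib_left
    proof (rule sum.cong[OF refl])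
      fix i assume "i \<in> {..n}"
      then have "b ^ n = b ^ i * b ^ (n - i)" by (simp flip: power_add)
      then show "b ^ n * ([:coeff r i:] * x ^ i) = [:coeff r i:] * ((b * x) ^ i * b ^ (n - i))"
        by (simp only: power_mult_distrib ac_simps)
    qed
    also have "[\<dots> = (\<Sum>i\<le>n. [:coeff r i:] * (f 3 ^ i * b ^ (n - i)))] (mod L)"
      by (intro cong_sum cong_mult cong_pow cong_refl cong_sym[OF f3])
    also have "(\<Sum>i\<le>n. [:coeff r i:] * (f 3 ^ i * b ^ (n - i))) = ?ev f g"
      unfolding g_def
      by (simp only: ev.hom ring_map.mpoly_hom_Var[OF ring_map_const_poly]
          ring_map.mpoly_hom_Const[OF ring_map_const_poly] b_def)
    finally show ?thesis by simp
  qed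
  ultimately show ?thesis by (auto simp: cong_iff_dvd_diff)
qed

section \<open>Choice of a general line\<close>

text \<open>
  The linear forms on the moment curve that vanish at a given nonzero vector are finite in number.
\<close>

lemma avoid_points:
  fixes Q :: "('a::alg_closed_field^3) set"
  assumes "finite Q" "\<And>q. q \<in> Q \<Longrightarrow> q \<noteq> 0"
  shows "\<exists>c. \<forall>q\<in>Q. q $ 1 + c * q $ 2 + c\<^sup>2 * q $ 3 \<noteq> 0"
proof -
  have "finite {x. poly [:q $ 1, q $ 2, q $ 3:] x = 0}" if "q \<in> Q" for q
    by (rule poly_roots_finite) (use assms(2)[OF that] in \<open>auto simp: vec_eq_iff forall_3\<close>)
  then have "finite (\<Union>q\<in>Q. {x. poly [:q $ 1, q $ 2, q $ 3:] x = 0})"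
    using assms(1) by blast
  then obtain c where "c \<notin> (\<Union>q\<in>Q. {x. poly [:q $ 1, q $ 2, q $ 3:] x = 0})"
    using infinite_alg_closed ex_new_if_finite by blast
  then show ?thesis by (intro exI[of _ c]) (auto simp: power2_eq_square algebra_simps)
qed

lemma eval_subst:
  "eval (subst f x) z = eval f (\<lambda>j. eval (x j) (z :: 'w \<Rightarrow> 'a::comm_ring_1))"
  unfolding subst_def by (simp add: ring_map.map_mpoly_hom[OF ring_map_eval] eval_def[of f])

text \<open>
  The line has to avoid the points \<open>P i\<close>, the image of the point at infinity of the projective line, and the
  images of the zeros of \<open>\<psi>1 \<circ> \<phi>\<close>, that is, the finitely many points where the inverse map is not
  available. The remaining lines cut the curve in a scheme of length \<open>d\<close> all of whose functions come
  from forms of the plane.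
\<close>

lemma general_line:
  fixes \<phi> :: "((2, 'a::alg_closed_field) mpoly)^3" and P :: "nat \<Rightarrow> 'a^3"
  assumes par: "rational_parametrization d F \<phi>" and P: "\<And>i. i < n \<Longrightarrow> P i \<noteq> 0"
  obtains l where "homogeneous 1 l" "\<And>i. i < n \<Longrightarrow> eval l (($) (P i)) \<noteq> 0"
    "subst l (($) \<phi>) \<noteq> 0" "degree (dehom 1 (subst l (($) \<phi>))) = d"
    "\<And>y j. d \<le> j + 1 \<Longrightarrow>
      \<exists>g. homogeneous j g \<and> dehom 1 (subst l (($) \<phi>)) dvd y - dehom 1 (subst g (($) \<phi>))"
proof -
  have \<phi>: "\<And>j. homogeneous d (\<phi> $ j)"
    and nz: "\<And>q :: 'a^2. q \<noteq> 0 \<Longrightarrow> \<exists>j. eval (\<phi> $ j) (($) q) \<noteq> 0"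
    using par by (auto simp: rational_parametrization_def)
  obtain e \<psi> where \<psi>: "\<And>i. homogeneous e (\<psi> $ i)" and \<psi>nz: "\<exists>i. subst (\<psi> $ i) (($) \<phi>) \<noteq> 0"
    and inv: "\<And>i j. Var i * subst (\<psi> $ j) (($) \<phi>) = Var j * subst (\<psi> $ i) (($) \<phi>)"
    using par unfolding rational_parametrization_def by metis
  define B where "B = dehom 1 (subst (\<psi> $ 1) (($) \<phi>))"
  have "subst (\<psi> $ 1) (($) \<phi>) \<noteq> 0"
  proof
    assume 0: "subst (\<psi> $ 1) (($) \<phi>) = 0"
    then have "subst (\<psi> $ j) (($) \<phi>) = 0" for j
      using inv[of 1 j] by simp
    then show False using \<psi>nz by blast
  qed
  then have B0: "B \<noteq> 0"
    unfolding B_def using dehom_eq_0 homogeneous_subst[OF \<psi>[of 1], where x = "($) \<phi>", OF \<phi>] by blast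
  define val where "val z = (\<chi> j. eval (\<phi> $ j) z)" for z :: "2 \<Rightarrow> 'a"
  have val0: "val z \<noteq> 0" if z: "z v = 1" for z v
  proof -
    have "(\<chi> u. z u) \<noteq> (0 :: 'a^2)" using z by (auto simp: vec_eq_iff intro!: exI[of _ v])
    from nz[OF this] obtain j where "eval (\<phi> $ j) (($) (\<chi> u. z u)) \<noteq> 0" by blast
    moreover have "($) (\<chi> u. z u) = z" by auto
    ultimately show ?thesis by (auto simp: val_def vec_eq_iff)
  qed
  define Q where "Q = P ` {..<n} \<union> {val (\<lambda>u. if u = 1 then 0 else 1)} \<union>
    (\<lambda>x. val (\<lambda>u. if u = 1 then 1 else x)) ` {x. poly B x = 0}"
  have "finite Q" unfolding Q_def using poly_roots_finite[OF B0] by simp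
  moreover have "q \<noteq> 0" if "q \<in> Q" for q
  proof -
    have 2: "(2 :: 2) \<noteq> 1" by (metis plus_1_neq_2(1) one_add_one)
    from that consider i where "i < n" "q = P i" | "q = val (\<lambda>u. if u = 1 then 0 else 1)"
      | x where "q = val (\<lambda>u. if u = 1 then 1 else x)"
      unfolding Q_def by blast
    then show ?thesis
    proof cases
      case 2
      then show ?thesis using \<open>(2 :: 2) \<noteq> 1\<close> by (simp add: val0[of _ 2])
    qed (use P in \<open>simp_all add: val0[of _ 1]\<close>)
  qed
  ultimately have "\<exists>c. \<forall>q\<in>Q. q $ 1 + c * q $ 2 + c\<^sup>2 * q $ 3 \<noteq> 0"
    by (rule avoid_points)
  then obtain c where c: "\<And>q. q \<in> Q \<Longrightarrow> q $ 1 + c * q $ 2 + c\<^sup>2 * q $ 3 \<noteq> 0"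
    by blast
  define l :: "(3, 'a) mpoly" where "l = Var 1 + Const c * Var 2 + Const (c\<^sup>2) * Var 3"
  have eval_l: "eval l z = z 1 + c * z 2 + c\<^sup>2 * z 3" for z
    by (simp add: l_def ring_map.hom[OF ring_map_eval])
  have hom_l: "homogeneous 1 l"
    unfolding l_def by (intro homogeneous_add homogeneous_Const_mult homogeneous_Var)
  define L where "L = subst l (($) \<phi>)"
  have hom_L: "homogeneous d L"
    using homogeneous_subst[OF hom_l \<phi>] by (simp add: L_def)
  have eval_L: "eval L z = val z $ 1 + c * val z $ 2 + c\<^sup>2 * val z $ 3" for z
    by (simp add: L_def eval_subst eval_l val_def)
  have "coeff (dehom 1 L) d = eval L (\<lambda>u. if u = 1 then 0 else 1)"
    using eval_rehom[of 1 d "dehom 1 L"] by (simp add: rehom_dehom[OF hom_L])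
  also have "\<dots> \<noteq> 0" unfolding eval_L by (rule c) (simp add: Q_def)
  finally have cd: "coeff (dehom 1 L) d \<noteq> 0" .
  then have deg_L: "degree (dehom 1 L) = d"
    using degree_dehom_le[OF hom_L] le_degree by (metis le_antisym)
  have L0: "dehom 1 L \<noteq> 0" using cd by auto
  show ?thesis
  proof
    show "homogeneous 1 l" by (rule hom_l)
    show "eval l (($) (P i)) \<noteq> 0" if "i < n" for i
      unfolding eval_l by (rule c) (use that in \<open>simp add: Q_def\<close>)
    show "subst l (($) \<phi>) \<noteq> 0" "degree (dehom 1 (subst l (($) \<phi>))) = d"
      using L0 deg_L by (auto simp: L_def)
    fix y j assume j: "d \<le> j + 1"
    show "\<exists>g. homogeneous j g \<and> dehom 1 (subst l (($) \<phi>)) dvd y - dehom 1 (subst g (($) \<phi>))"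
      unfolding L_def[symmetric] dehom_subst
    proof (rule line_section_surjective)
      show "dehom 1 L \<noteq> 0" "degree (dehom 1 L) \<le> j + 1" using L0 deg_L j by auto
      show "dehom 1 L dvd dehom 1 (\<phi> $ 1) + [:c:] * dehom 1 (\<phi> $ 2) + [:c\<^sup>2:] * dehom 1 (\<phi> $ 3)"
        by (simp add: L_def l_def ring_map.hom[OF ring_map_subst] dehom.hom dehom_Const)
      show "\<exists>j. poly (dehom 1 (\<phi> $ j)) x \<noteq> 0" for x
        using val0[of "\<lambda>u. if u = 1 then 1 else x" 1] by (auto simp: poly_dehom val_def vec_eq_iff)
      show "homogeneous e (\<psi> $ 1)" "homogeneous e (\<psi> $ 2)" by (rule \<psi>)+
      have "dehom 1 (Var 1 * subst (\<psi> $ 2) (($) \<phi>)) = dehom 1 (Var 2 * subst (\<psi> $ 1) (($) \<phi>))"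
        by (simp only: inv)
      moreover have "(2 :: 2) \<noteq> 1" by (metis plus_1_neq_2(1) one_add_one)
      ultimately show "mpoly_hom (\<lambda>c. [:c:]) (\<lambda>j. dehom 1 (\<phi> $ j)) (\<psi> $ 2) =
          [:0, 1:] * mpoly_hom (\<lambda>c. [:c:]) (\<lambda>j. dehom 1 (\<phi> $ j)) (\<psi> $ 1)"
        by (simp add: dehom.mult dehom_Var dehom_subst)
      show "poly (mpoly_hom (\<lambda>c. [:c:]) (\<lambda>j. dehom 1 (\<phi> $ j)) (\<psi> $ 1)) x \<noteq> 0"
        if "poly (dehom 1 L) x = 0" for x
      proof
        assume "poly (mpoly_hom (\<lambda>c. [:c:]) (\<lambda>j. dehom 1 (\<phi> $ j)) (\<psi> $ 1)) x = 0"
        then have "poly B x = 0" by (simp add: B_def dehom_subst)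
        then have "eval L (\<lambda>u. if u = 1 then 1 else x) \<noteq> 0"
          unfolding eval_L by (intro c) (simp add: Q_def)
        then show False using that by (simp add: poly_dehom)
      qed
    qed
  qed
qed

section \<open>Local membership in an ideal on a chart\<close>

text \<open>
  Membership in the localization \<^term>\<open>localization {v} J\<close>, for which closure properties are convenient
  to state.
\<close>

definition loc :: "'v \<Rightarrow> ('v, 'a::comm_ring_1) mpoly set \<Rightarrow> ('v, 'a) lpoly set" where
  "loc v J = {x. \<exists>M. Var v ^ M * x \<in> laurent ` J}"

lemma locI: "Var v ^ M * x = laurent b \<Longrightarrow> b \<in> J \<Longrightarrow> x \<in> loc v J"
  by (auto simp: loc_def)

lemma loc_cases:
  assumes "x \<in> loc v J"
  obtains M b where "Var v ^ M * x = laurent b" "b \<in> J"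
  using assms by (auto simp: loc_def)

lemma loc_mult:
  assumes "ideal.subspace J" "x \<in> loc v J"
  shows "laurent r * x \<in> loc v J"
proof -
  obtain M b where b: "Var v ^ M * x = laurent b" "b \<in> J" using loc_cases[OF assms(2)] by blast
  have "Var v ^ M * (laurent r * x) = laurent (r * b)"
    using b(1) by (simp add: laurent.mult mult.left_commute)
  then show ?thesis by (rule locI) (rule ideal.subspace_scale[OF assms(1) b(2)])
qed

lemma loc_add:
  assumes "ideal.subspace J" "x \<in> loc v J" "y \<in> loc v J"
  shows "x + y \<in> loc v J"
proof -
  obtain M b where b: "Var v ^ M * x = laurent b" "b \<in> J" using loc_cases[OF assms(2)] by blast
  obtain N c where c: "Var v ^ N * y = laurent c" "c \<in> J" using loc_cases[OF assms(3)] by blast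
  have "Var v ^ (M + N) * (x + y) = Var v ^ N * (Var v ^ M * x) + Var v ^ M * (Var v ^ N * y)"
    by (simp add: power_add algebra_simps)
  also have "\<dots> = laurent (Var v ^ N * b + Var v ^ M * c)"
    unfolding b c by (simp add: laurent.hom)
  finally show ?thesis
    by (rule locI) (intro ideal.subspace_add[OF assms(1)] ideal.subspace_scale[OF assms(1)] b c)
qed

lemma loc_sum: "ideal.subspace J \<Longrightarrow> (\<And>i. i \<in> A \<Longrightarrow> f i \<in> loc v J) \<Longrightarrow> sum f A \<in> loc v J"
proof (induction A rule: infinite_finite_induct)
  case empty
  show ?case by (rule locI[of _ 0 _ 0]) (use empty ideal.subspace_0 in auto)
next
  case (infinite A)
  show ?case by (rule locI[of _ 0 _ 0]) (use infinite ideal.subspace_0 in auto)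
qed (auto intro: loc_add)

lemma loc_laurent: "Var v ^ M * b \<in> J \<Longrightarrow> laurent b \<in> loc v J"
  by (rule locI[of _ M _ "Var v ^ M * b"]) (simp_all add: laurent.hom)

lemma loc_laurentD: "laurent b \<in> loc v J \<Longrightarrow> \<exists>M. Var v ^ M * b \<in> J"
proof -
  assume "laurent b \<in> loc v J"
  then obtain M c where "Var v ^ M * laurent b = laurent c" "c \<in> J" by (rule loc_cases)
  then have "laurent (Var v ^ M * b) = laurent c" by (simp add: laurent.hom)
  then show ?thesis using \<open>c \<in> J\<close> by (auto intro!: exI[of _ M])
qed

lemma loc_uminus: "ideal.subspace J \<Longrightarrow> x \<in> loc v J \<Longrightarrow> - x \<in> loc v J"
  using loc_mult[of J x v "-1"] by (simp add: laurent.minus)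

text \<open>
  In a monomial of degree at least \<open>2 * N\<close> one of the two exponents is at least \<open>N\<close>.
\<close>

lemma form_of_large_degree:
  fixes u :: "(2, 'a::field) mpoly"
  assumes u: "homogeneous m u" and m: "2 * N \<le> m"
  obtains a b where "homogeneous (m - N) a" "homogeneous (m - N) b" "u = Var 1 ^ N * a + Var 2 ^ N * b"
proof -
  let ?c = "\<lambda>i. Const (coeff (dehom 1 u) i) :: (2, 'a) mpoly"
  have 2: "(1 :: 2) + 1 = 2" by simp
  define a where "a = (\<Sum>i<N. ?c i * (Var 1 ^ (m - i - N) * Var 2 ^ i))"
  define b where "b = (\<Sum>i\<in>{N..m}. ?c i * (Var 1 ^ (m - i) * Var 2 ^ (i - N)))"
  note vp = homogeneous_Var_power[where ?'e = nat, simplified]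
  have "u = (\<Sum>i\<in>{..<N} \<union> {N..m}. ?c i * (Var 1 ^ (m - i) * Var 2 ^ i))"
    using rehom_dehom[OF u, of 1] m
    by (simp add: rehom_def ivl_disj_un 2)
  also have "\<dots> = (\<Sum>i<N. ?c i * (Var 1 ^ (m - i) * Var 2 ^ i)) + (\<Sum>i\<in>{N..m}. ?c i * (Var 1 ^ (m - i) * Var 2 ^ i))"
    by (rule sum.union_disjoint) auto
  also have "(\<Sum>i<N. ?c i * (Var 1 ^ (m - i) * Var 2 ^ i)) = Var 1 ^ N * a"
    unfolding a_def sum_distrib_left
  proof (rule sum.cong[OF refl])
    fix i assume "i \<in> {..<N}"
    then have "m - i = N + (m - i - N)" using m by simp
    then have "(Var 1 :: (2, 'a) mpoly) ^ (m - i) = Var 1 ^ N * Var 1 ^ (m - i - N)"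
      by (metis power_add)
    then show "?c i * (Var 1 ^ (m - i) * Var 2 ^ i) = Var 1 ^ N * (?c i * (Var 1 ^ (m - i - N) * Var 2 ^ i))"
      by (simp only: ac_simps)
  qed
  also have "(\<Sum>i\<in>{N..m}. ?c i * (Var 1 ^ (m - i) * Var 2 ^ i)) = Var 2 ^ N * b"
    unfolding b_def sum_distrib_left
  proof (rule sum.cong[OF refl])
    fix i assume "i \<in> {N..m}"
    then have "i = N + (i - N)" by simp
    then have "(Var 2 :: (2, 'a) mpoly) ^ i = Var 2 ^ N * Var 2 ^ (i - N)"
      by (metis power_add)
    then show "?c i * (Var 1 ^ (m - i) * Var 2 ^ i) = Var 2 ^ N * (?c i * (Var 1 ^ (m - i) * Var 2 ^ (i - N)))"
      by (simp only: ac_simps)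
  qed
  finally have "u = Var 1 ^ N * a + Var 2 ^ N * b" .
  moreover have "homogeneous (m - N) a" unfolding a_def
    by (intro homogeneous_sum homogeneous_Const_mult homogeneous_mult'[OF vp vp]) (use m in auto)
  moreover have "homogeneous (m - N) b" unfolding b_def
    by (intro homogeneous_sum homogeneous_Const_mult homogeneous_mult'[OF vp vp]) auto
  ultimately show ?thesis using that by blast
qed

section \<open>Vanishing of the first cohomology of the inverse image ideal\<close>

text \<open>
  A parametrized curve, an ideal and a line in the position produced by the previous sections:
  \<open>surj\<close> says that forms of degree at least \<open>d - 1\<close> cut out all functions on the line section of the curve,
  \<open>lift\<close> that forms on the line lift to the ideal, and \<open>coprime\<close> that the line avoids the zero locus
  of the ideal.
\<close>

locale rational_curve =
  fixes \<phi> :: "((2, 'a::alg_closed_field) mpoly)^3" and d k :: nat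
    and I :: "(3, 'a) mpoly set" and l :: "(3, 'a) mpoly"
  assumes I: "ideal.subspace I"
    and \<phi>: "\<And>j. homogeneous d (\<phi> $ j)"
    and nz\<phi>: "\<And>q :: 'a^2. q \<noteq> 0 \<Longrightarrow> \<exists>j. eval (\<phi> $ j) (($) q) \<noteq> 0"
    and d: "d > 0" "d \<le> k + 2"
    and l: "homogeneous 1 l"
    and l\<phi>: "subst l (($) \<phi>) \<noteq> 0" "degree (dehom 1 (subst l (($) \<phi>))) = d"
    and surj: "\<And>y j. d \<le> j + 1 \<Longrightarrow>
      \<exists>g. homogeneous j g \<and> dehom 1 (subst l (($) \<phi>)) dvd y - dehom 1 (subst g (($) \<phi>))"
    and lift: "\<And>n g. k + 1 \<le> n \<Longrightarrow> homogeneous n g \<Longrightarrow> \<exists>f\<in>sections I n. l dvd g - f"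
    and coprime: "\<exists>N. \<forall>v. \<exists>E A. E \<in> I \<and> Var v ^ N = E + l * A"
begin

definition J where "J = pullback_ideal \<phi> I"

abbreviation pb where "pb f \<equiv> subst f (($) \<phi>)"

abbreviation L where "L \<equiv> pb l"

sublocale pb: ring_map "\<lambda>f. pb f" by (rule ring_map_subst)

lemma subspace_J: "ideal.subspace J"
  unfolding J_def pullback_ideal_def by (rule ideal.subspace_span)

lemmas J_add = ideal.subspace_add[OF subspace_J]
  and J_diff = ideal.subspace_diff[OF subspace_J]
  and J_mult = ideal.subspace_scale[OF subspace_J]
  and J_sum = ideal.subspace_sum[OF subspace_J]
  and J_0 = ideal.subspace_0[OF subspace_J]

lemma pb_in_J: "f \<in> I \<Longrightarrow> pb f \<in> J"
  unfolding J_def pullback_ideal_def by (intro ideal.span_base) auto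

lemma hom_pb: "homogeneous n f \<Longrightarrow> homogeneous (d * n) (pb f)"
  by (rule homogeneous_subst[OF _ \<phi>])

lemma hom_L: "homogeneous d L"
  using hom_pb[OF l] by simp

text \<open>
  The two surjectivity properties combined. This is where \<open>d \<le> k + 2\<close> enters: it makes forms of degree
  \<open>k + 1\<close> numerous enough on the line section.
\<close>

lemma line_section_lift:
  assumes "k + 1 \<le> n"
  obtains f where "f \<in> sections I n" "dehom 1 L dvd y - dehom 1 (pb f)"
proof -
  obtain g where g: "homogeneous n g" "dehom 1 L dvd y - dehom 1 (pb g)"
    using surj[of n y] d assms by auto
  obtain f where f: "f \<in> sections I n" "l dvd g - f" using lift[OF assms g(1)] by blast
  have "dehom 1 L dvd dehom 1 (pb (g - f))" by (intro dehom.dvd pb.dvd f)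
  from dvd_add[OF g(2) this] have "dehom 1 L dvd y - dehom 1 (pb f)"
    by (simp add: pb.diff dehom.diff)
  then show ?thesis using that f by blast
qed

lemma coordinates_generate: "\<exists>M a. Var v ^ M = (\<Sum>j\<in>UNIV. a j * \<phi> $ j)"
  using forms_without_common_zero[of d "\<lambda>j. \<phi> $ j" v] \<phi> nz\<phi> by blast

text \<open>
  The line avoids the zero locus of the ideal, so \<open>L\<close> is a unit modulo \<^const>\<open>J\<close> locally, and a power of each
  \<open>\<phi> $ j\<close> multiplies \<open>r\<close> into \<^const>\<open>J\<close>. These powers have no common zero.
\<close>

lemma J_saturated_along_L:
  assumes "L * r \<in> J"
  shows "\<exists>M. Var v ^ M * r \<in> J"
proof -
  obtain N where N: "\<And>v. \<exists>E A. E \<in> I \<and> Var v ^ N = E + l * A" using coprime by blast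
  have *: "\<phi> $ j ^ N * r \<in> J" for j
  proof -
    obtain E A where EA: "E \<in> I" "Var j ^ N = E + l * A" using N by blast
    from arg_cong[OF EA(2), of pb] have "\<phi> $ j ^ N = pb E + L * pb A" by (simp add: pb.hom)
    then have "\<phi> $ j ^ N * r = r * pb E + pb A * (L * r)" by (simp add: algebra_simps)
    then show ?thesis using J_add J_mult pb_in_J[OF EA(1)] assms by presburger
  qed
  have "\<exists>j. eval (\<phi> $ j ^ N) (($) q) \<noteq> 0" if "q \<noteq> 0" for q :: "'a^2"
    using nz\<phi>[OF that] by (metis power_not_zero ring_map.power[OF ring_map_eval])
  then obtain M a where M: "Var v ^ M = (\<Sum>j\<in>UNIV. a j * \<phi> $ j ^ N)"
    using forms_without_common_zero[where f = "\<lambda>j. \<phi> $ j ^ N", OF homogeneous_power[OF \<phi>], of v] by blast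
  have "Var v ^ M * r = (\<Sum>j\<in>UNIV. a j * (\<phi> $ j ^ N * r))"
    by (simp add: M sum_distrib_right mult.assoc)
  then have "Var v ^ M * r \<in> J" using * by (simp add: J_sum J_mult)
  then show ?thesis by blast
qed

text \<open>
  The cocycle \<open>p / (st) ^ N\<close> of degree \<open>n\<close>, with \<open>s\<close>, \<open>t\<close> the two variables, is the sum of \<open>q / s ^ (N + A)\<close> and
  \<open>q' / t ^ (N + A)\<close>, hence a coboundary with values in \<^const>\<open>J\<close>.
\<close>

definition splits :: "nat \<Rightarrow> nat \<Rightarrow> (2, 'a) mpoly \<Rightarrow> bool" where
  "splits n N p \<longleftrightarrow> (\<exists>A q q'. q \<in> J \<and> q' \<in> J \<and>
     homogeneous (n + N + A) q \<and> homogeneous (n + N + A) q' \<and>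
     (Var 1 * Var 2) ^ A * p = Var 2 ^ (N + A) * q + Var 1 ^ (N + A) * q')"

text \<open>
  Vanishing in large degrees, in the weak form that a given cocycle is killed by every form of
  sufficiently large degree.
\<close>

lemma splits_multiple:
  assumes p: "p \<in> J" "homogeneous (n + 2 * N) p" and u: "homogeneous m u" "2 * N \<le> m"
  shows "splits (n + m) N (u * p)"
proof -
  obtain a b where ab: "homogeneous (m - N) a" "homogeneous (m - N) b" "u = Var 1 ^ N * a + Var 2 ^ N * b"
    using form_of_large_degree[OF u] by blast
  have "b * p \<in> J" "a * p \<in> J" using p J_mult by auto
  moreover have "homogeneous (n + m + N + 0) (b * p)" "homogeneous (n + m + N + 0) (a * p)"
    using u(2) by (auto intro: homogeneous_mult'[OF ab(1) p(2)] homogeneous_mult'[OF ab(2) p(2)])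
  moreover have "(Var 1 * Var 2) ^ 0 * (u * p) = Var 2 ^ (N + 0) * (b * p) + Var 1 ^ (N + 0) * (a * p)"
    by (simp add: ab(3) algebra_simps)
  ultimately show ?thesis unfolding splits_def by blast
qed

text \<open>
  Multiplication by \<open>L\<close> is injective on the first cohomology of \<^const>\<open>J\<close> in degrees \<open>d * j\<close>, \<open>j \<ge> k\<close>. Indeed, let
  \<open>L * p / (st) ^ N = q / s ^ M + q' / t ^ M\<close>. On the line section \<open>L = 0\<close> the two summands are opposite, so
  they come from a function there, which is the restriction of some \<open>f\<close> in the ideal. Subtracting \<open>f\<close> from the
  first summand and adding it to the second makes both divisible by \<open>L\<close>.
\<close>

lemma splits_descent:
  assumes p: "homogeneous (d * j + 2 * N) p" and j: "k \<le> j" and Lp: "splits (d * (j + 1)) N (L * p)"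
  shows "splits (d * j) N p"
proof -
  obtain A q q' where qJ: "q \<in> J" "q' \<in> J"
    and hq: "homogeneous (d * (j + 1) + N + A) q" "homogeneous (d * (j + 1) + N + A) q'"
    and eq: "(Var 1 * Var 2) ^ A * (L * p) = Var 2 ^ (N + A) * q + Var 1 ^ (N + A) * q'"
    using Lp unfolding splits_def by blast
  let ?s = "Var 1 :: (2, 'a) mpoly" and ?t = "Var 2 :: (2, 'a) mpoly" and ?N = "N + A"
  note vp = homogeneous_Var_power[where ?'e = nat, simplified]
  obtain f where f: "f \<in> sections I (j + 1)" "dehom 1 L dvd dehom 1 q - dehom 1 (pb f)"
    using line_section_lift[of "j + 1"] j by auto
  have fI: "pb f \<in> J" and hf: "homogeneous (d * (j + 1)) (pb f)"
    using f(1) hom_pb[of "j + 1" f] by (auto simp only: sections_def mem_Collect_eq pb_in_J)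
  have h1: "homogeneous (d * (j + 1) + N + A) (q - ?s ^ ?N * pb f)"
    by (intro homogeneous_diff hq homogeneous_mult'[OF vp hf]) simp
  have h2: "homogeneous (d * (j + 1) + N + A) (q' + ?t ^ ?N * pb f)"
    by (intro homogeneous_add hq homogeneous_mult'[OF vp hf]) simp
  have d1: "dehom 1 L dvd dehom 1 (q - ?s ^ ?N * pb f)"
    using f(2) by (simp add: dehom.hom dehom_Var)
  have "dehom 1 (q' + ?t ^ ?N * pb f) =
      dehom 1 L * dehom 1 (?t ^ A * p) - dehom 1 (?t ^ ?N) * (dehom 1 q - dehom 1 (pb f))"
    using arg_cong[OF eq, of "dehom 1"]
    by (simp add: dehom.hom dehom_Var[of 1 1] power_mult_distrib algebra_simps)
  then have d2: "dehom 1 L dvd dehom 1 (q' + ?t ^ ?N * pb f)"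
    using f(2) by simp
  have n: "d * (j + 1) + N + A - d = d * j + N + A" by simp
  obtain r where r: "homogeneous (d * j + N + A) r" "q - ?s ^ ?N * pb f = L * r"
    using form_dvd_of_dehom_dvd[OF hom_L l\<phi> h1 d1] unfolding n by blast
  obtain r' where r': "homogeneous (d * j + N + A) r'" "q' + ?t ^ ?N * pb f = L * r'"
    using form_dvd_of_dehom_dvd[OF hom_L l\<phi> h2 d2] unfolding n by blast
  have "L * ((?s * ?t) ^ A * p) = ?t ^ ?N * (L * r + ?s ^ ?N * pb f) + ?s ^ ?N * (L * r' - ?t ^ ?N * pb f)"
    using eq by (simp flip: r(2) r'(2) add: mult.left_commute)
  also have "\<dots> = L * (?t ^ ?N * r + ?s ^ ?N * r')" by (simp add: algebra_simps)
  finally have rr: "(?s * ?t) ^ A * p = ?t ^ ?N * r + ?s ^ ?N * r'" using l\<phi>(1) by simp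
  have "L * r \<in> J" "L * r' \<in> J"
    unfolding r(2)[symmetric] r'(2)[symmetric] using qJ fI J_add J_diff J_mult by auto
  then obtain M M' where M: "?s ^ M * r \<in> J" "?t ^ M' * r' \<in> J"
    using J_saturated_along_L by meson
  let ?M = "M + M'"
  have "?s ^ ?M * r \<in> J" "?t ^ ?M * r' \<in> J"
    using J_mult[OF M(1), of "?s ^ M'"] J_mult[OF M(2), of "?t ^ M"] by (simp_all add: power_add ac_simps)
  moreover have "homogeneous (d * j + N + (A + ?M)) (?s ^ ?M * r)" "homogeneous (d * j + N + (A + ?M)) (?t ^ ?M * r')"
    by (rule homogeneous_mult'[OF vp r(1)] homogeneous_mult'[OF vp r'(1)], simp)+
  moreover have "(?s * ?t) ^ (A + ?M) * p = ?t ^ (N + (A + ?M)) * (?s ^ ?M * r) + ?s ^ (N + (A + ?M)) * (?t ^ ?M * r')"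
  proof -
    have "(?s * ?t) ^ (A + ?M) * p = (?s * ?t) ^ ?M * ((?s * ?t) ^ A * p)"
      by (simp add: power_add ac_simps)
    also have "\<dots> = ?t ^ (N + (A + ?M)) * (?s ^ ?M * r) + ?s ^ (N + (A + ?M)) * (?t ^ ?M * r')"
      unfolding rr by (simp add: power_mult_distrib power_add algebra_simps)
    finally show ?thesis .
  qed
  ultimately show ?thesis unfolding splits_def by blast
qed

text \<open>
  So a cocycle of degree \<open>d * k\<close> vanishes because its multiple by a large power of \<open>L\<close> does.
\<close>

lemma splits_of_J:
  assumes "p \<in> J" "homogeneous (d * k + 2 * N) p"
  shows "splits (d * k) N p"
proof -
  have "splits (d * (k + i)) N (L ^ i * p) \<Longrightarrow> splits (d * k) N p" for i
  proof (induction i)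
    case (Suc i)
    have 1: "homogeneous (d * (k + i) + 2 * N) (L ^ i * p)"
      by (rule homogeneous_mult'[OF homogeneous_power[OF hom_L] assms(2)]) (simp add: algebra_simps)
    have 2: "splits (d * (k + i + 1)) N (L * (L ^ i * p))"
      using Suc.prems by (simp add: mult.assoc)
    have "splits (d * (k + i)) N (L ^ i * p)"
      by (rule splits_descent[OF 1 _ 2]) simp
    then show ?case by (rule Suc.IH)
  qed simp
  moreover have "splits (d * k + (2 * N) * d) N (L ^ (2 * N) * p)"
    by (rule splits_multiple[OF assms]) (use homogeneous_power[OF hom_L, of "2 * N"] d(1) in auto)
  then have "splits (d * (k + 2 * N)) N (L ^ (2 * N) * p)"
    by (simp only: distrib_left mult.commute[of d])
  ultimately show ?thesis by blast
qed

text \<open>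
  In terms of sections: two sections over the charts whose difference over the overlap lies in \<^const>\<open>J\<close> differ
  from one global form by sections of \<^const>\<open>J\<close>.
\<close>

lemma split_cocycle:
  fixes a b :: "(2, 'a) lpoly"
  assumes a: "homogeneous (int (d * k)) a" "Var 1 ^ n * a \<in> range laurent"
    and b: "homogeneous (int (d * k)) b" "Var 2 ^ n' * b \<in> range laurent"
    and p: "(Var 1 * Var 2) ^ N * (a - b) = laurent p" "p \<in> J"
  obtains g where "homogeneous (d * k) g" "a - laurent g \<in> loc 1 J" "b - laurent g \<in> loc 2 J"
proof -
  let ?s = "Var 1 :: (2, 'a) lpoly" and ?t = "Var 2 :: (2, 'a) lpoly"
  let ?s' = "Varinv 1 :: (2, 'a) lpoly" and ?t' = "Varinv 2 :: (2, 'a) lpoly"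
  note vp = homogeneous_Var_power[where ?'e = int, simplified]
  have "homogeneous (int (d * k + 2 * N)) ((?s * ?t) ^ N * (a - b))"
    unfolding power_mult_distrib
    by (rule homogeneous_mult'[OF homogeneous_mult[OF vp vp] homogeneous_diff[OF a(1) b(1)]]) simp
  then have "homogeneous (d * k + 2 * N) p"
    unfolding p(1) by (simp only: homogeneous_laurent_iff)
  from splits_of_J[OF p(2) this] obtain A q q' where q: "q \<in> J" "q' \<in> J"
    and hq: "homogeneous (d * k + N + A) q" "homogeneous (d * k + N + A) q'"
    and eq: "(Var 1 * Var 2) ^ A * p = Var 2 ^ (N + A) * q + Var 1 ^ (N + A) * q'"
    unfolding splits_def by blast
  let ?N = "N + A"
  have "(?s * ?t) ^ ?N * (a - b) = (?s * ?t) ^ A * ((?s * ?t) ^ N * (a - b))"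
    by (simp add: power_add mult.assoc mult.left_commute)
  also have "\<dots> = laurent (Var 2 ^ ?N * q + Var 1 ^ ?N * q')"
    unfolding p(1) eq[symmetric] by (simp add: laurent.hom)
  finally have ab: "?s ^ ?N * (?t ^ ?N * (a - b)) = ?t ^ ?N * laurent q + ?s ^ ?N * laurent q'"
    by (simp add: laurent.hom power_mult_distrib mult.assoc)
  have "a - b = ?t' ^ ?N * (?s' ^ ?N * (?s ^ ?N * (?t ^ ?N * (a - b))))" by simp
  also have "\<dots> = ?s' ^ ?N * (?t' ^ ?N * (?t ^ ?N * laurent q)) + ?t' ^ ?N * (?s' ^ ?N * (?s ^ ?N * laurent q'))"
    unfolding ab by (simp only: distrib_left mult.left_commute)
  also have "\<dots> = ?s' ^ ?N * laurent q + ?t' ^ ?N * laurent q'" by simp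
  finally have ab': "a - b = ?s' ^ ?N * laurent q + ?t' ^ ?N * laurent q'" .
  define G where "G = a - ?s' ^ ?N * laurent q"
  have G': "G = b + ?t' ^ ?N * laurent q'" using ab' by (simp add: G_def algebra_simps)
  obtain a' where a': "?s ^ n * a = laurent a'" using a(2) by blast
  obtain b' where b': "?t ^ n' * b = laurent b'" using b(2) by blast
  have "?s ^ (n + ?N) * G = ?s ^ ?N * (?s ^ n * a) - ?s ^ n * (?s ^ ?N * (?s' ^ ?N * laurent q))"
    unfolding G_def power_add[of _ n] by (simp only: right_diff_distrib mult.assoc mult.left_commute)
  also have "\<dots> = laurent (Var 1 ^ ?N * a' - Var 1 ^ n * q)" by (simp add: a' laurent.hom)
  finally have G1: "?s ^ (n + ?N) * G \<in> range laurent" by blast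
  have "?t ^ (n' + ?N) * G = ?t ^ ?N * (?t ^ n' * b) + ?t ^ n' * (?t ^ ?N * (?t' ^ ?N * laurent q'))"
    unfolding G' power_add[of _ n'] by (simp only: distrib_left mult.assoc mult.left_commute)
  also have "\<dots> = laurent (Var 2 ^ ?N * b' + Var 2 ^ n' * q')" by (simp add: b' laurent.hom)
  finally have G2: "?t ^ (n' + ?N) * G \<in> range laurent" by blast
  have "G \<in> range laurent"
    by (rule range_laurentI[OF _ G1 G2]) (metis plus_1_neq_2(2) one_add_one)
  then obtain g where g: "G = laurent g" by blast
  have "homogeneous (int (d * k + N + A)) (laurent q)" using hq(1) by (simp only: homogeneous_laurent_iff)
  from homogeneous_mult'[OF homogeneous_Varinv_power[of ?N 1] this, of "int (d * k)"]
  have "homogeneous (int (d * k)) (?s' ^ ?N * laurent q)" by simp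
  from homogeneous_diff[OF a(1) this] have "homogeneous (d * k) g"
    unfolding G_def[symmetric] g by (simp only: homogeneous_laurent_iff)
  moreover have "a - laurent g \<in> loc 1 J"
    by (rule locI[OF _ q(1), of _ ?N]) (simp add: g[symmetric] G_def)
  moreover have "- (b - laurent g) \<in> loc 2 J"
    by (rule locI[OF _ q(2), of _ ?N]) (simp add: g[symmetric] G')
  then have "b - laurent g \<in> loc 2 J"
    using loc_uminus[OF subspace_J] by fastforce
  ultimately show ?thesis using that by blast
qed

end

section \<open>From cokernel classes to forms in the ideal\<close>

context rational_curve
begin

abbreviation "Syz \<equiv> syzygies \<phi>"
abbreviation "JM \<equiv> ideal_times J Syz"

text \<open>
  The spaces of cochains in the definition of \<^const>\<open>delta0\<close>: lifts of sections of the quotient sheaf,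
  lifts of the zero section, and restrictions of global syzygies.
\<close>

definition "glued_lifts = {u :: ((2, 'a) lpoly)^3^2.
  (\<forall>v. u $ v \<in> localization_vec {v} (int (d * k)) Syz) \<and>
  (\<forall>v w. u $ v - u $ w \<in> localization_vec {v, w} (int (d * k)) JM)}"

definition "zero_lifts = {u :: ((2, 'a) lpoly)^3^2. \<forall>v. u $ v \<in> localization_vec {v} (int (d * k)) JM}"

definition "global_lifts = {(\<chi> v. laurent_vec g) :: ((2, 'a) lpoly)^3^2 | g. g \<in> Syz \<and> (\<forall>j. homogeneous (d * k) (g $ j))}"

lemma delta0_eq: "delta0 d \<phi> I k = quotient_dim glued_lifts (zero_lifts \<union> global_lifts)"
  unfolding delta0_def Let_def glued_lifts_def zero_lifts_def global_lifts_def J_def ..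

text \<open>
  The connecting map relates \<open>u\<close> to \<open>f\<close>: modulo \<^const>\<open>J\<close> the local syzygies \<open>u $ v\<close> coincide with one vector of
  global forms, whose pairing with \<open>\<phi>\<close>, instead of being \<open>0\<close>, is \<open>f \<circ> \<phi>\<close>. This is kept as a linear
  relation, since neither \<open>f\<close> nor the global forms are determined by \<open>u\<close>.
\<close>

definition connects :: "((2, 'a) lpoly)^3^2 \<Rightarrow> (3, 'a) mpoly \<Rightarrow> bool" where
  "connects u f \<longleftrightarrow> (\<forall>v j. homogeneous (int (d * k)) (u $ v $ j)) \<and>
    (\<forall>v. (\<Sum>j\<in>UNIV. u $ v $ j * laurent (\<phi> $ j)) = 0) \<and>
    (\<exists>g :: ((2, 'a) mpoly)^3. (\<forall>j. homogeneous (d * k) (g $ j)) \<and> (\<Sum>j\<in>UNIV. g $ j * \<phi> $ j) = pb f \<and>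
      (\<forall>v j. u $ v $ j - laurent (g $ j) \<in> loc v J))"

lemma connectsE:
  assumes "connects u f"
  obtains g :: "((2, 'a) mpoly)^3" where
    "\<And>j. homogeneous (d * k) (g $ j)" "(\<Sum>j\<in>UNIV. g $ j * \<phi> $ j) = pb f"
    "\<And>v j. u $ v $ j - laurent (g $ j) \<in> loc v J"
  using assms unfolding connects_def by (elim exE conjE) (rule that; blast)

lemma connectsI:
  fixes g :: "((2, 'a) mpoly)^3"
  assumes "\<And>v j. homogeneous (int (d * k)) (u $ v $ j)"
    "\<And>v. (\<Sum>j\<in>UNIV. u $ v $ j * laurent (\<phi> $ j)) = 0"
    "\<And>j. homogeneous (d * k) (g $ j)" "(\<Sum>j\<in>UNIV. g $ j * \<phi> $ j) = pb f"
    "\<And>v j. u $ v $ j - laurent (g $ j) \<in> loc v J"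
  shows "connects u f"
  unfolding connects_def by (intro conjI allI exI[of _ g] assms)

lemma connects_add:
  assumes "connects u f" "connects u' f'"
  shows "connects (u + u') (f + f')"
proof -
  obtain g where
    g: "\<And>j. homogeneous (d * k) (g $ j)" "(\<Sum>j\<in>UNIV. g $ j * \<phi> $ j) = pb f"
      "\<And>v j. u $ v $ j - laurent (g $ j) \<in> loc v J"
    using assms(1) by (rule connectsE) blast
  obtain g' where
    g': "\<And>j. homogeneous (d * k) (g' $ j)" "(\<Sum>j\<in>UNIV. g' $ j * \<phi> $ j) = pb f'"
      "\<And>v j. u' $ v $ j - laurent (g' $ j) \<in> loc v J"
    using assms(2) by (rule connectsE) blast
  have u: "\<And>v j. homogeneous (int (d * k)) (u $ v $ j)" "\<And>v j. homogeneous (int (d * k)) (u' $ v $ j)"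
    "\<And>v. (\<Sum>j\<in>UNIV. u $ v $ j * laurent (\<phi> $ j)) = 0" "\<And>v. (\<Sum>j\<in>UNIV. u' $ v $ j * laurent (\<phi> $ j)) = 0"
    using assms by (simp_all add: connects_def)
  have "(u + u') $ v $ j - laurent ((g + g') $ j) \<in> loc v J" for v j
    using loc_add[OF subspace_J g(3)[of v j] g'(3)[of v j]] by (simp add: laurent.add algebra_simps)
  moreover have "(\<Sum>j\<in>UNIV. (g + g') $ j * \<phi> $ j) = pb (f + f')"
    by (simp add: distrib_right sum.distrib g g' pb.add)
  moreover have "homogeneous (d * k) ((g + g') $ j)" for j
    by (simp add: homogeneous_add g g')
  ultimately show ?thesis
    by (intro connectsI[of _ "g + g'"]) (simp_all add: u homogeneous_add distrib_right sum.distrib del: of_nat_mult)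
qed

lemma connects_scale:
  assumes "connects u f"
  shows "connects (cochain_scale c u) (pm_scale c f)"
proof -
  obtain g where
    g: "\<And>j. homogeneous (d * k) (g $ j)" "(\<Sum>j\<in>UNIV. g $ j * \<phi> $ j) = pb f"
      "\<And>v j. u $ v $ j - laurent (g $ j) \<in> loc v J"
    using assms by (rule connectsE) blast
  have u: "\<And>v j. homogeneous (int (d * k)) (u $ v $ j)"
    "\<And>v. (\<Sum>j\<in>UNIV. u $ v $ j * laurent (\<phi> $ j)) = 0"
    using assms by (simp_all add: connects_def)
  let ?g = "(\<chi> j. Const c * g $ j) :: ((2, 'a) mpoly)^3"
  have "cochain_scale c u $ v $ j - laurent (?g $ j) \<in> loc v J" for v j
    using loc_mult[OF subspace_J g(3)[of v j], of "Const c"]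
    by (simp add: cochain_scale_def pm_scale_eq_Const_mult laurent.mult right_diff_distrib)
  moreover have "(\<Sum>j\<in>UNIV. ?g $ j * \<phi> $ j) = pb (pm_scale c f)"
    by (simp add: mult.assoc sum_distrib_left[symmetric] g pb.mult pm_scale_eq_Const_mult)
  moreover have "homogeneous (d * k) (?g $ j)" for j
    by (simp add: homogeneous_Const_mult g)
  ultimately show ?thesis
    by (intro connectsI[of _ ?g])
      (simp_all add: u cochain_scale_def pm_scale_eq_Const_mult homogeneous_Const_mult mult.assoc sum_distrib_left[symmetric] del: of_nat_mult)
qed

lemma connects_diff_sum:
  assumes "connects u f" "finite C" "\<And>i. i \<in> C \<Longrightarrow> connects (u' i) (f' i)"
  shows "connects (u - (\<Sum>i\<in>C. cochain_scale (c i) (u' i))) (f - (\<Sum>i\<in>C. pm_scale (c i) (f' i)))"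
  using assms(2,3)
proof (induction C)
  case (insert x C)
  have "connects (u - (\<Sum>i\<in>C. cochain_scale (c i) (u' i)) + cochain_scale (- c x) (u' x))
      (f - (\<Sum>i\<in>C. pm_scale (c i) (f' i)) + pm_scale (- c x) (f' x))"
    by (intro connects_add connects_scale) (use insert in auto)
  then show ?case using insert(1,2) by (simp add: algebra_simps)
qed (use assms(1) in simp)

lemma localization_vec_syzygies:
  assumes "u \<in> localization_vec {v} e Syz"
  shows "homogeneous e (u $ j)" "\<exists>N. Var v ^ N * u $ j \<in> range laurent"
    "(\<Sum>j\<in>UNIV. u $ j * laurent (\<phi> $ j)) = 0"
proof -
  show "homogeneous e (u $ j)" using assms by (simp add: localization_vec_def)
  obtain N g where "(\<Prod>v\<in>{v}. Var v) ^ N *s u = laurent_vec g" and g: "g \<in> Syz"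
    using assms by (auto simp: localization_vec_def)
  then have u: "Var v ^ N * u $ j = laurent (g $ j)" for j
    by (simp add: vec_eq_iff laurent_vec_def)
  then show "\<exists>N. Var v ^ N * u $ j \<in> range laurent" by blast
  have "Var v ^ N * (\<Sum>j\<in>UNIV. u $ j * laurent (\<phi> $ j)) = (\<Sum>j\<in>UNIV. (Var v ^ N * u $ j) * laurent (\<phi> $ j))"
    by (simp add: sum_distrib_left mult.assoc)
  also have "\<dots> = laurent (\<Sum>j\<in>UNIV. g $ j * \<phi> $ j)"
    by (simp only: u laurent.hom)
  also have "\<dots> = 0" using g by (simp add: syzygies_def)
  finally have 0: "Var v ^ N * (\<Sum>j\<in>UNIV. u $ j * laurent (\<phi> $ j)) = 0" .
  have "(\<Sum>j\<in>UNIV. u $ j * laurent (\<phi> $ j)) =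
      Varinv v ^ N * (Var v ^ N * (\<Sum>j\<in>UNIV. u $ j * laurent (\<phi> $ j)))"
    by (simp only: Var_Varinv_power_mult)
  also have "\<dots> = 0" by (simp only: 0 mult_zero_right)
  finally show "(\<Sum>j\<in>UNIV. u $ j * laurent (\<phi> $ j)) = 0" .
qed

lemma ideal_times_component:
  assumes "p \<in> JM"
  shows "p $ j \<in> J"
  using assms unfolding ideal_times_def
proof (induction rule: free_module.span_induct_alt)
  case (step c x y)
  then obtain a g where "x = a *s g" "a \<in> J" by blast
  then have "(c * g $ j) * a + y $ j \<in> J" by (intro J_add J_mult step(2))
  then show ?case by (simp add: \<open>x = _\<close> ac_simps)
qed (simp add: J_0)

text \<open>
  By vanishing of the first cohomology of \<^const>\<open>J\<close>, the cochain \<open>u\<close> agrees modulo \<^const>\<open>J\<close> with global forms \<open>G j\<close>,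
  and \<open>h = (\<Sum>j. G j * \<phi> $ j)\<close> is locally in \<^const>\<open>J\<close>. On the line section \<open>h\<close> equals \<open>f \<circ> \<phi>\<close> for some \<open>f\<close> in the
  ideal, so \<open>h = f \<circ> \<phi> + L * q\<close>, and \<open>q\<close> is again locally in \<^const>\<open>J\<close>. Since \<open>L\<close> is a combination
  of the \<open>\<phi> $ j\<close>, the term \<open>L * q\<close> can be absorbed into the \<open>G j\<close>.
\<close>

lemma exists_connected_form:
  assumes u: "u \<in> glued_lifts"
  obtains f where "f \<in> sections I (k + 1)" "connects u f"
proof -
  have uM: "u $ v \<in> localization_vec {v} (int (d * k)) Syz" for v
    using u by (simp add: glued_lifts_def)
  note hom = localization_vec_syzygies(1)[OF uM] and reg = localization_vec_syzygies(2)[OF uM]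
    and syz = localization_vec_syzygies(3)[OF uM]
  have ne: "(1 :: 2) \<noteq> 2" by (metis plus_1_neq_2(1) one_add_one)
  have "u $ 1 - u $ 2 \<in> localization_vec {1, 2} (int (d * k)) JM"
    using u by (simp add: glued_lifts_def)
  then obtain N p where "(\<Prod>v\<in>{1, 2}. Var v) ^ N *s (u $ 1 - u $ 2) = laurent_vec p" and p: "p \<in> JM"
    by (auto simp: localization_vec_def)
  then have up: "(Var 1 * Var 2) ^ N * (u $ 1 $ j - u $ 2 $ j) = laurent (p $ j)" for j
    using ne by (simp add: vec_eq_iff laurent_vec_def right_diff_distrib)
  have "\<exists>g. homogeneous (d * k) g \<and> (\<forall>v. u $ v $ j - laurent g \<in> loc v J)" for j
  proof -
    obtain n n' where "Var 1 ^ n * u $ 1 $ j \<in> range laurent" "Var 2 ^ n' * u $ 2 $ j \<in> range laurent"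
      using reg by meson
    from split_cocycle[OF hom this(1) hom this(2) up ideal_times_component[OF p]]
    obtain g where g: "homogeneous (d * k) g" "u $ 1 $ j - laurent g \<in> loc 1 J" "u $ 2 $ j - laurent g \<in> loc 2 J"
      by blast
    have "u $ v $ j - laurent g \<in> loc v J" for v
      using g(2,3) exhaust_2[of v] by auto
    with g(1) show ?thesis by blast
  qed
  then obtain G where G: "\<And>j. homogeneous (d * k) (G j)" "\<And>j v. u $ v $ j - laurent (G j) \<in> loc v J"
    by metis
  define h where "h = (\<Sum>j\<in>UNIV. G j * \<phi> $ j)"
  have hom_h: "homogeneous (d * (k + 1)) h"
    unfolding h_def by (intro homogeneous_sum homogeneous_mult'[OF G(1) \<phi>]) simp
  have h_loc: "laurent h \<in> loc v J" for v
  proof -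
    have "(\<Sum>j\<in>UNIV. laurent (\<phi> $ j) * (u $ v $ j - laurent (G j))) =
        (\<Sum>j\<in>UNIV. u $ v $ j * laurent (\<phi> $ j)) - laurent h"
      by (simp add: h_def laurent.hom right_diff_distrib sum_subtractf mult.commute)
    then have "- laurent h = (\<Sum>j\<in>UNIV. laurent (\<phi> $ j) * (u $ v $ j - laurent (G j)))"
      by (simp add: syz)
    also have "\<dots> \<in> loc v J"
      by (intro loc_sum loc_mult subspace_J G)
    finally show ?thesis using loc_uminus[OF subspace_J] by fastforce
  qed
  obtain f where f: "f \<in> sections I (k + 1)" "dehom 1 L dvd dehom 1 h - dehom 1 (pb f)"
    using line_section_lift[of "k + 1" "dehom 1 h"] by auto
  have fI: "pb f \<in> J" and hom_f: "homogeneous (d * (k + 1)) (pb f)"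
    using f(1) hom_pb[of "k + 1" f] by (auto simp only: sections_def mem_Collect_eq pb_in_J)
  obtain q where q: "homogeneous (d * (k + 1) - d) q" "h - pb f = L * q"
    by (rule form_dvd_of_dehom_dvd[OF hom_L l\<phi> homogeneous_diff[OF hom_h hom_f], unfolded dehom.diff, OF f(2)])
  have q_loc: "laurent q \<in> loc v J" for v
  proof -
    have "laurent (pb f) \<in> loc v J" by (rule loc_laurent[of _ 0]) (simp add: fI)
    then have "laurent h + - laurent (pb f) \<in> loc v J"
      by (intro loc_add loc_uminus subspace_J h_loc)
    then have "laurent (L * q) \<in> loc v J" by (simp add: laurent.diff flip: q(2))
    from loc_laurentD[OF this] obtain M where "Var v ^ M * (L * q) \<in> J" ..
    then have "L * (Var v ^ M * q) \<in> J" by (simp only: mult.left_commute)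
    from J_saturated_along_L[OF this] obtain M' where "Var v ^ M' * (Var v ^ M * q) \<in> J" ..
    then show ?thesis by (intro loc_laurent[of _ "M' + M"]) (simp add: power_add mult.assoc)
  qed
  obtain c where c: "l = (\<Sum>j\<in>UNIV. Const (c j) * Var j)"
    by (rule linear_form_decompose[OF l])
  define g :: "((2, 'a) mpoly)^3" where "g = (\<chi> j. G j - Const (c j) * q)"
  have "homogeneous (d * k) (g $ j)" for j
    using homogeneous_diff[OF G(1)[of j] homogeneous_Const_mult, of q "c j"] q(1) by (simp add: g_def)
  moreover have "(\<Sum>j\<in>UNIV. g $ j * \<phi> $ j) = pb f"
  proof -
    have "L = (\<Sum>j\<in>UNIV. Const (c j) * \<phi> $ j)" by (simp add: c pb.hom)
    moreover have "g $ j * \<phi> $ j = G j * \<phi> $ j - (Const (c j) * \<phi> $ j) * q" for j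
      by (simp add: g_def algebra_simps)
    ultimately have "(\<Sum>j\<in>UNIV. g $ j * \<phi> $ j) = h - L * q"
      by (simp only: h_def sum_subtractf sum_distrib_right[symmetric])
    then show ?thesis by (simp flip: q(2))
  qed
  moreover have "u $ v $ j - laurent (g $ j) \<in> loc v J" for v j
  proof -
    have "u $ v $ j - laurent (g $ j) = (u $ v $ j - laurent (G j)) + laurent (Const (c j)) * laurent q"
      by (simp add: g_def laurent.diff laurent.mult)
    also have "\<dots> \<in> loc v J" by (intro loc_add loc_mult subspace_J G q_loc)
    finally show ?thesis .
  qed
  ultimately have "connects u f" by (intro connectsI[of _ g] hom syz)
  with f(1) show ?thesis using that by blast
qed

text \<open>
  Locally the syzygy module is a direct summand of the free module, so its elements with entries in
  \<^const>\<open>J\<close> are combinations of syzygies with coefficients in \<^const>\<open>J\<close>. The vectors \<open>w i\<close> in the proof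
  are the images of the unit vectors under a projection, up to the power of a variable.
\<close>

lemma syzygy_with_coefficients_in_J:
  assumes b: "\<And>j. b $ j \<in> J" "(\<Sum>j\<in>UNIV. b $ j * \<phi> $ j) = 0"
  shows "\<exists>N. Var v ^ N *s b \<in> JM"
proof -
  obtain N a where a: "Var v ^ N = (\<Sum>j\<in>UNIV. a j * \<phi> $ j)" using coordinates_generate[of v] by (elim exE)
  define w :: "3 \<Rightarrow> ((2, 'a) mpoly)^3" where
    "w i = (\<chi> j. (if i = j then Var v ^ N else 0) - \<phi> $ i * a j)" for i
  have "w i \<in> Syz" for i
  proof -
    have "(\<Sum>j\<in>UNIV. w i $ j * \<phi> $ j) = Var v ^ N * \<phi> $ i - \<phi> $ i * (\<Sum>j\<in>UNIV. a j * \<phi> $ j)"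
      by (simp add: w_def left_diff_distrib sum_subtractf sum_distrib_left mult.assoc
          if_distrib[of "\<lambda>x. x * _"] cong: if_cong)
    then show ?thesis by (simp add: syzygies_def a[symmetric] mult.commute)
  qed
  then have "(\<Sum>i\<in>UNIV. b $ i *s w i) \<in> JM"
    unfolding ideal_times_def by (intro free_module.span_sum free_module.span_base) (use b in blast)
  also have "(\<Sum>i\<in>UNIV. b $ i *s w i) = Var v ^ N *s b"
  proof (rule vec_eq_iff[THEN iffD2], rule allI)
    fix j
    have "(\<Sum>i\<in>UNIV. b $ i *s w i) $ j = b $ j * Var v ^ N - (\<Sum>i\<in>UNIV. b $ i * \<phi> $ i) * a j"
      by (simp add: w_def right_diff_distrib sum_subtractf sum_distrib_right mult.assoc
          if_distrib[of "\<lambda>x. _ * x"] cong: if_cong)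
    then show "(\<Sum>i\<in>UNIV. b $ i *s w i) $ j = (Var v ^ N *s b) $ j"
      using b(2) by (simp add: mult.commute)
  qed
  finally show ?thesis by blast
qed

definition image_mu :: "(3, 'a) mpoly set" where
  "image_mu = {\<Sum>j\<in>UNIV. Var j * F j | F. \<forall>j. F j \<in> sections I k}"

text \<open>
  If \<open>f\<close> is a combination of the variables with forms \<open>F j\<close> of the ideal, subtracting \<open>F j \<circ> \<phi>\<close> from the
  global forms turns them into a global syzygy, still equal to \<open>u\<close> modulo \<^const>\<open>J\<close>.
\<close>

lemma connects_image_mu:
  assumes u: "connects u f" and f: "f \<in> image_mu"
  shows "u \<in> cochain.span (zero_lifts \<union> global_lifts)"
proof -
  obtain F where F: "\<And>j. F j \<in> sections I k" "f = (\<Sum>j\<in>UNIV. Var j * F j)"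
    using f by (auto simp: image_mu_def)
  obtain g where
    g: "\<And>j. homogeneous (d * k) (g $ j)" "(\<Sum>j\<in>UNIV. g $ j * \<phi> $ j) = pb f"
      "\<And>v j. u $ v $ j - laurent (g $ j) \<in> loc v J"
    using u by (rule connectsE) blast
  have hu: "\<And>v j. homogeneous (int (d * k)) (u $ v $ j)"
    and su: "\<And>v. (\<Sum>j\<in>UNIV. u $ v $ j * laurent (\<phi> $ j)) = 0"
    using u by (simp_all add: connects_def)
  define g' :: "((2, 'a) mpoly)^3" where "g' = (\<chi> j. g $ j - pb (F j))"
  have hg': "homogeneous (d * k) (g' $ j)" for j
    unfolding g'_def vec_lambda_beta
    by (intro homogeneous_diff g hom_pb) (use F(1)[of j] in \<open>simp add: sections_def\<close>)
  have sg': "(\<Sum>j\<in>UNIV. g' $ j * \<phi> $ j) = 0"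
  proof -
    have "g' $ j * \<phi> $ j = g $ j * \<phi> $ j - \<phi> $ j * pb (F j)" for j
      by (simp add: g'_def algebra_simps)
    then have "(\<Sum>j\<in>UNIV. g' $ j * \<phi> $ j) = pb f - (\<Sum>j\<in>UNIV. \<phi> $ j * pb (F j))"
      by (simp only: sum_subtractf g(2))
    also have "(\<Sum>j\<in>UNIV. \<phi> $ j * pb (F j)) = pb f" by (simp add: F(2) pb.hom)
    finally show ?thesis by simp
  qed
  define r :: "((2, 'a) lpoly)^3^2" where "r = (\<chi> v. laurent_vec g')"
  have "r \<in> global_lifts" unfolding global_lifts_def r_def using sg' hg' by (auto simp: syzygies_def)
  moreover have "u - r \<in> zero_lifts"
    unfolding zero_lifts_def
  proof (rule CollectI, rule allI)
    fix v
    let ?z = "(u - r) $ v"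
    have z: "?z $ j = u $ v $ j - laurent (g' $ j)" for j
      by (simp add: r_def laurent_vec_def)
    have hz: "homogeneous (int (d * k)) (?z $ j)" for j
    proof -
      have "homogeneous (int (d * k)) (laurent (g' $ j))" using hg' by (simp only: homogeneous_laurent_iff)
      then show ?thesis unfolding z by (rule homogeneous_diff[OF hu])
    qed
    have "?z $ j \<in> loc v J" for j
    proof -
      have "laurent (pb (F j)) \<in> loc v J"
        by (rule loc_laurent[of _ 0]) (use F(1)[of j] in \<open>simp add: pb_in_J sections_def\<close>)
      from loc_add[OF subspace_J g(3)[of v j] this] show ?thesis
        unfolding z by (simp add: g'_def laurent.diff diff_diff_eq2 diff_add_eq)
    qed
    then have "\<exists>m b. Var v ^ m * ?z $ j = laurent b \<and> b \<in> J" for j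
      by (meson loc_cases)
    then obtain m b where mb: "\<And>j. Var v ^ m j * ?z $ j = laurent (b j)" "\<And>j. b j \<in> J"
      by metis
    define N where "N = (\<Sum>j\<in>UNIV. m j)"
    define c :: "((2, 'a) mpoly)^3" where "c = (\<chi> j. Var v ^ (N - m j) * b j)"
    have c: "Var v ^ N * ?z $ j = laurent (c $ j)" for j
    proof -
      have "m j \<le> N" unfolding N_def by (rule member_le_sum) auto
      then have "(Var v :: (2, 'a) lpoly) ^ N = Var v ^ (N - m j) * Var v ^ m j" by (simp flip: power_add)
      then show ?thesis by (simp only: mult.assoc mb(1) c_def vec_lambda_beta laurent.mult laurent.power laurent_Var)
    qed
    have cJ: "c $ j \<in> J" for j by (simp add: c_def J_mult mb(2))
    have "laurent (\<Sum>j\<in>UNIV. c $ j * \<phi> $ j) = (\<Sum>j\<in>UNIV. Var v ^ N * ?z $ j * laurent (\<phi> $ j))"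
      by (simp only: laurent.hom c)
    also have "\<dots> = Var v ^ N * ((\<Sum>j\<in>UNIV. u $ v $ j * laurent (\<phi> $ j)) - laurent (\<Sum>j\<in>UNIV. g' $ j * \<phi> $ j))"
      unfolding z by (simp add: laurent.hom sum_distrib_left left_diff_distrib right_diff_distrib sum_subtractf mult.assoc)
    also have "\<dots> = laurent 0" by (simp add: su sg')
    finally have "(\<Sum>j\<in>UNIV. c $ j * \<phi> $ j) = 0" by (simp only: laurent_eq_iff)
    then obtain N' where "Var v ^ N' *s c \<in> JM" using syzygy_with_coefficients_in_J[OF cJ] by blast
    moreover have "(\<Prod>v\<in>{v}. Var v) ^ (N' + N) *s ?z = laurent_vec (Var v ^ N' *s c)"
      by (simp add: vec_eq_iff laurent_vec_def laurent.hom c[symmetric] power_add mult.assoc del: vector_minus_component)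
    ultimately show "?z \<in> localization_vec {v} (int (d * k)) JM"
      unfolding localization_vec_def using hz by blast
  qed
  ultimately have "(u - r) + r \<in> cochain.span (zero_lifts \<union> global_lifts)"
    by (intro cochain.span_add cochain.span_base) auto
  then show ?thesis by simp
qed

end

section \<open>Counting dimensions\<close>

lemma finite_exponents: "finite {m :: 'v::finite \<Rightarrow>\<^sub>0 nat. (\<Sum>v\<in>UNIV. Poly_Mapping.lookup m v) = n}"
proof -
  have "Poly_Mapping.lookup ` {m :: 'v \<Rightarrow>\<^sub>0 nat. (\<Sum>v\<in>UNIV. Poly_Mapping.lookup m v) = n} \<subseteq>
      (\<Pi>\<^sub>E v\<in>UNIV. {..n})"
  proof (clarsimp simp: PiE_def)
    fix m :: "'v \<Rightarrow>\<^sub>0 nat" and v assume "n = (\<Sum>v\<in>UNIV. Poly_Mapping.lookup m v)"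
    then show "Poly_Mapping.lookup m v \<le> (\<Sum>v\<in>UNIV. Poly_Mapping.lookup m v)"
      by (intro member_le_sum) auto
  qed
  then have "finite (Poly_Mapping.lookup ` {m :: 'v \<Rightarrow>\<^sub>0 nat. (\<Sum>v\<in>UNIV. Poly_Mapping.lookup m v) = n})"
    by (rule finite_subset) (simp add: finite_PiE)
  then show ?thesis
    by (rule finite_imageD) (rule inj_onI, rule poly_mapping_eqI, simp)
qed

lemma homogeneous_in_finite_span:
  "\<exists>T. finite T \<and> {f. homogeneous n f} \<subseteq> pm.span (T :: ('v::finite, 'a::field) mpoly set)"
proof (intro exI conjI subsetI)
  let ?E = "{m :: 'v \<Rightarrow>\<^sub>0 nat. (\<Sum>v\<in>UNIV. Poly_Mapping.lookup m v) = n}"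
  let ?T = "(\<lambda>m. Poly_Mapping.single m 1 :: ('v, 'a) mpoly) ` ?E"
  show "finite ?T" using finite_exponents by blast
  fix f :: "('v, 'a) mpoly" assume "f \<in> {f. homogeneous n f}"
  then have "m \<in> ?E" if "m \<in> Poly_Mapping.keys f" for m
    using that by (simp add: homogeneous_def)
  then have "(\<Sum>m\<in>Poly_Mapping.keys f. pm_scale (Poly_Mapping.lookup f m) (Poly_Mapping.single m 1)) \<in> pm.span ?T"
    by (intro pm.span_sum pm.span_scale pm.span_base) auto
  also have "(\<Sum>m\<in>Poly_Mapping.keys f. pm_scale (Poly_Mapping.lookup f m) (Poly_Mapping.single m 1)) = f"
    by (subst (3) poly_mapping_sum_singles)
      (simp add: pm_scale_eq_Const_mult Const_def mult_single)
  finally show "f \<in> pm.span ?T" .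
qed

lemma independent_card_le_dim_forms:
  fixes V :: "('v::finite, 'a::field) mpoly set"
  assumes V: "V \<subseteq> {f. homogeneous n f}" and S: "S \<subseteq> V" "pm.independent S"
  shows "finite S" "card S \<le> pm.dim V"
proof -
  obtain T :: "('v, 'a) mpoly set" where T: "finite T" "{f. homogeneous n f} \<subseteq> pm.span T"
    using homogeneous_in_finite_span by blast
  have fin: "finite S" if "S \<subseteq> V" "pm.independent S" for S
    using pm.independent_span_bound[OF T(1) that(2)] that(1) V T(2) by blast
  then show "finite S" using S by blast
  obtain B where B: "B \<subseteq> V" "pm.independent B" "V \<subseteq> pm.span B" "card B = pm.dim V"
    by (rule pm.basis_exists)
  show "card S \<le> pm.dim V"
    using pm.independent_span_bound[OF fin[OF B(1,2)] S(2)] S(1) B by auto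
qed

lemma subspace_sections: "ideal.subspace I \<Longrightarrow> pm.subspace (sections I k)"
  unfolding pm.subspace_def sections_def
  by (auto simp: pm_scale_eq_Const_mult homogeneous_add homogeneous_Const_mult
      ideal.subspace_0 ideal.subspace_add ideal.subspace_scale)

context rational_curve
begin

lemma image_muI: "x = (\<Sum>j\<in>UNIV. Var j * F j) \<Longrightarrow> (\<And>j. F j \<in> sections I k) \<Longrightarrow> x \<in> image_mu"
  unfolding image_mu_def by (intro CollectI exI[of _ F]) simp

lemma subspace_image_mu: "pm.subspace image_mu"
  unfolding pm.subspace_def
proof (intro conjI ballI allI)
  note sub = subspace_sections[OF I, of k]
  show "0 \<in> image_mu" unfolding image_mu_def
    using pm.subspace_0[OF sub] by (auto intro!: exI[of _ "\<lambda>_. 0"])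
  fix x y assume "x \<in> image_mu" "y \<in> image_mu"
  then obtain F G where F: "\<And>j. F j \<in> sections I k" "x = (\<Sum>j\<in>UNIV. Var j * F j)"
    and G: "\<And>j. G j \<in> sections I k" "y = (\<Sum>j\<in>UNIV. Var j * G j)"
    unfolding image_mu_def by auto
  show "x + y \<in> image_mu" unfolding image_mu_def
    using pm.subspace_add[OF sub F(1) G(1)] F(2) G(2)
    by (auto intro!: exI[of _ "\<lambda>j. F j + G j"] simp: distrib_left sum.distrib)
next
  note sub = subspace_sections[OF I, of k]
  fix c x assume "x \<in> image_mu"
  then obtain F where F: "\<And>j. F j \<in> sections I k" "x = (\<Sum>j\<in>UNIV. Var j * F j)"
    unfolding image_mu_def by auto
  show "pm_scale c x \<in> image_mu" unfolding image_mu_def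
    using pm.subspace_scale[OF sub F(1)] F(2)
    by (auto intro!: exI[of _ "\<lambda>j. pm_scale c (F j)"]
        simp: pm_scale_eq_Const_mult sum_distrib_left mult.left_commute)
qed

lemma image_mu_subset: "image_mu \<subseteq> sections I (k + 1)"
proof
  fix x assume "x \<in> image_mu"
  then obtain F where F: "\<And>j. F j \<in> sections I k" "x = (\<Sum>j\<in>UNIV. Var j * F j)"
    unfolding image_mu_def by auto
  have "homogeneous (k + 1) (Var j * F j)" for j
    by (rule homogeneous_mult'[OF homogeneous_Var]) (use F(1)[of j] in \<open>auto simp: sections_def\<close>)
  moreover have "Var j * F j \<in> I" for j
    using F(1)[of j] ideal.subspace_scale[OF I] by (simp add: sections_def)
  ultimately show "x \<in> sections I (k + 1)"
    unfolding F(2) sections_def by (auto intro: homogeneous_sum ideal.subspace_sum[OF I])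
qed

text \<open>
  Choose forms connected to elements of \<^const>\<open>glued_lifts\<close> that together with a basis of the image of
  multiplication are independent and span all such forms. The cochains belonging to the chosen forms
  span the cokernel, because the correction of \<open>u\<close> by them is connected to a form in the image.
\<close>

lemma delta0_le: "delta0 d \<phi> I k + pm.dim image_mu \<le> h0 I (k + 1)"
proof -
  have hom: "sections I (k + 1) \<subseteq> {f. homogeneous (k + 1) f}" by (auto simp: sections_def)
  obtain A where A: "A \<subseteq> image_mu" "pm.independent A" "image_mu \<subseteq> pm.span A" "card A = pm.dim image_mu"
    by (rule pm.basis_exists)
  define D where "D = {f \<in> sections I (k + 1). \<exists>u\<in>glued_lifts. connects u f}"
  obtain B where B: "A \<subseteq> B" "B \<subseteq> A \<union> D" "pm.independent B" "A \<union> D \<subseteq> pm.span B"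
    using pm.maximal_independent_subset_extend[of A "A \<union> D", OF _ A(2)] by blast
  have BI: "B \<subseteq> sections I (k + 1)"
    using B(2) A(1) image_mu_subset by (auto simp: D_def)
  note finB = independent_card_le_dim_forms[OF hom BI B(3)]
  define C where "C = B - A"
  have finC: "finite C" and cardC: "card C + card A = card B"
    using finB(1) B(1) by (auto simp: C_def card_Diff_subset finite_subset card_mono)
  have "\<forall>f\<in>C. \<exists>u\<in>glued_lifts. connects u f" using B(2) by (auto simp: C_def D_def)
  then obtain w where w: "\<And>f. f \<in> C \<Longrightarrow> w f \<in> glued_lifts" "\<And>f. f \<in> C \<Longrightarrow> connects (w f) f" by metis
  have "glued_lifts \<subseteq> cochain.span (w ` C \<union> (zero_lifts \<union> global_lifts))"
  proof
    fix u assume u: "u \<in> glued_lifts"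
    obtain f where f: "f \<in> sections I (k + 1)" "connects u f" using exists_connected_form[OF u] by blast
    then have "f \<in> pm.span (C \<union> A)" using B(4) B(1) u by (auto simp: D_def C_def Un_absorb2)
    then obtain c' a where ca: "f = c' + a" "c' \<in> pm.span C" "a \<in> pm.span A"
      unfolding pm.span_Un by blast
    then obtain r where r: "c' = (\<Sum>g\<in>C. pm_scale (r g) g)"
      using pm.span_finite[OF finC] by auto
    have a: "a \<in> image_mu"
      using ca(3) pm.span_minimal[OF A(1) subspace_image_mu] by blast
    define u' where "u' = (\<Sum>g\<in>C. cochain_scale (r g) (w g))"
    have "connects (u - u') a"
      using connects_diff_sum[OF f(2) finC, of w "\<lambda>g. g" r] w(2) by (simp add: u'_def ca(1) r)
    then have "u - u' \<in> cochain.span (zero_lifts \<union> global_lifts)" using connects_image_mu a by blast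
    then have "u - u' \<in> cochain.span (w ` C \<union> (zero_lifts \<union> global_lifts))"
      using cochain.span_mono[of "zero_lifts \<union> global_lifts" "w ` C \<union> (zero_lifts \<union> global_lifts)"] by blast
    moreover have "u' \<in> cochain.span (w ` C \<union> (zero_lifts \<union> global_lifts))"
      unfolding u'_def by (intro cochain.span_sum cochain.span_scale cochain.span_base) auto
    ultimately have "(u - u') + u' \<in> cochain.span (w ` C \<union> (zero_lifts \<union> global_lifts))" by (rule cochain.span_add)
    then show "u \<in> cochain.span (w ` C \<union> (zero_lifts \<union> global_lifts))" by simp
  qed
  moreover have "w ` C \<subseteq> glued_lifts" "finite (w ` C)" using w finC by auto
  ultimately have "quotient_dim glued_lifts (zero_lifts \<union> global_lifts) \<le> card (w ` C)"
    unfolding quotient_dim_def by (intro Least_le) blast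
  also have "\<dots> \<le> card C" using finC by (rule card_image_le)
  finally show ?thesis
    using cardC finB(2) A(4) by (simp add: delta0_eq h0_def)
qed

end

lemma mult_superset:
  "finite X \<Longrightarrow> Poly_Mapping.keys t \<subseteq> X \<Longrightarrow>
    mult t = (\<Sum>x\<in>X. pm_scale (Poly_Mapping.lookup t x) (fst x * snd x))"
  unfolding mult_def by (rule sum.mono_neutral_left) (auto simp: in_keys_iff)

lemma (in rational_curve) mult_in_image_mu:
  assumes "t \<in> free_on (sections I k) (sections UNIV 1)"
  shows "mult t \<in> image_mu"
  unfolding mult_def
proof (intro pm.subspace_sum[OF subspace_image_mu] pm.subspace_scale[OF subspace_image_mu])
  fix x assume "x \<in> Poly_Mapping.keys t"
  then have x: "fst x \<in> sections I k" "homogeneous 1 (snd x)"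
    using assms by (auto simp: free_on_def sections_def)
  obtain c where c: "snd x = (\<Sum>j\<in>UNIV. Const (c j) * Var j)"
    by (rule linear_form_decompose[OF x(2)])
  have "fst x * snd x = (\<Sum>j\<in>UNIV. Var j * pm_scale (c j) (fst x))"
    by (simp add: c sum_distrib_left pm_scale_eq_Const_mult ac_simps)
  moreover have "pm_scale (c j) (fst x) \<in> sections I k" for j
    by (rule pm.subspace_scale[OF subspace_sections[OF I] x(1)])
  ultimately show "fst x * snd x \<in> image_mu" by (rule image_muI)
qed

text \<open>A product of linear functionals, read off on representatives in the free space.\<close>

definition bilinear_value ::
    "('p \<Rightarrow> 'a::comm_ring_1) \<Rightarrow> ('q \<Rightarrow> 'a) \<Rightarrow> (('p \<times> 'q) \<Rightarrow>\<^sub>0 'a) \<Rightarrow> 'a" where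
  "bilinear_value \<alpha> \<beta> t = (\<Sum>x\<in>Poly_Mapping.keys t. Poly_Mapping.lookup t x * (\<alpha> (fst x) * \<beta> (snd x)))"

lemma bilinear_value_superset:
  "finite X \<Longrightarrow> Poly_Mapping.keys t \<subseteq> X \<Longrightarrow>
    bilinear_value \<alpha> \<beta> t = (\<Sum>x\<in>X. Poly_Mapping.lookup t x * (\<alpha> (fst x) * \<beta> (snd x)))"
  unfolding bilinear_value_def by (rule sum.mono_neutral_left) (auto simp: in_keys_iff)

lemma bilinear_value_single: "bilinear_value \<alpha> \<beta> (Poly_Mapping.single (u, v) c) = c * (\<alpha> u * \<beta> v)"
  by (subst bilinear_value_superset[of "{(u, v)}"]) auto

lemma bilinear_value_add: "bilinear_value \<alpha> \<beta> (s + t) = bilinear_value \<alpha> \<beta> s + bilinear_value \<alpha> \<beta> t"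
proof -
  let ?X = "Poly_Mapping.keys s \<union> Poly_Mapping.keys t"
  have "bilinear_value \<alpha> \<beta> (s + t) =
      (\<Sum>x\<in>?X. Poly_Mapping.lookup (s + t) x * (\<alpha> (fst x) * \<beta> (snd x)))"
    by (rule bilinear_value_superset) (use keys_add[of s t] in auto)
  then show ?thesis
    by (simp add: bilinear_value_superset[of ?X] lookup_add distrib_right sum.distrib)
qed

lemma bilinear_value_scale: "bilinear_value \<alpha> \<beta> (pm_scale c t) = c * bilinear_value \<alpha> \<beta> t"
proof -
  have "bilinear_value \<alpha> \<beta> (pm_scale c t) =
      (\<Sum>x\<in>Poly_Mapping.keys t. Poly_Mapping.lookup (pm_scale c t) x * (\<alpha> (fst x) * \<beta> (snd x)))"
    by (rule bilinear_value_superset) (auto simp: in_keys_iff lookup_pm_scale)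
  then show ?thesis
    by (simp add: bilinear_value_def lookup_pm_scale sum_distrib_left mult.assoc)
qed

lemma bilinear_value_diff: "bilinear_value \<alpha> \<beta> (s - t) = bilinear_value \<alpha> \<beta> s - bilinear_value \<alpha> \<beta> t"
  using bilinear_value_add[of \<alpha> \<beta> "s - t" t] by simp

text \<open>
  This detects nonzero tensors: a tensor that is a combination of relations has value \<open>0\<close> under every
  product of linear functionals.
\<close>

lemma bilinear_value_relations:
  assumes \<alpha>: "\<And>u u'. u \<in> U \<Longrightarrow> u' \<in> U \<Longrightarrow> \<alpha> (u + u') = \<alpha> u + \<alpha> u'" "\<And>c u. u \<in> U \<Longrightarrow> \<alpha> (pm_scale c u) = c * \<alpha> u"
    and \<beta>: "\<And>v v'. v \<in> V \<Longrightarrow> v' \<in> V \<Longrightarrow> \<beta> (v + v') = \<beta> v + \<beta> v'" "\<And>c v. v \<in> V \<Longrightarrow> \<beta> (pm_scale c v) = c * \<beta> v"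
    and t: "t \<in> tensor_relations U V"
  shows "bilinear_value \<alpha> \<beta> t = 0"
  using t unfolding tensor_relations_def
proof (induction rule: pm.span_induct_alt)
  case base
  show ?case by (simp add: bilinear_value_def)
next
  case (step c x y)
  then have "bilinear_value \<alpha> \<beta> x = 0"
    by (auto simp: bilinear_value_diff bilinear_value_single \<alpha> \<beta> distrib_left distrib_right mult.assoc mult.left_commute)
  with step(2) show ?case by (simp add: bilinear_value_add bilinear_value_scale)
qed

text \<open>
  The products of the three variables with a basis of the sections are independent: the coefficients of
  a linear dependence are the values of products of coordinate functionals on an element of the
  kernel.
\<close>

lemma (in rational_curve) dim_image_mu:
  assumes inj: "mu_injective I k"
  shows "3 * h0 I k \<le> pm.dim image_mu"
proof -
  have hom: "sections I k \<subseteq> {f. homogeneous k f}" "image_mu \<subseteq> {f. homogeneous (k + 1) f}"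
    using image_mu_subset by (auto simp: sections_def)
  obtain B where B: "B \<subseteq> sections I k" "pm.independent B" "sections I k \<subseteq> pm.span B" "card B = pm.dim (sections I k)"
    by (rule pm.basis_exists)
  note finB = independent_card_le_dim_forms(1)[OF hom(1) B(1,2)]
  define X where "X = B \<times> range (Var :: 3 \<Rightarrow> (3, 'a) mpoly)"
  have Var_eq: "Var i = (Var j :: (3, 'a) mpoly) \<longleftrightarrow> i = j" for i j :: 3
  proof
    assume eq: "Var i = (Var j :: (3, 'a) mpoly)"
    have "eval (Var i) (\<lambda>v. if v = i then 1 else 0 :: 'a) = eval (Var j) (\<lambda>v. if v = i then 1 else 0)"
      by (simp only: eq)
    then show "i = j" by (simp split: if_splits)
  qed simp
  have single_eq: "Poly_Mapping.single i (1 :: nat) = Poly_Mapping.single j 1 \<longleftrightarrow> i = j" for i j :: 3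
    by (metis lookup_single_eq lookup_single_not_eq zero_neq_one)
  have finX: "finite X" using finB by (simp add: X_def)
  have zero: "c x = 0" if 0: "(\<Sum>x\<in>X. pm_scale (c x) (fst x * snd x)) = 0" and x: "x \<in> X" for c x
  proof -
    define t where "t = (\<Sum>x\<in>X. Poly_Mapping.single x (c x))"
    have lookup_t: "Poly_Mapping.lookup t y = (if y \<in> X then c y else 0)" for y
      using finX by (simp add: t_def lookup_sum lookup_single when_def)
    have keys_t: "Poly_Mapping.keys t \<subseteq> X" by (auto simp: in_keys_iff lookup_t split: if_splits)
    have "mult t = 0"
      using 0 by (simp add: mult_superset[OF finX keys_t] lookup_t)
    moreover have "t \<in> free_on (sections I k) (sections UNIV 1)"
    proof -
      have "homogeneous 1 (Var j :: (3, 'a) mpoly)" for j by (rule homogeneous_Var)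
      then have "X \<subseteq> sections I k \<times> sections UNIV 1"
        using B(1) by (auto simp: X_def sections_def)
      with keys_t show ?thesis by (auto simp: free_on_def)
    qed
    ultimately have rel: "t \<in> tensor_relations (sections I k) (sections UNIV 1)"
      using inj by (auto simp: mu_injective_def)
    obtain f j where fj: "x = (f, Var j)" "f \<in> B" using x by (auto simp: X_def)
    define \<alpha> where "\<alpha> u = pm.representation B u f" for u
    define \<beta> where "\<beta> v = Poly_Mapping.lookup v (Poly_Mapping.single j 1)" for v :: "(3, 'a) mpoly"
    have "bilinear_value \<alpha> \<beta> t = 0"
    proof (rule bilinear_value_relations[OF _ _ _ _ rel])
      fix u u' and a :: 'a assume "u \<in> sections I k" "u' \<in> sections I k"
      then have "u \<in> pm.span B" "u' \<in> pm.span B" using B(3) by auto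
      then show "\<alpha> (u + u') = \<alpha> u + \<alpha> u'"
        by (simp add: \<alpha>_def pm.representation_add[OF B(2)])
    next
      fix u and a :: 'a assume "u \<in> sections I k"
      then have "u \<in> pm.span B" using B(3) by auto
      then show "\<alpha> (pm_scale a u) = a * \<alpha> u"
        by (simp add: \<alpha>_def pm.representation_scale[OF B(2)])
    qed (simp_all add: \<beta>_def lookup_add lookup_pm_scale)
    moreover have "bilinear_value \<alpha> \<beta> t = (\<Sum>y\<in>X. if y = x then c x else 0)"
      unfolding bilinear_value_superset[OF finX keys_t]
    proof (rule sum.cong[OF refl])
      fix y assume y: "y \<in> X"
      then obtain g i where gi: "y = (g, Var i)" "g \<in> B" by (auto simp: X_def)
      have "\<alpha> g = (if g = f then 1 else 0)"
        unfolding \<alpha>_def using pm.representation_basis[OF B(2) gi(2)] by auto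
      moreover have "\<beta> (Var i) = (if i = j then 1 else 0)"
        unfolding \<beta>_def Var_def lookup_single when_def single_eq by (rule refl)
      ultimately show "Poly_Mapping.lookup t y * (\<alpha> (fst y) * \<beta> (snd y)) = (if y = x then c x else 0)"
        using y by (auto simp: lookup_t gi fj Var_eq)
    qed
    ultimately show "c x = 0" using finX x by simp
  qed
  define G where "G = (\<lambda>x. fst x * snd x) ` X"
  have injX: "inj_on (\<lambda>x. fst x * snd x) X"
  proof (rule inj_onI, rule ccontr)
    fix x y assume xy: "x \<in> X" "y \<in> X" "fst x * snd x = fst y * snd y" "x \<noteq> y"
    define c :: "_ \<Rightarrow> 'a" where "c z = (if z = x then 1 else if z = y then -1 else 0)" for z
    have "(\<Sum>z\<in>X. pm_scale (c z) (fst z * snd z)) = (\<Sum>z\<in>{x, y}. pm_scale (c z) (fst z * snd z))"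
      by (rule sum.mono_neutral_right) (use finX xy in \<open>auto simp: c_def\<close>)
    also have "\<dots> = 0" using xy by (simp add: c_def)
    finally have "c x = 0" using zero xy(1) by blast
    then show False by (simp add: c_def)
  qed
  have "pm.independent G"
  proof (rule pm.independent_if_scalars_zero)
    show "finite G" using finX by (simp add: G_def)
    fix c x assume 0: "(\<Sum>x\<in>G. pm_scale (c x) x) = 0" and x: "x \<in> G"
    have "(\<Sum>y\<in>X. pm_scale (c (fst y * snd y)) (fst y * snd y)) = 0"
      using 0 unfolding G_def by (simp add: sum.reindex[OF injX])
    with x zero[of "\<lambda>y. c (fst y * snd y)"] show "c x = 0" by (auto simp: G_def)
  qed
  moreover have "G \<subseteq> image_mu"
  proof
    fix g assume "g \<in> G"
    then obtain f i where fi: "g = f * Var i" "f \<in> sections I k" using B(1) by (auto simp: G_def X_def)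
    then have "g = (\<Sum>j\<in>UNIV. Var j * (if j = i then f else 0))"
      by (simp add: if_distrib[of "\<lambda>x. _ * x"] mult.commute cong: if_cong)
    moreover have "(if j = i then f else 0) \<in> sections I k" for j
      using fi pm.subspace_0[OF subspace_sections[OF I]] by simp
    ultimately show "g \<in> image_mu" by (rule image_muI)
  qed
  ultimately have "card G \<le> pm.dim image_mu"
    using independent_card_le_dim_forms(2)[OF hom(2)] by blast
  moreover have "card G = 3 * card B"
  proof -
    have "card (range (Var :: 3 \<Rightarrow> (3, 'a) mpoly)) = 3"
      by (subst card_image) (auto simp: inj_on_def Var_eq)
    moreover have "card G = card X" unfolding G_def by (rule card_image[OF injX])
    ultimately show ?thesis by (simp add: X_def card_cartesian_product)
  qed
  ultimately show ?thesis by (simp add: B(4) h0_def)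
qed

section \<open>Non-maximal rank of the multiplication map\<close>

lemma integral_curve_degree_pos:
  assumes "integral_curve d (F :: (3, 'a::field) mpoly)"
  shows "d > 0"
proof (rule ccontr)
  assume "\<not> d > 0"
  then have F: "F = Const (Poly_Mapping.lookup F 0)" and irr: "irreducible F"
    using assms homogeneous_0_decompose by (auto simp: integral_curve_def)
  let ?c = "Poly_Mapping.lookup F 0"
  have "?c \<noteq> 0" using F irr by (metis Const_zero not_irreducible_zero)
  then have "Const ?c * Const (inverse ?c) = (1 :: (3, 'a) mpoly)" by (simp flip: Const_mult)
  then have "F dvd 1" using F by (metis dvd_triv_left)
  then show False using irr by (simp add: irreducible_def)
qed

text \<open>
  The general line of \<open>general_line\<close> does all that is required, provided the points are given by
  nonzero vectors.
\<close>

lemma rational_curve_fat_ideal: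
  fixes P :: "nat \<Rightarrow> 'a::alg_closed_field^3"
  assumes P: "\<And>i. i < n \<Longrightarrow> P i \<noteq> 0" and h1: "h1_vanishes (fat_ideal n P m) k"
    and F: "integral_curve d F" and par: "rational_parametrization d F \<phi>" and dk: "d \<le> k + 2"
  shows "\<exists>l. rational_curve \<phi> d k (fat_ideal n P m) l"
proof -
  obtain l where l: "homogeneous 1 l" "\<And>i. i < n \<Longrightarrow> eval l (($) (P i)) \<noteq> 0"
    "subst l (($) \<phi>) \<noteq> 0" "degree (dehom 1 (subst l (($) \<phi>))) = d"
    and surj: "\<And>y j. d \<le> j + 1 \<Longrightarrow>
      \<exists>g. homogeneous j g \<and> dehom 1 (subst l (($) \<phi>)) dvd y - dehom 1 (subst g (($) \<phi>))"
    using general_line[OF par, of n P] P by blast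
  have "\<exists>E. E \<in> fat_ideal n P m \<and> coprime_witness l v (\<Sum>i<n. m i) E" for v
    using fat_ideal_coprime[OF l(1), of n P m v] l(2) by blast
  then obtain E where E: "\<And>v. E v \<in> fat_ideal n P m" "\<And>v. coprime_witness l v (\<Sum>i<n. m i) (E v)"
    by metis
  have base: "\<exists>f\<in>sections (fat_ideal n P m) (k + 1). l dvd g - f" if g: "homogeneous (k + 1) g" for g
  proof -
    obtain f where "f \<in> sections (fat_ideal n P m) (k + 1)" "l dvd g - f"
      by (rule h1_vanishes_lift[OF subspace_fat_ideal fat_ideal_saturated[of n P, OF P] E h1 l(1) g])
    then show ?thesis ..
  qed
  have "rational_curve \<phi> d k (fat_ideal n P m) l"
  proof
    show "ideal.subspace (fat_ideal n P m)" by (rule subspace_fat_ideal)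
    show "homogeneous d (\<phi> $ j)" for j using par by (simp add: rational_parametrization_def)
    show "\<exists>j. eval (\<phi> $ j) (($) q) \<noteq> 0" if "q \<noteq> 0" for q
      using par that by (simp add: rational_parametrization_def)
    show "0 < d" by (rule integral_curve_degree_pos[OF F])
    show "\<exists>f\<in>sections (fat_ideal n P m) j. l dvd g - f" if "k + 1 \<le> j" "homogeneous j g" for j g
      by (rule lift_higher_degree[OF subspace_fat_ideal base that])
    show "\<exists>N. \<forall>v. \<exists>E A. E \<in> fat_ideal n P m \<and> Var v ^ N = E + l * A"
      using E unfolding coprime_witness_def by meson
  qed (use l surj dk in auto)
  then show ?thesis by blast
qed

text \<open>
  All tuples of points: the complement of the zero locus of the constant \<open>1\<close>.
\<close>

lemma zariski_open_nonzero: "zariski_open n {P :: nat \<Rightarrow> 'a::field^3. \<forall>i<n. P i \<noteq> 0}"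
proof -
  have "multihomogeneous n (1 :: (nat \<times> 3, 'a) mpoly)"
    by (auto simp: multihomogeneous_def intro!: exI[of _ "\<lambda>_. 0"])
  then show ?thesis
    unfolding zariski_open_def
    by (intro exI[of _ "{1}"]) (simp add: ring_map.one[OF ring_map_eval])
qed

theorem corollary5p3:
  fixes k n :: nat
  assumes "k \<ge> 1"
  shows "for_general_points n (\<lambda>P :: nat \<Rightarrow> 'a::alg_closed_field^3.
    \<forall>m :: nat \<Rightarrow> nat.
      h1_vanishes (fat_ideal n P m) k \<and>
      (\<exists>d F r \<phi>.
         integral_curve d F \<and>
         (\<forall>i<n. multiplicity_at F (P i) (r i)) \<and>
         smooth_strict_transform n P r F \<and>
         rational_parametrization d F \<phi> \<and>
         d \<le> k + 2 \<and>
         (\<forall>i<n. int (r i) - 1 \<le> int (m i)) \<and>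
         int (delta0 d \<phi> (fat_ideal n P m) k) > exp_dim_cok_mu (fat_ideal n P m) k)
      \<longrightarrow> \<not> mu_injective (fat_ideal n P m) k \<and> \<not> mu_surjective (fat_ideal n P m) k)"
  unfolding for_general_points_def
proof (intro exI conjI ballI allI impI)
  let ?U = "{P :: nat \<Rightarrow> 'a^3. \<forall>i<n. P i \<noteq> 0}"
  show "zariski_open n ?U" by (rule zariski_open_nonzero)
  have "(\<lambda>_. axis 1 1) \<in> ?U" by (simp add: axis_eq_0_iff)
  then show "?U \<noteq> {}" by (intro ex_in_conv[THEN iffD1] exI)
  fix P :: "nat \<Rightarrow> 'a^3" and m :: "nat \<Rightarrow> nat"
  let ?I = "fat_ideal n P m"
  assume P: "P \<in> ?U"
  assume A: "h1_vanishes ?I k \<and>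
      (\<exists>d F r \<phi>. integral_curve d F \<and> (\<forall>i<n. multiplicity_at F (P i) (r i)) \<and>
         smooth_strict_transform n P r F \<and> rational_parametrization d F \<phi> \<and> d \<le> k + 2 \<and>
         (\<forall>i<n. int (r i) - 1 \<le> int (m i)) \<and>
         int (delta0 d \<phi> ?I k) > exp_dim_cok_mu ?I k)"
  then obtain d F \<phi> where *: "h1_vanishes ?I k" "integral_curve d F" "rational_parametrization d F \<phi>"
    "d \<le> k + 2" "int (delta0 d \<phi> ?I k) > exp_dim_cok_mu ?I k"
    by blast
  obtain l where "rational_curve \<phi> d k ?I l"
    using rational_curve_fat_ideal[OF _ *(1-4)] P by blast
  then interpret rational_curve \<phi> d k ?I l .
  have delta: "delta0 d \<phi> ?I k + pm.dim image_mu \<le> h0 ?I (k + 1)" by (rule delta0_le)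
  show "\<not> mu_injective ?I k"
    using dim_image_mu delta *(5) by (auto simp: exp_dim_cok_mu_def)
  show "\<not> mu_surjective ?I k"
  proof
    assume surj_mu: "mu_surjective ?I k"
    have "sections ?I (k + 1) \<subseteq> image_mu"
      unfolding surj_mu[unfolded mu_surjective_def, symmetric]
      by (rule image_subsetI) (rule mult_in_image_mu)
    with image_mu_subset have "image_mu = sections ?I (k + 1)" by (rule subset_antisym)
    then show False using delta *(5) by (simp add: exp_dim_cok_mu_def h0_def)
  qed
qed

end
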